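(* Let $\boldsymbol{\mu}=(\mu_1,\dots,\mu_N)\in(\mathbb{T}\setminus\{1\})^N$ and $Q,P_1,\dots,P_T\in\mathbb{R}[X_1,\dots,X_N]$. Assume that $P_1,\dots,P_T$ are hypoelliptic and that at least one of them is not constant. Then $Z(Q;P_1,\dots,P_T;\boldsymbol{\mu};\cdot)$ can be holomorphically extended to $\mathbb{C}^T$. Let $\mathbf{a}\in\mathbb{N}^N$, and set $$E(\mathbf{a})=\{\mathbf{m}\in(\mathbb{N}^* )^N:\ \mathbf{m}\ngeq\mathbf{a}+\mathbf{1}\}=\{\mathbf{m}\in(\mathbb{N}^* )^N:\ \exists n\in\{1,\dots,N\},\ m_n\le a_n\}.$$ Then for all $\mathbf{k}=(k_1,\dots,k_T)\in\mathbb{N}^T$ the following relation holds: $$\begin{aligned}(1-\boldsymbol{\mu}^{\mathbf{a}})\,Z(Q;P_1,\dots,P_T;\boldsymbol{\mu};-\mathbf{k})={}&\boldsymbol{\mu}^{\mathbf{a}}\sum_{\mathbf{0}\le\mathbf{u}<\mathbf{k}}\binom{\mathbf{k}}{\mathbf{u}}\,Z\Big(Q(\mathbf{X}+\mathbf{a})\prod_{t=1}^T(\Delta_{\mathbf{a}}P_t)^{k_t-u_t};P_1,\dots,P_T;\boldsymbol{\mu};-\mathbf{u}\Big)\\&+\boldsymbol{\mu}^{\mathbf{a}}\,Z(\Delta_{\mathbf{a}}Q;P_1,\dots,P_T;\boldsymbol{\mu};-\mathbf{k})+Z_{N-1}^{\mathbf{a}}(-\mathbf{k}),\end{aligned}$$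 where $$Z_{N-1}^{\mathbf{a}}(\mathbf{s})=\sum_{\mathbf{m}\in E(\mathbf{a})}\boldsymbol{\mu}^{\mathbf{m}}\,Q(\mathbf{m})\prod_{t=1}^T P_t(\mathbf{m})^{-s_t}.$$ Moreover $$Z_{N-1}^{\mathbf{a}}(\mathbf{s})=\sum_{q=1}^{N-1}\ \sum_{\substack{I\subset\{1,\dots,N\}\\ \#I=q}}\ \sum_{\mathbf{b}=(b_i)\in\prod_{i\in I^c}\{0,\dots,a_i\}}\Big(\prod_{i\in I^c}\mu_i^{b_i}\Big)\,Z\big(Q^{\mathbf{a},I,\mathbf{b}};P_1^{\mathbf{a},I,\mathbf{b}},\dots,P_T^{\mathbf{a},I,\mathbf{b}};(\mu_i)_{i\in I};\mathbf{s}\big).$$ In particular, $Z_{N-1}^{\mathbf{a}}$ is a finite linear combination of zeta series $Z$ associated to hypoelliptic polynomials of at most $N-1$ variables.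
   Context: Here $N,T\ge1$ are integers. Notation: $\mathbb{N}=\{0,1,2,\dots\}$, $\mathbb{N}^*=\mathbb{N}\setminus\{0\}$, $J=[1,+\infty[$, $\mathbb{T}=\{z\in\mathbb{C}:|z|=1\}$ (not to be confused with the integer $T$), $\mathbf{0}=(0,\dots,0)$, $\mathbf{1}=(1,\dots,1)$, $|\mathbf{x}|=|x_1|+\dots+|x_N|$, $\mathbf{z}^{\mathbf{m}}=\prod_n z_n^{m_n}$. Hypoelliptic: $P\in\mathbb{R}[X_1,\dots,X_N]$ is hypoelliptic if $P(\mathbf{x})>0$ for all $\mathbf{x}\in J^N$ and, for every $\boldsymbol{\alpha}\in\mathbb{N}^N\setminus\{\mathbf{0}\}$, $\frac{\partial^{\boldsymbol{\alpha}}P}{P}(\mathbf{x})\to0$ as $|\mathbf{x}|\to+\infty$ with $\mathbf{x}\in J^N$. Zeta series: for $\mathbf{s}=(s_1,\dots,s_T)\in\mathbb{C}^T$, $$Z(Q;P_1,\dots,P_T;\boldsymbol{\mu};\mathbf{s})=\sum_{\mathbf{m}\in(\mathbb{N}^* )^N}\boldsymbol{\mu}^{\mathbf{m}}\,Q(\mathbf{m})\prod_{t=1}^T P_t(\mathbf{m})^{-s_t},$$ absolutely convergent when $\Re(s_1),\dots,\Re(s_T)$ are sufficiently large. The same notation is used for holomorphic continuations, and likewise for $Z_{N-1}^{\mathbf{a}}$; values at negative integers are those of the continuations. Differences: $\Delta_{\mathbf{a}}P(\mathbf{X})=P(\mathbf{X}+\mathbf{a})-P(\mathbf{X})$. Multi-indices: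 $\mathbf{0}\le\mathbf{u}<\mathbf{k}$ means $\mathbf{u}\in\mathbb{N}^T$, $u_t\le k_t$ for all $t$ and $\mathbf{u}\ne\mathbf{k}$; $\binom{\mathbf{k}}{\mathbf{u}}=\prod_{t=1}^T\binom{k_t}{u_t}$. Restricted functions: let $I=\{i_1,\dots,i_q\}\subset\{1,\dots,N\}$ with $q=\#I$, $I^c=\{1,\dots,N\}\setminus I=\{j_1,\dots,j_{N-q}\}$ and $\mathbf{b}=(b_i)_{i\in I^c}\in\prod_{i\in I^c}\{0,\dots,a_i\}$. For $f:\mathbb{N}^N\to\mathbb{C}$, the function $f^{\mathbf{a},I,\mathbf{b}}:\mathbb{N}^q\to\mathbb{C}$ is $f^{\mathbf{a},I,\mathbf{b}}(d_1,\dots,d_q)=f(m_1,\dots,m_N)$ with $m_{i_k}=a_{i_k}+d_k$ for $k=1,\dots,q$ and $m_{j_k}=b_{j_k}$ for $k=1,\dots,N-q$.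
   Formalization: The "Moreover" formula is false as printed (N=1, a=1, Q=1, P=X: empty sum, but Z_0^a=μ). It is proved in corrected form: q runs from 0 to N-1, b_i over {1,…,a_i}, and each term has the additional factor ∏_{i∈I} μ_i^{a_i}. *)

theory Defs
  imports "HOL-Analysis.Analysis" "HOL-Library.Poly_Mapping"
begin

section \<open>Real polynomials in several variables\<close>

text \<open>
  A monomial is a finitely supported exponent function. The variables are \<open>X\<^sub>1, X\<^sub>2, \<dots>\<close>, and
  \<open>polys N\<close> is the ring of real polynomials in \<open>X\<^sub>1, \<dots>, X\<^sub>N\<close>. The number of variables is a
  natural number rather than a type, because the restricted polynomials below have fewer variables.
\<close>

type_synonym mpoly = "(nat \<Rightarrow>\<^sub>0 nat) \<Rightarrow>\<^sub>0 real"

definition polys :: "nat \<Rightarrow> mpoly set" where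
  "polys N = {p. \<forall>\<beta>\<in>Poly_Mapping.keys p. Poly_Mapping.keys \<beta> \<subseteq> {1..N}}"

definition Const :: "real \<Rightarrow> mpoly" where
  "Const c = Poly_Mapping.single 0 c"

definition Var :: "nat \<Rightarrow> mpoly" where
  "Var i = Poly_Mapping.single (Poly_Mapping.single i 1) 1"

definition mpoly_eval :: "mpoly \<Rightarrow> (nat \<Rightarrow> real) \<Rightarrow> real" where
  "mpoly_eval p x = (\<Sum>\<beta>\<in>Poly_Mapping.keys p. Poly_Mapping.lookup p \<beta> *
      (\<Prod>i\<in>Poly_Mapping.keys \<beta>. x i ^ Poly_Mapping.lookup \<beta> i))"

definition mpoly_subst :: "mpoly \<Rightarrow> (nat \<Rightarrow> mpoly) \<Rightarrow> mpoly" where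
  "mpoly_subst p \<sigma> = (\<Sum>\<beta>\<in>Poly_Mapping.keys p. Const (Poly_Mapping.lookup p \<beta>) *
      (\<Prod>i\<in>Poly_Mapping.keys \<beta>. \<sigma> i ^ Poly_Mapping.lookup \<beta> i))"

definition partial_deriv :: "nat \<Rightarrow> mpoly \<Rightarrow> mpoly" where
  "partial_deriv i p = (\<Sum>\<beta>\<in>Poly_Mapping.keys p.
      Poly_Mapping.single (\<beta> - Poly_Mapping.single i 1)
        (Poly_Mapping.lookup p \<beta> * real (Poly_Mapping.lookup \<beta> i)))"

definition mixed_deriv :: "nat \<Rightarrow> (nat \<Rightarrow>\<^sub>0 nat) \<Rightarrow> mpoly \<Rightarrow> mpoly" where
  "mixed_deriv N \<alpha> = fold (\<lambda>i. partial_deriv i ^^ Poly_Mapping.lookup \<alpha> i) [1..<Suc N]"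

definition shift_poly :: "(nat \<Rightarrow> nat) \<Rightarrow> mpoly \<Rightarrow> mpoly" where
  "shift_poly a p = mpoly_subst p (\<lambda>i. Var i + Const (real (a i)))"

definition diff_poly :: "(nat \<Rightarrow> nat) \<Rightarrow> mpoly \<Rightarrow> mpoly" where
  "diff_poly a p = shift_poly a p - p"

text \<open>
  For a finite set \<open>I = {i\<^sub>1 < \<dots> < i\<^sub>q}\<close>, \<open>idx I k\<close> is \<open>i\<^sub>k\<close>, and conversely the \<open>k\<close> with
  \<open>i = i\<^sub>k\<close> is the number of elements of \<open>I\<close> that are at most \<open>i\<close>.
  So \<open>restrict_poly a I b p\<close> is the polynomial in \<open>X\<^sub>1, \<dots>, X\<^sub>q\<close> obtained from \<open>p\<close> by replacing
  the variable of index \<open>i\<^sub>k\<close> by \<open>a i\<^sub>k + X\<^sub>k\<close>, and the variables of index \<open>j\<close> outside \<open>I\<close> by \<open>b j\<close>.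
\<close>

definition idx :: "nat set \<Rightarrow> nat \<Rightarrow> nat" where
  "idx I k = sorted_list_of_set I ! (k - 1)"

definition restrict_poly :: "(nat \<Rightarrow> nat) \<Rightarrow> nat set \<Rightarrow> (nat \<Rightarrow> nat) \<Rightarrow> mpoly \<Rightarrow> mpoly" where
  "restrict_poly a I b p = mpoly_subst p
     (\<lambda>i. if i \<in> I then Const (real (a i)) + Var (card {j\<in>I. j \<le> i}) else Const (real (b i)))"


section \<open>Hypoelliptic polynomials\<close>

definition hypoelliptic :: "nat \<Rightarrow> mpoly \<Rightarrow> bool" where
  "hypoelliptic N p \<longleftrightarrow> p \<in> polys N \<and>
     (\<forall>x \<in> {1..N} \<rightarrow>\<^sub>E {1..}. mpoly_eval p x > 0) \<and>
     (\<forall>\<alpha>. Poly_Mapping.keys \<alpha> \<subseteq> {1..N} \<and> \<alpha> \<noteq> 0 \<longrightarrow>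
        ((\<lambda>x. mpoly_eval (mixed_deriv N \<alpha> p) x / mpoly_eval p x) \<longlongrightarrow> 0)
          (inf (filtercomap (\<lambda>x. \<Sum>n=1..N. \<bar>x n\<bar>) at_top) (principal ({1..N} \<rightarrow>\<^sub>E {1..}))))"


section \<open>Zeta series and their holomorphic continuations\<close>

definition mu_power :: "nat \<Rightarrow> (nat \<Rightarrow> complex) \<Rightarrow> (nat \<Rightarrow> nat) \<Rightarrow> complex" where
  "mu_power N \<mu> m = (\<Prod>n=1..N. \<mu> n ^ m n)"

definition zeta_term ::
  "nat \<Rightarrow> mpoly \<Rightarrow> ('t::finite \<Rightarrow> mpoly) \<Rightarrow> (nat \<Rightarrow> complex) \<Rightarrow> complex ^ 't \<Rightarrow> (nat \<Rightarrow> nat) \<Rightarrow> complex"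
  where
  "zeta_term N Q P \<mu> s m = mu_power N \<mu> m * of_real (mpoly_eval Q (\<lambda>n. real (m n))) *
     (\<Prod>t\<in>UNIV. of_real (mpoly_eval (P t) (\<lambda>n. real (m n))) powr (- (s $ t)))"

text \<open>Holomorphy on the whole space of \<open>T\<close>-tuples: the Frechet derivative is complex linear.\<close>

definition entire :: "(complex ^ 't::finite \<Rightarrow> complex) \<Rightarrow> bool" where
  "entire F \<longleftrightarrow> (\<forall>s. \<exists>D. (F has_derivative D) (at s) \<and> (\<forall>c v. D (c *s v) = c * D v))"

definition continues_series ::
  "'m set \<Rightarrow> (complex ^ 't::finite \<Rightarrow> 'm \<Rightarrow> complex) \<Rightarrow> (complex ^ 't \<Rightarrow> complex) \<Rightarrow> bool" where
  "continues_series A f F \<longleftrightarrow> entire F \<and>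
     (\<exists>\<sigma>::real. \<forall>s. (\<forall>t. Re (s $ t) > \<sigma>) \<longrightarrow>
        (\<lambda>m. norm (f s m)) summable_on A \<and> (f s has_sum F s) A)"

text \<open>
  By the identity theorem there is at most one such function, so the value of \<open>continuation\<close> is
  meaningful whenever one exists.
\<close>

definition continuation ::
  "'m set \<Rightarrow> (complex ^ 't::finite \<Rightarrow> 'm \<Rightarrow> complex) \<Rightarrow> complex ^ 't \<Rightarrow> complex" where
  "continuation A f = (THE F. continues_series A f F)"

text \<open>
  For \<open>N = 0\<close> the index set has exactly one element, and the zeta series is a single term.
\<close>

definition pos_tuples :: "nat \<Rightarrow> (nat \<Rightarrow> nat) set" where
  "pos_tuples N = {1..N} \<rightarrow>\<^sub>E {1..}"

definition zeta ::
  "nat \<Rightarrow> mpoly \<Rightarrow> ('t::finite \<Rightarrow> mpoly) \<Rightarrow> (nat \<Rightarrow> complex) \<Rightarrow> complex ^ 't \<Rightarrow> complex" where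
  "zeta N Q P \<mu> = continuation (pos_tuples N) (zeta_term N Q P \<mu>)"

definition E_set :: "nat \<Rightarrow> (nat \<Rightarrow> nat) \<Rightarrow> (nat \<Rightarrow> nat) set" where
  "E_set N a = {m \<in> pos_tuples N. \<exists>n\<in>{1..N}. m n \<le> a n}"

definition zeta_E ::
  "nat \<Rightarrow> (nat \<Rightarrow> nat) \<Rightarrow> mpoly \<Rightarrow> ('t::finite \<Rightarrow> mpoly) \<Rightarrow> (nat \<Rightarrow> complex) \<Rightarrow> complex ^ 't \<Rightarrow> complex"
  where
  "zeta_E N a Q P \<mu> = continuation (E_set N a) (zeta_term N Q P \<mu>)"

definition neg_point :: "('t::finite \<Rightarrow> nat) \<Rightarrow> complex ^ 't" where
  "neg_point k = (\<chi> t. - of_nat (k t))"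

end

theory Submission
  imports Defs "HOL-Complex_Analysis.Complex_Analysis"
begin

text \<open>
  The continuation is obtained as an Abel limit: its value at \<open>s\<close> is the limit for \<open>r \<longlongrightarrow> 1\<close> of the series damped
  by \<open>r\<close> to the power \<open>|m|\<close>. Summation by parts in the last variable replaces the summand by its difference and a boundary
  series with one variable less. Since \<open>\<mu>\<^sub>N \<noteq> 1\<close>, iterating this reduces the claim to series of high order differences, and
  these converge absolutely and locally uniformly in \<open>s\<close>, because the summand extends holomorphically to discs of
  radius \<open>|m|\<^sup>\<kappa>\<close> in one variable, on which Cauchy's estimate applies. At negative integers the relation then only
  expresses that the damped series over all \<open>m\<close> splits into the part over \<open>E(a)\<close> and a translate.

  The discs, and the absolute convergence, need the quantitative form \<open>\<partial>\<^sup>\<alpha>P = O(P |x|\<^sup>-\<^sup>\<epsilon>)\<close> of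
  hypoellipticity. It is a Lojasiewicz inequality at infinity, proved here without quantifier elimination: the largest
  \<open>|x|\<close> on a level set of \<open>f / g\<close> is approached by critical points of a penalised polynomial whose leading form is a sum of
  powers, and at those points all polynomials are combinations of finitely many monomials, which yields an algebraic relation between
  the level and the largest \<open>|x|\<close>.
\<close>

no_notation fps_nth (infixl \<open>$\<close> 75)

section \<open>Polynomials in several variables\<close>

text \<open>At -k the series diverge in general, so the relation cannot be read off termwise from a
  convergent sum. Damping by the total weight repairs this: a translation changes the weight by a
  constant, whose factor \<open>r ^ k\<close> tends to 1, and cutting the index set cuts damped sums
  that converge absolutely. Where the series itself converges absolutely its Abel limit is its sum,
  and this identifies Abel limits with the continuation.

  The obstacle in the Lojasiewicz inequality is that the critical points of |x|^2 on a level set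
  need not be isolated, so that eliminating the variables may give only the trivial relation. A
  small multiple of a sum of high even powers gives each critical equation a pure power as leading
  term. The price is two auxiliary parameters: a relation with parameters could degenerate in the
  limit, hence common powers of them are divided out first. The substitution x_i = 1 + v_i^2 unfolds
  the orthant to the whole space, so that all extrema are interior; a level set f / g = d with d
  \<noteq> 0 is bounded because f / g tends to 0.\<close>

definition mono_eval :: "(nat \<Rightarrow>\<^sub>0 nat) \<Rightarrow> (nat \<Rightarrow> 'a::real_normed_field) \<Rightarrow> 'a" where
  "mono_eval \<beta> x = (\<Prod>i\<in>Poly_Mapping.keys \<beta>. x i ^ Poly_Mapping.lookup \<beta> i)"

text \<open>The point may lie in any real normed field: inequalities are wanted at real points,
  holomorphy in one variable at complex ones.\<close>

definition peval :: "mpoly \<Rightarrow> (nat \<Rightarrow> 'a::real_normed_field) \<Rightarrow> 'a" where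
  "peval p x = (\<Sum>\<beta>\<in>Poly_Mapping.keys p. of_real (Poly_Mapping.lookup p \<beta>) * mono_eval \<beta> x)"

lemma mpoly_eval_eq_peval: "mpoly_eval p x = peval p x"
  by (simp add: mpoly_eval_def peval_def mono_eval_def)

lemma mono_eval_superset:
  assumes "finite S" "Poly_Mapping.keys \<beta> \<subseteq> S"
  shows "mono_eval \<beta> x = (\<Prod>i\<in>S. x i ^ Poly_Mapping.lookup \<beta> i)"
  unfolding mono_eval_def
  by (rule prod.mono_neutral_left) (use assms in \<open>auto simp: in_keys_iff\<close>)

lemma mono_eval_0 [simp]: "mono_eval 0 x = 1"
  by (simp add: mono_eval_def)

lemma mono_eval_add: "mono_eval (\<beta> + \<gamma>) x = mono_eval \<beta> x * mono_eval \<gamma> x"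
proof -
  let ?S = "Poly_Mapping.keys \<beta> \<union> Poly_Mapping.keys \<gamma>"
  have "mono_eval (\<beta> + \<gamma>) x = (\<Prod>i\<in>?S. x i ^ Poly_Mapping.lookup (\<beta> + \<gamma>) i)"
    by (rule mono_eval_superset) (use keys_add[of \<beta> \<gamma>] in auto)
  also have "\<dots> = mono_eval \<beta> x * mono_eval \<gamma> x"
    by (subst (1 2) mono_eval_superset[where S = ?S])
       (auto simp: lookup_add power_add prod.distrib)
  finally show ?thesis .
qed

lemma peval_superset:
  assumes "finite S" "Poly_Mapping.keys p \<subseteq> S"
  shows "peval p x = (\<Sum>\<beta>\<in>S. of_real (Poly_Mapping.lookup p \<beta>) * mono_eval \<beta> x)"
  unfolding peval_def
  by (rule sum.mono_neutral_left) (use assms in \<open>auto simp: in_keys_iff\<close>)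

lemma peval_0 [simp]: "peval 0 x = 0"
  by (simp add: peval_def)

lemma peval_add: "peval (p + q) x = peval p x + peval q x"
proof -
  let ?S = "Poly_Mapping.keys p \<union> Poly_Mapping.keys q"
  have "peval (p + q) x = (\<Sum>\<beta>\<in>?S. of_real (Poly_Mapping.lookup (p + q) \<beta>) * mono_eval \<beta> x)"
    by (rule peval_superset) (use keys_add[of p q] in auto)
  also have "\<dots> = peval p x + peval q x"
    by (subst (1 2) peval_superset[where S = ?S])
       (auto simp: lookup_add algebra_simps sum.distrib)
  finally show ?thesis .
qed

lemma peval_uminus: "peval (- p) x = - peval p x"
  using peval_add[of p "- p" x] by (simp add: add_eq_0_iff)

lemma peval_diff: "peval (p - q) x = peval p x - peval q x"
  using peval_add[of p "- q" x] by (simp add: peval_uminus)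

lemma peval_sum: "peval (sum f S) x = (\<Sum>i\<in>S. peval (f i) x)"
  by (induction S rule: infinite_finite_induct) (auto simp: peval_add)

lemma peval_single [simp]: "peval (Poly_Mapping.single \<beta> c) x = of_real c * mono_eval \<beta> x"
  by (cases "c = 0") (simp_all add: peval_def)

lemma mpoly_expand: "p = (\<Sum>\<beta>\<in>Poly_Mapping.keys p. Poly_Mapping.single \<beta> (Poly_Mapping.lookup p \<beta>))"
  for p :: "'a \<Rightarrow>\<^sub>0 'b::comm_monoid_add"
proof (rule poly_mapping_eqI)
  fix k
  have "Poly_Mapping.lookup (\<Sum>\<beta>\<in>Poly_Mapping.keys p. Poly_Mapping.single \<beta> (Poly_Mapping.lookup p \<beta>)) k
     = (\<Sum>\<beta>\<in>Poly_Mapping.keys p. if \<beta> = k then Poly_Mapping.lookup p \<beta> else 0)"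
    unfolding lookup_sum by (intro sum.cong) (auto simp: lookup_single when_def)
  also have "\<dots> = Poly_Mapping.lookup p k"
    by (simp add: in_keys_iff)
  finally show "Poly_Mapping.lookup p k = Poly_Mapping.lookup (\<Sum>\<beta>\<in>Poly_Mapping.keys p. Poly_Mapping.single \<beta> (Poly_Mapping.lookup p \<beta>)) k"
    by simp
qed

lemma peval_mult: "peval (p * q) x = peval p x * peval q x"
proof -
  have "p * q = (\<Sum>\<beta>\<in>Poly_Mapping.keys p. \<Sum>\<gamma>\<in>Poly_Mapping.keys q.
      Poly_Mapping.single (\<beta> + \<gamma>) (Poly_Mapping.lookup p \<beta> * Poly_Mapping.lookup q \<gamma>))"
    by (subst mpoly_expand[of p], subst mpoly_expand[of q]) (simp add: sum_product mult_single)
  then show ?thesis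
    by (simp add: peval_sum peval_def[of p] peval_def[of q] sum_product mono_eval_add algebra_simps)
qed

lemma peval_Const [simp]: "peval (Const c) x = of_real c"
  by (simp add: Const_def)

lemma peval_1 [simp]: "peval 1 x = 1"
  using peval_Const[of 1 x] by (simp add: Const_def)

lemma peval_Var [simp]: "peval (Var i) x = x i"
  by (simp add: Var_def mono_eval_def)

lemma peval_power: "peval (p ^ n) x = peval p x ^ n"
  by (induction n) (auto simp: peval_mult)

lemma peval_prod: "peval (prod f S) x = (\<Prod>i\<in>S. peval (f i) x)"
  by (induction S rule: infinite_finite_induct) (auto simp: peval_mult)

lemma peval_subst: "peval (mpoly_subst p \<sigma>) x = peval p (\<lambda>i. peval (\<sigma> i) x)"
  by (simp add: mpoly_subst_def peval_sum peval_mult peval_prod peval_power peval_def[of p] mono_eval_def)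

lemma peval_of_real: "peval p (\<lambda>i. of_real (x i)) = of_real (peval p x)"
  by (simp add: peval_def mono_eval_def)

lemma peval_cong:
  assumes "p \<in> polys N" "\<And>i. i \<in> {1..N} \<Longrightarrow> x i = y i"
  shows "peval p x = peval p y"
proof -
  have "mono_eval \<beta> x = mono_eval \<beta> y" if "\<beta> \<in> Poly_Mapping.keys p" for \<beta>
    unfolding mono_eval_def
  proof (rule prod.cong)
    fix i assume "i \<in> Poly_Mapping.keys \<beta>"
    then have "i \<in> {1..N}" using that assms(1) unfolding polys_def by blast
    then show "x i ^ Poly_Mapping.lookup \<beta> i = y i ^ Poly_Mapping.lookup \<beta> i" using assms(2) by simp
  qed simp
  then show ?thesis unfolding peval_def by (intro sum.cong) auto
qed

section \<open>Polynomials in the first N variables\<close>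

lemma polys_0 [simp]: "0 \<in> polys N" and polys_1 [simp]: "1 \<in> polys N"
  and polys_Const [simp]: "Const c \<in> polys N"
  by (auto simp: polys_def Const_def)

lemma polys_single: "Poly_Mapping.keys \<beta> \<subseteq> {1..N} \<Longrightarrow> Poly_Mapping.single \<beta> c \<in> polys N"
  by (auto simp: polys_def)

lemma polys_Var: "i \<in> {1..N} \<Longrightarrow> Var i \<in> polys N"
  unfolding Var_def by (rule polys_single) auto

lemma polys_add: "p \<in> polys N \<Longrightarrow> q \<in> polys N \<Longrightarrow> p + q \<in> polys N"
  using keys_add[of p q] by (fastforce simp: polys_def)

lemma polys_uminus: "p \<in> polys N \<Longrightarrow> - p \<in> polys N"
  by (auto simp: polys_def in_keys_iff)

lemma polys_diff: "p \<in> polys N \<Longrightarrow> q \<in> polys N \<Longrightarrow> p - q \<in> polys N"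
  using polys_add[of p N "- q"] polys_uminus[of q N] by simp

lemma polys_mult: 
  assumes "p \<in> polys N" "q \<in> polys N"
  shows "p * q \<in> polys N"
  unfolding polys_def
proof safe
  fix \<beta> i assume "\<beta> \<in> Poly_Mapping.keys (p * q)" "i \<in> Poly_Mapping.keys \<beta>"
  then obtain a b where "\<beta> = a + b" "a \<in> Poly_Mapping.keys p" "b \<in> Poly_Mapping.keys q"
    using keys_mult[of p q] by auto
  then show "i \<in> {1..N}"
    using assms \<open>i \<in> Poly_Mapping.keys \<beta>\<close> keys_add[of a b] unfolding polys_def by blast
qed

lemma polys_power: "p \<in> polys N \<Longrightarrow> p ^ n \<in> polys N"
  by (induction n) (auto intro: polys_mult)

lemma polys_sum: "(\<And>i. i \<in> S \<Longrightarrow> f i \<in> polys N) \<Longrightarrow> sum f S \<in> polys N"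
  by (induction S rule: infinite_finite_induct) (auto intro: polys_add)

lemma polys_prod: "(\<And>i. i \<in> S \<Longrightarrow> f i \<in> polys N) \<Longrightarrow> prod f S \<in> polys N"
  by (induction S rule: infinite_finite_induct) (auto intro: polys_mult)

lemma polys_subst:
  assumes "p \<in> polys N" "\<And>i. i \<in> {1..N} \<Longrightarrow> \<sigma> i \<in> polys M"
  shows "mpoly_subst p \<sigma> \<in> polys M"
  unfolding mpoly_subst_def
proof (intro polys_sum polys_mult polys_Const polys_prod polys_power assms(2))
  fix \<beta> i assume "\<beta> \<in> Poly_Mapping.keys p" "i \<in> Poly_Mapping.keys \<beta>"
  then show "i \<in> {1..N}" using assms(1) unfolding polys_def by blast
qed

lemma polys_shift: "p \<in> polys N \<Longrightarrow> shift_poly a p \<in> polys N"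
  unfolding shift_poly_def by (erule polys_subst) (intro polys_add polys_Var polys_Const)

lemma polys_diff_poly: "p \<in> polys N \<Longrightarrow> diff_poly a p \<in> polys N"
  unfolding diff_poly_def by (intro polys_diff polys_shift)

lemma peval_shift: "peval (shift_poly a p) x = peval p (\<lambda>i. x i + of_nat (a i))"
  by (simp add: shift_poly_def peval_subst peval_add)

lemma peval_restrict:
  "peval (restrict_poly a I b p) x =
     peval p (\<lambda>i. if i \<in> I then of_nat (a i) + x (card {j\<in>I. j \<le> i}) else of_nat (b i))"
  unfolding restrict_poly_def peval_subst
  by (intro arg_cong[of _ _ "peval p"] ext) (auto simp: peval_add)

section \<open>Formal partial derivatives\<close>

lemma lookup_partial_deriv:
  "Poly_Mapping.lookup (partial_deriv i p) \<gamma> =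
     Poly_Mapping.lookup p (\<gamma> + Poly_Mapping.single i 1) * real (Suc (Poly_Mapping.lookup \<gamma> i))"
proof -
  let ?e = "Poly_Mapping.single i (1::nat)"
  have eq: "(Poly_Mapping.lookup p \<beta> * real (Poly_Mapping.lookup \<beta> i) when \<beta> - ?e = \<gamma>)
      = (if \<beta> = \<gamma> + ?e then Poly_Mapping.lookup p \<beta> * real (Poly_Mapping.lookup \<beta> i) else 0)" for \<beta>
  \<comment> \<open>Subtraction of exponents is truncated. If the variable does not occur in
    \<open>\<beta>\<close>, then \<open>\<beta> - ?e\<close> is \<open>\<beta>\<close> and may equal
    \<open>\<gamma>\<close>, but then the coefficient has the factor 0.\<close>
  proof (cases "Poly_Mapping.lookup \<beta> i = 0")
    case True
    then have "\<beta> \<noteq> \<gamma> + ?e" by (auto simp: lookup_add)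
    then show ?thesis using True by simp
  next
    case False
    have "\<beta> - ?e + ?e = \<beta>"
      by (rule poly_mapping_eqI) (use False in \<open>auto simp: lookup_add lookup_minus lookup_single when_def\<close>)
    then have "\<beta> - ?e = \<gamma> \<longleftrightarrow> \<beta> = \<gamma> + ?e" by (metis add_diff_cancel_right')
    then show ?thesis by (simp add: when_def)
  qed
  have "Poly_Mapping.lookup (partial_deriv i p) \<gamma> = (\<Sum>\<beta>\<in>Poly_Mapping.keys p.
      if \<beta> = \<gamma> + ?e then Poly_Mapping.lookup p \<beta> * real (Poly_Mapping.lookup \<beta> i) else 0)"
    unfolding partial_deriv_def lookup_sum lookup_single eq ..
  also have "\<dots> = Poly_Mapping.lookup p (\<gamma> + ?e) * real (Suc (Poly_Mapping.lookup \<gamma> i))"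
    by (simp add: in_keys_iff lookup_add)
  finally show ?thesis .
qed

lemma polys_partial_deriv:
  assumes "p \<in> polys N" shows "partial_deriv i p \<in> polys N"
  unfolding polys_def
proof safe
  fix \<gamma> k assume "\<gamma> \<in> Poly_Mapping.keys (partial_deriv i p)" and k: "k \<in> Poly_Mapping.keys \<gamma>"
  then have "\<gamma> + Poly_Mapping.single i 1 \<in> Poly_Mapping.keys p"
    by (auto simp: in_keys_iff lookup_partial_deriv)
  moreover have "k \<in> Poly_Mapping.keys (\<gamma> + Poly_Mapping.single i 1)"
    using k by (auto simp: in_keys_iff lookup_add)
  ultimately show "k \<in> {1..N}" using assms unfolding polys_def by blast
qed

lemma polys_partial_deriv_iter: "p \<in> polys N \<Longrightarrow> (partial_deriv i ^^ n) p \<in> polys N"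
  by (induction n) (auto intro: polys_partial_deriv)

lemma mono_eval_has_derivative:
  fixes x :: "nat \<Rightarrow> 'a::real_normed_field"
  shows "((\<lambda>z. mono_eval \<beta> (x(n := z))) has_field_derivative
     of_nat (Poly_Mapping.lookup \<beta> n) * mono_eval (\<beta> - Poly_Mapping.single n 1) (x(n := z))) (at z)"
proof -
  let ?S = "insert n (Poly_Mapping.keys \<beta>)"
  let ?c = "\<Prod>i\<in>?S - {n}. x i ^ Poly_Mapping.lookup \<beta> i"
  have 1: "mono_eval \<beta> (x(n := w)) = w ^ Poly_Mapping.lookup \<beta> n * ?c" for w
  proof -
    have "mono_eval \<beta> (x(n := w)) = (\<Prod>i\<in>?S. (x(n := w)) i ^ Poly_Mapping.lookup \<beta> i)"
      by (rule mono_eval_superset) auto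
    also have "\<dots> = w ^ Poly_Mapping.lookup \<beta> n * (\<Prod>i\<in>?S - {n}. (x(n := w)) i ^ Poly_Mapping.lookup \<beta> i)"
      by (subst prod.remove[of _ n]) auto
    also have "(\<Prod>i\<in>?S - {n}. (x(n := w)) i ^ Poly_Mapping.lookup \<beta> i) = ?c"
      by (intro prod.cong) auto
    finally show ?thesis .
  qed
  have 2: "mono_eval (\<beta> - Poly_Mapping.single n 1) (x(n := w)) = w ^ (Poly_Mapping.lookup \<beta> n - 1) * ?c" for w
  proof -
    have "mono_eval (\<beta> - Poly_Mapping.single n 1) (x(n := w))
        = (\<Prod>i\<in>?S. (x(n := w)) i ^ Poly_Mapping.lookup (\<beta> - Poly_Mapping.single n 1) i)"
      by (rule mono_eval_superset) (auto simp: in_keys_iff lookup_minus)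
    also have "\<dots> = w ^ (Poly_Mapping.lookup \<beta> n - 1) *
        (\<Prod>i\<in>?S - {n}. (x(n := w)) i ^ Poly_Mapping.lookup (\<beta> - Poly_Mapping.single n 1) i)"
      by (subst prod.remove[of _ n]) (auto simp: lookup_minus)
    also have "(\<Prod>i\<in>?S - {n}. (x(n := w)) i ^ Poly_Mapping.lookup (\<beta> - Poly_Mapping.single n 1) i) = ?c"
      by (intro prod.cong) (auto simp: lookup_minus lookup_single)
    finally show ?thesis .
  qed
  show ?thesis unfolding 1 2
    by (auto intro!: derivative_eq_intros)
qed

lemma peval_has_derivative:
  fixes x :: "nat \<Rightarrow> 'a::real_normed_field"
  shows "((\<lambda>z. peval p (x(n := z))) has_field_derivative peval (partial_deriv n p) (x(n := z))) (at z)"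
proof -
  have "((\<lambda>z. peval p (x(n := z))) has_field_derivative (\<Sum>\<beta>\<in>Poly_Mapping.keys p.
      of_real (Poly_Mapping.lookup p \<beta>) * (of_nat (Poly_Mapping.lookup \<beta> n) *
        mono_eval (\<beta> - Poly_Mapping.single n 1) (x(n := z))))) (at z)"
    unfolding peval_def by (intro DERIV_sum DERIV_cmult mono_eval_has_derivative)
  also have "(\<Sum>\<beta>\<in>Poly_Mapping.keys p.
      of_real (Poly_Mapping.lookup p \<beta>) * (of_nat (Poly_Mapping.lookup \<beta> n) *
        mono_eval (\<beta> - Poly_Mapping.single n 1) (x(n := z)))) = peval (partial_deriv n p) (x(n := z))"
    by (simp add: partial_deriv_def peval_sum algebra_simps)
  finally show ?thesis .
qed

text \<open>The factor \<open>c\<close> is a quotient of factorials; its positivity shows that the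
  two coefficients vanish together.\<close>

lemma lookup_partial_deriv_iter:
  "\<exists>c>0. Poly_Mapping.lookup ((partial_deriv i ^^ n) p) \<gamma> =
     Poly_Mapping.lookup p (\<gamma> + Poly_Mapping.single i n) * c"
proof (induction n arbitrary: \<gamma>)
  case 0
  then show ?case by (auto intro!: exI[of _ 1])
next
  case (Suc n)
  obtain c where c: "c > 0" "Poly_Mapping.lookup ((partial_deriv i ^^ n) p) (\<gamma> + Poly_Mapping.single i 1) =
     Poly_Mapping.lookup p (\<gamma> + Poly_Mapping.single i 1 + Poly_Mapping.single i n) * c"
    using Suc.IH by blast
  have "\<gamma> + Poly_Mapping.single i 1 + Poly_Mapping.single i n = \<gamma> + Poly_Mapping.single i (Suc n)"
    by (simp add: single_add[symmetric] add.assoc)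
  then show ?case using c
    by (intro exI[of _ "c * real (Suc (Poly_Mapping.lookup \<gamma> i))"]) (simp add: lookup_partial_deriv)
qed

lemma lookup_fold_partial_deriv:
  "\<exists>c>0. Poly_Mapping.lookup (fold (\<lambda>i. partial_deriv i ^^ e i) xs p) \<gamma> =
     Poly_Mapping.lookup p (\<gamma> + (\<Sum>i\<leftarrow>xs. Poly_Mapping.single i (e i))) * c"
proof (induction xs arbitrary: p)
  case Nil
  then show ?case by (auto intro!: exI[of _ 1])
next
  case (Cons x xs)
  obtain c where c: "c > 0" "Poly_Mapping.lookup (fold (\<lambda>i. partial_deriv i ^^ e i) (x # xs) p) \<gamma> =
      Poly_Mapping.lookup ((partial_deriv x ^^ e x) p) (\<gamma> + (\<Sum>i\<leftarrow>xs. Poly_Mapping.single i (e i))) * c"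
    using Cons.IH[of "(partial_deriv x ^^ e x) p"] by auto
  obtain d where d: "d > 0" "Poly_Mapping.lookup ((partial_deriv x ^^ e x) p) (\<gamma> + (\<Sum>i\<leftarrow>xs. Poly_Mapping.single i (e i)))
      = Poly_Mapping.lookup p (\<gamma> + (\<Sum>i\<leftarrow>xs. Poly_Mapping.single i (e i)) + Poly_Mapping.single x (e x)) * d"
    using lookup_partial_deriv_iter by blast
  show ?case
    by (rule exI[of _ "d * c"]) (use c d in \<open>simp add: algebra_simps\<close>)
qed

lemma sum_single_lookup:
  fixes \<alpha> :: "nat \<Rightarrow>\<^sub>0 nat"
  assumes "Poly_Mapping.keys \<alpha> \<subseteq> {1..N}"
  shows "(\<Sum>i\<leftarrow>[1..<Suc N]. Poly_Mapping.single i (Poly_Mapping.lookup \<alpha> i)) = \<alpha>"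
proof -
  have "(\<Sum>i\<leftarrow>[1..<Suc N]. Poly_Mapping.single i (Poly_Mapping.lookup \<alpha> i))
      = (\<Sum>i\<in>{1..N}. Poly_Mapping.single i (Poly_Mapping.lookup \<alpha> i))"
    by (subst sum_list_distinct_conv_sum_set)
       (auto simp del: upt_Suc simp: atLeastLessThanSuc_atLeastAtMost)
  also have "\<dots> = (\<Sum>i\<in>Poly_Mapping.keys \<alpha>. Poly_Mapping.single i (Poly_Mapping.lookup \<alpha> i))"
    by (rule sum.mono_neutral_right) (use assms in \<open>auto simp: in_keys_iff\<close>)
  also have "\<dots> = \<alpha>" by (rule mpoly_expand[symmetric])
  finally show ?thesis .
qed

lemma lookup_mixed_deriv:
  assumes "Poly_Mapping.keys \<alpha> \<subseteq> {1..N}"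
  shows "\<exists>c>0. Poly_Mapping.lookup (mixed_deriv N \<alpha> p) \<gamma> = Poly_Mapping.lookup p (\<gamma> + \<alpha>) * c"
  using lookup_fold_partial_deriv[of "Poly_Mapping.lookup \<alpha>" "[1..<Suc N]" p \<gamma>]
  unfolding mixed_deriv_def sum_single_lookup[OF assms] .

lemma polys_fold_partial_deriv:
  "p \<in> polys N \<Longrightarrow> fold (\<lambda>i. partial_deriv i ^^ e i) xs p \<in> polys N"
  by (induction xs arbitrary: p) (auto intro: polys_partial_deriv_iter)

lemma polys_mixed_deriv: "p \<in> polys N \<Longrightarrow> mixed_deriv M \<alpha> p \<in> polys N"
  unfolding mixed_deriv_def by (rule polys_fold_partial_deriv)

lemma keys_nonempty: "\<gamma> \<noteq> 0 \<Longrightarrow> Poly_Mapping.keys \<gamma> \<noteq> {}"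
  by (metis equals0D lookup_not_eq_zero_eq_in_keys lookup_zero poly_mapping_eqI)

lemma finite_set_max_ex:
  fixes f :: "'b \<Rightarrow> nat"
  assumes "finite S" "S \<noteq> {}"
  shows "\<exists>b\<in>S. \<forall>c\<in>S. f c \<le> f b"
proof -
  have "Max (f ` S) \<in> f ` S" using assms by simp
  then obtain b where "b \<in> S" "f b = Max (f ` S)" by auto
  then show ?thesis using assms(1) by (metis Max_ge finite_imageI imageI)
qed

text \<open>Differentiate by an exponent \<open>\<beta>\<close> of maximal total degree: a
  coefficient at \<open>\<gamma>\<close> \<noteq> 0 would come from the exponent
  \<open>\<gamma> + \<beta>\<close>, which has larger total degree. For hypoelliptic p this turns
  the decay of the derivatives into growth of p.\<close>

lemma ex_mixed_deriv_eq_Const: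
  assumes p: "p \<in> polys N" and nc: "\<forall>c. p \<noteq> Const c"
  shows "\<exists>\<alpha> c. Poly_Mapping.keys \<alpha> \<subseteq> {1..N} \<and> \<alpha> \<noteq> 0 \<and> c \<noteq> 0 \<and> mixed_deriv N \<alpha> p = Const c"
proof -
  let ?td = "\<lambda>\<beta>. \<Sum>i=1..N. Poly_Mapping.lookup \<beta> i"
  have ex: "\<exists>\<beta>\<in>Poly_Mapping.keys p. \<beta> \<noteq> 0"
  proof (rule ccontr)
    assume "\<not> ?thesis"
    then have "Poly_Mapping.keys p \<subseteq> {0}" by auto
    then have "p = Const (Poly_Mapping.lookup p 0)"
      unfolding Const_def by (intro poly_mapping_eqI) (auto simp: lookup_single when_def in_keys_iff)
    then show False using nc by blast
  qed
  have "Poly_Mapping.keys p \<noteq> {}" using ex by auto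
  then obtain \<beta> where \<beta>: "\<beta> \<in> Poly_Mapping.keys p" "\<And>\<gamma>. \<gamma> \<in> Poly_Mapping.keys p \<Longrightarrow> ?td \<gamma> \<le> ?td \<beta>"
    using finite_set_max_ex[of "Poly_Mapping.keys p" ?td] by auto
  have td_pos: "?td \<gamma> > 0" if "Poly_Mapping.keys \<gamma> \<subseteq> {1..N}" "\<gamma> \<noteq> 0" for \<gamma> :: "nat \<Rightarrow>\<^sub>0 nat"
  proof -
    have "Poly_Mapping.keys \<gamma> \<noteq> {}" using that(2) by (rule keys_nonempty)
    then obtain i where "i \<in> Poly_Mapping.keys \<gamma>" by blast
    then show ?thesis using that(1)[THEN subsetD, of i] by (intro sum_pos2[of _ i]) (auto simp: in_keys_iff)
  qed
  have sub: "\<gamma> \<in> Poly_Mapping.keys p \<Longrightarrow> Poly_Mapping.keys \<gamma> \<subseteq> {1..N}" for \<gamma>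
    using p by (auto simp: polys_def)
  have \<beta>0: "\<beta> \<noteq> 0"
  proof
    assume "\<beta> = 0"
    moreover obtain \<gamma> where "\<gamma> \<in> Poly_Mapping.keys p" "\<gamma> \<noteq> 0" using ex by auto
    ultimately show False using \<beta>(2)[of \<gamma>] td_pos[of \<gamma>] sub[of \<gamma>] by simp
  qed
  define c where "c = Poly_Mapping.lookup (mixed_deriv N \<beta> p) 0"
  have "c \<noteq> 0"
    using lookup_mixed_deriv[OF sub[OF \<beta>(1)], of p 0] \<beta>(1) by (auto simp: c_def in_keys_iff)
  moreover have "mixed_deriv N \<beta> p = Const c"
  proof (rule poly_mapping_eqI)
    fix \<gamma>
    show "Poly_Mapping.lookup (mixed_deriv N \<beta> p) \<gamma> = Poly_Mapping.lookup (Const c) \<gamma>"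
    proof (cases "\<gamma> = 0")
      case True then show ?thesis by (simp add: c_def Const_def)
    next
      case False
      have "\<gamma> + \<beta> \<notin> Poly_Mapping.keys p"
      proof
        assume k: "\<gamma> + \<beta> \<in> Poly_Mapping.keys p"
        have "Poly_Mapping.keys \<gamma> \<subseteq> Poly_Mapping.keys (\<gamma> + \<beta>)"
          by (auto simp: in_keys_iff lookup_add)
        then have "?td \<gamma> > 0" using sub[OF k] False by (intro td_pos) auto
        then show False using \<beta>(2)[OF k] by (simp add: lookup_add sum.distrib)
      qed
      then show ?thesis
        using lookup_mixed_deriv[OF sub[OF \<beta>(1)], of p \<gamma>] False
        by (auto simp: Const_def lookup_single in_keys_iff)
    qed
  qed
  ultimately show ?thesis using sub[OF \<beta>(1)] \<beta>0 by blast
qed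

section \<open>Hypoelliptic polynomials and their restrictions\<close>

text \<open>Multiplying by \<open>g\<close> replaces the limit of a quotient, and absolute values in
  the sum disappear because all coordinates are at least 1. For \<open>N = 0\<close> the relation
  always holds (take \<open>R = 1\<close>), so the faces that are single points are covered by the
  same lemmas.\<close>

definition little_o :: "nat \<Rightarrow> mpoly \<Rightarrow> mpoly \<Rightarrow> bool" where
  "little_o N f g \<longleftrightarrow> (\<forall>e>0. \<exists>R. \<forall>x::nat \<Rightarrow> real. (\<forall>n\<in>{1..N}. 1 \<le> x n) \<and> R \<le> (\<Sum>n=1..N. x n) \<longrightarrow>
      \<bar>peval f x\<bar> \<le> e * peval g x)"

lemma eventually_at_infinity_orthant:
  "eventually Q (inf (filtercomap (\<lambda>x. \<Sum>n=1..N. \<bar>x n\<bar>) at_top) (principal ({1..N} \<rightarrow>\<^sub>E {1..}))) \<longleftrightarrow>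
     (\<exists>R. \<forall>x \<in> {1..N} \<rightarrow>\<^sub>E {1::real..}. R \<le> (\<Sum>n=1..N. x n) \<longrightarrow> Q x)"
proof -
  have "(\<Sum>n=1..N. \<bar>x n\<bar>) = (\<Sum>n=1..N. x n)" if "x \<in> {1..N} \<rightarrow>\<^sub>E {1::real..}" for x
  proof (rule sum.cong)
    fix n assume "n \<in> {1..N}"
    then have "x n \<in> {1..}" using that by blast
    then show "\<bar>x n\<bar> = x n" by simp
  qed simp
  then have *: "(R \<le> (\<Sum>n=1..N. \<bar>x n\<bar>) \<longrightarrow> x \<in> {1..N} \<rightarrow>\<^sub>E {1::real..} \<longrightarrow> Q x) \<longleftrightarrow>
      (x \<in> {1..N} \<rightarrow>\<^sub>E {1..} \<longrightarrow> R \<le> (\<Sum>n=1..N. x n) \<longrightarrow> Q x)" for R x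
    by (cases "x \<in> {1..N} \<rightarrow>\<^sub>E {1::real..}") simp_all
  show ?thesis
    unfolding eventually_inf_principal eventually_filtercomap_at_top_linorder Ball_def * ..
qed

text \<open>Polynomials in \<open>polys N\<close> do not see coordinates outside
  \<open>{1..N}\<close>, so the extensional functions of the definition may be replaced by arbitrary
  ones. Positivity of p allows clearing the denominator.\<close>

lemma hypoelliptic_iff:
  "hypoelliptic N p \<longleftrightarrow> p \<in> polys N \<and> (\<forall>x. (\<forall>n\<in>{1..N}. 1 \<le> x n) \<longrightarrow> peval p x > (0::real)) \<and>
     (\<forall>\<alpha>. Poly_Mapping.keys \<alpha> \<subseteq> {1..N} \<and> \<alpha> \<noteq> 0 \<longrightarrow> little_o N (mixed_deriv N \<alpha> p) p)"
proof (cases "p \<in> polys N")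
  case p: True
  have ext: "peval q (restrict x {1..N}) = peval q x" if "q \<in> polys N" for q and x :: "nat \<Rightarrow> real"
    using that by (rule peval_cong) auto
  have mem: "restrict x {1..N} \<in> {1..N} \<rightarrow>\<^sub>E {1..}" if "\<forall>n\<in>{1..N}. 1 \<le> x n" for x :: "nat \<Rightarrow> real"
    using that by auto
  have memD: "\<forall>n\<in>{1..N}. 1 \<le> x n" if "x \<in> {1..N} \<rightarrow>\<^sub>E {1..}" for x :: "nat \<Rightarrow> real"
    using that by (auto simp: PiE_iff)
  have pos: "(\<forall>x \<in> {1..N} \<rightarrow>\<^sub>E {1..}. mpoly_eval p x > 0) \<longleftrightarrow>
      (\<forall>x. (\<forall>n\<in>{1..N}. 1 \<le> x n) \<longrightarrow> peval p x > (0::real))" (is "?L \<longleftrightarrow> ?R")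
    unfolding mpoly_eval_eq_peval
  proof
    assume L: "\<forall>x \<in> {1..N} \<rightarrow>\<^sub>E {1..}. peval p x > (0::real)"
    show ?R
    proof (intro allI impI)
      fix x :: "nat \<Rightarrow> real" assume "\<forall>n\<in>{1..N}. 1 \<le> x n"
      from L[rule_format, OF mem[OF this]] show "peval p x > 0" unfolding ext[OF p] .
    qed
  next
    assume ?R then show "\<forall>x \<in> {1..N} \<rightarrow>\<^sub>E {1..}. peval p x > (0::real)" using memD by blast
  qed
  have lim: "((\<lambda>x. mpoly_eval q x / mpoly_eval p x) \<longlongrightarrow> 0)
          (inf (filtercomap (\<lambda>x. \<Sum>n=1..N. \<bar>x n\<bar>) at_top) (principal ({1..N} \<rightarrow>\<^sub>E {1..})))
      \<longleftrightarrow> little_o N q p" if pp: ?R and q: "q \<in> polys N" for q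
  proof -
    have "((\<lambda>x. mpoly_eval q x / mpoly_eval p x) \<longlongrightarrow> 0)
          (inf (filtercomap (\<lambda>x. \<Sum>n=1..N. \<bar>x n\<bar>) at_top) (principal ({1..N} \<rightarrow>\<^sub>E {1..}))) \<longleftrightarrow>
        (\<forall>e>0. \<exists>R. \<forall>x \<in> {1..N} \<rightarrow>\<^sub>E {1::real..}. R \<le> (\<Sum>n=1..N. x n) \<longrightarrow> \<bar>peval q x / peval p x\<bar> < e)"
      unfolding tendsto_iff eventually_at_infinity_orthant mpoly_eval_eq_peval dist_real_def diff_0_right by (rule refl)
    also have "\<dots> \<longleftrightarrow> (\<forall>e>0. \<exists>R. \<forall>x \<in> {1..N} \<rightarrow>\<^sub>E {1::real..}. R \<le> (\<Sum>n=1..N. x n) \<longrightarrow> \<bar>peval q x\<bar> < e * peval p x)"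
    proof -
      have "\<bar>peval q x / peval p x\<bar> < e \<longleftrightarrow> \<bar>peval q x\<bar> < e * peval p x" 
        if "x \<in> {1..N} \<rightarrow>\<^sub>E {1::real..}" for x e
      proof -
        have "peval p x > 0" using pp memD[OF that] by blast
        then show ?thesis by (simp add: abs_divide divide_less_eq)
      qed
      then have "(\<forall>x \<in> {1..N} \<rightarrow>\<^sub>E {1::real..}. R \<le> (\<Sum>n=1..N. x n) \<longrightarrow> \<bar>peval q x / peval p x\<bar> < e) \<longleftrightarrow>
          (\<forall>x \<in> {1..N} \<rightarrow>\<^sub>E {1::real..}. R \<le> (\<Sum>n=1..N. x n) \<longrightarrow> \<bar>peval q x\<bar> < e * peval p x)" for R e
        by (intro ball_cong refl) (simp only:)
      then show ?thesis by (simp only:)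
    qed
    also have "\<dots> \<longleftrightarrow> (\<forall>e>0. \<exists>R. \<forall>x. (\<forall>n\<in>{1..N}. (1::real) \<le> x n) \<and> R \<le> (\<Sum>n=1..N. x n) \<longrightarrow> \<bar>peval q x\<bar> < e * peval p x)"
    proof -
      have s: "(\<Sum>n=1..N. restrict x {1..N} n) = (\<Sum>n=1..N. x n)" for x :: "nat \<Rightarrow> real"
        by (intro sum.cong) auto
      have "(\<forall>x \<in> {1..N} \<rightarrow>\<^sub>E {1::real..}. R \<le> (\<Sum>n=1..N. x n) \<longrightarrow> \<bar>peval q x\<bar> < e * peval p x) \<longleftrightarrow>
        (\<forall>x. (\<forall>n\<in>{1..N}. (1::real) \<le> x n) \<and> R \<le> (\<Sum>n=1..N. x n) \<longrightarrow> \<bar>peval q x\<bar> < e * peval p x)" for R e :: real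
      proof safe
        fix x :: "nat \<Rightarrow> real"
        assume H: "\<forall>x \<in> {1..N} \<rightarrow>\<^sub>E {1::real..}. R \<le> (\<Sum>n=1..N. x n) \<longrightarrow> \<bar>peval q x\<bar> < e * peval p x"
          and x: "\<forall>n\<in>{1..N}. 1 \<le> x n" "R \<le> (\<Sum>n=1..N. x n)"
        show "\<bar>peval q x\<bar> < e * peval p x"
          using H[rule_format, OF mem[OF x(1)]] x(2) unfolding s ext[OF p] ext[OF q] .
      next
        fix x :: "nat \<Rightarrow> real"
        assume H: "\<forall>x. (\<forall>n\<in>{1..N}. (1::real) \<le> x n) \<and> R \<le> (\<Sum>n=1..N. x n) \<longrightarrow> \<bar>peval q x\<bar> < e * peval p x"
          and x: "x \<in> {1..N} \<rightarrow>\<^sub>E {1..}" "R \<le> (\<Sum>n=1..N. x n)"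
        show "\<bar>peval q x\<bar> < e * peval p x"
          using H memD[OF x(1)] x(2) by blast
      qed
      then show ?thesis by simp
    qed
    also have "\<dots> \<longleftrightarrow> little_o N q p"
      unfolding little_o_def
    proof safe
      fix e :: real assume H: "\<forall>e>0. \<exists>R. \<forall>x. (\<forall>n\<in>{1..N}. (1::real) \<le> x n) \<and> R \<le> (\<Sum>n=1..N. x n) \<longrightarrow> \<bar>peval q x\<bar> < e * peval p x"
        and "e > 0"
      then show "\<exists>R. \<forall>x. (\<forall>n\<in>{1..N}. (1::real) \<le> x n) \<and> R \<le> (\<Sum>n=1..N. x n) \<longrightarrow> \<bar>peval q x\<bar> \<le> e * peval p x"
        by (meson less_imp_le)
    next
      fix e :: real assume H: "\<forall>e>0. \<exists>R. \<forall>x. (\<forall>n\<in>{1..N}. (1::real) \<le> x n) \<and> R \<le> (\<Sum>n=1..N. x n) \<longrightarrow> \<bar>peval q x\<bar> \<le> e * peval p x"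
        and "e > 0"
      then obtain R where R: "\<forall>x. (\<forall>n\<in>{1..N}. (1::real) \<le> x n) \<and> R \<le> (\<Sum>n=1..N. x n) \<longrightarrow> \<bar>peval q x\<bar> \<le> e/2 * peval p x"
        by (metis half_gt_zero)
      have "\<bar>peval q x\<bar> < e * peval p x" if "\<forall>n\<in>{1..N}. 1 \<le> x n" "R \<le> (\<Sum>n=1..N. x n)" for x
      proof -
        have "\<bar>peval q x\<bar> \<le> e/2 * peval p x" using R that by blast
        moreover have "e * peval p x > 0" using pp that \<open>e > 0\<close> by simp
        ultimately show ?thesis by simp
      qed
      then show "\<exists>R. \<forall>x. (\<forall>n\<in>{1..N}. (1::real) \<le> x n) \<and> R \<le> (\<Sum>n=1..N. x n) \<longrightarrow> \<bar>peval q x\<bar> < e * peval p x"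
        by blast
    qed
    finally show ?thesis .
  qed
  show ?thesis
    unfolding hypoelliptic_def pos using lim polys_mixed_deriv[OF p] p by blast
next
  case False
  then show ?thesis by (simp add: hypoelliptic_def)
qed

lemma hypoelliptic_pos:
  "hypoelliptic N p \<Longrightarrow> (\<And>n. n \<in> {1..N} \<Longrightarrow> 1 \<le> x n) \<Longrightarrow> peval p x > (0::real)"
  by (simp add: hypoelliptic_iff)

text \<open>Some derivative of p is a nonzero constant c, and c / p tending to 0 means that p tends
  to infinity.\<close>

lemma hypoelliptic_little_o_1:
  assumes "hypoelliptic N p" "\<forall>c. p \<noteq> Const c"
  shows "little_o N 1 p"
proof -
  obtain \<alpha> c where *: "Poly_Mapping.keys \<alpha> \<subseteq> {1..N}" "\<alpha> \<noteq> 0" "c \<noteq> 0" "mixed_deriv N \<alpha> p = Const c"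
    using ex_mixed_deriv_eq_Const[of p N] assms by (auto simp: hypoelliptic_iff)
  then have o: "little_o N (Const c) p" using assms(1) by (metis hypoelliptic_iff)
  show ?thesis unfolding little_o_def
  proof safe
    fix e :: real assume "e > 0"
    then have "e * \<bar>c\<bar> > 0" using * by simp
    then obtain R where R: "\<forall>x. (\<forall>n\<in>{1..N}. 1 \<le> x n) \<and> R \<le> (\<Sum>n=1..N. x n) \<longrightarrow> \<bar>peval (Const c) x\<bar> \<le> e * \<bar>c\<bar> * peval p x"
      using o unfolding little_o_def by blast
    have "\<bar>peval 1 x\<bar> \<le> e * peval p x" if "\<forall>n\<in>{1..N}. 1 \<le> x n" "R \<le> (\<Sum>n=1..N. x n)" for x
    proof -
      have "\<bar>c\<bar> * 1 \<le> \<bar>c\<bar> * (e * peval p x)" using R that by (fastforce simp: algebra_simps)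
      then show ?thesis using *(3) by (subst (asm) mult_le_cancel_left_pos) auto
    qed
    then show "\<exists>R. \<forall>x. (\<forall>n\<in>{1..N}. 1 \<le> x n) \<and> R \<le> (\<Sum>n=1..N. x n) \<longrightarrow> \<bar>peval 1 x\<bar> \<le> e * peval p x"
      by blast
  qed
qed

section \<open>Enumeration of an index set and restriction to a face\<close>

lemma idx_props:
  assumes "finite I" "k \<in> {1..card I}"
  shows idx_in: "idx I k \<in> I" and card_le_idx: "card {j\<in>I. j \<le> idx I k} = k"
proof -
  let ?l = "sorted_list_of_set I"
  have len: "length ?l = card I" by simp
  have st: "sorted_wrt (<) ?l" using assms(1) by simp
  show "idx I k \<in> I"
    using nth_mem[of "k - 1" ?l] assms by (auto simp: idx_def)
  have "{j\<in>I. j \<le> idx I k} = (!) ?l ` {..<k}"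
  proof safe
    fix j assume "j \<in> I" "j \<le> idx I k"
    then obtain i where i: "i < length ?l" "j = ?l ! i"
      using assms(1) by (metis in_set_conv_nth set_sorted_list_of_set)
    have "i < k"
    proof (rule ccontr)
      assume "\<not> i < k"
      then have "?l ! (k - 1) < ?l ! i" using i(1) assms(2)
        by (intro sorted_wrt_nth_less[OF st]) auto
      then show False using \<open>j \<le> idx I k\<close> i(2) by (simp add: idx_def)
    qed
    then show "j \<in> (!) ?l ` {..<k}" using i by auto
  next
    fix i assume "i < k"
    then show "?l ! i \<in> I" using nth_mem[of i ?l] assms by auto
    show "?l ! i \<le> idx I k"
      unfolding idx_def
      by (rule sorted_nth_mono[OF sorted_sorted_list_of_set]) (use \<open>i < k\<close> assms(2) len in auto)
  qed
  moreover have "inj_on ((!) ?l) {..<k}"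
    by (rule inj_on_nth) (use assms(2) len in auto)
  ultimately show "card {j\<in>I. j \<le> idx I k} = k" by (simp add: card_image)
qed

lemma idx_card_le:
  assumes "finite I" "i \<in> I"
  shows "idx I (card {j\<in>I. j \<le> i}) = i" "card {j\<in>I. j \<le> i} \<in> {1..card I}"
proof -
  obtain n where n: "n < card I" "i = sorted_list_of_set I ! n"
    using assms by (metis in_set_conv_nth length_sorted_list_of_set set_sorted_list_of_set)
  then have "i = idx I (Suc n)" by (simp add: idx_def)
  then show "idx I (card {j\<in>I. j \<le> i}) = i" "card {j\<in>I. j \<le> i} \<in> {1..card I}"
    using card_le_idx[OF assms(1), of "Suc n"] n(1) by auto
qed

lemma bij_betw_idx: "finite I \<Longrightarrow> bij_betw (idx I) {1..card I} I"
proof (rule bij_betw_byWitness[where f' = "\<lambda>i. card {j\<in>I. j \<le> i}"])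
  assume fin: "finite I"
  show "\<forall>k\<in>{1..card I}. card {j \<in> I. j \<le> idx I k} = k" using card_le_idx[OF fin] by blast
  show "\<forall>i\<in>I. idx I (card {j \<in> I. j \<le> i}) = i" using idx_card_le(1)[OF fin] by blast
  show "idx I ` {1..card I} \<subseteq> I" using idx_in[OF fin] by blast
  show "(\<lambda>i. card {j \<in> I. j \<le> i}) ` I \<subseteq> {1..card I}" using idx_card_le(2)[OF fin] by blast
qed

lemma map_idx_upt: "finite I \<Longrightarrow> map (idx I) [1..<Suc (card I)] = sorted_list_of_set I"
  by (rule nth_equalityI) (auto simp: idx_def simp del: upt_Suc)

text \<open>Together with \<open>map_idx_upt\<close> this lists the elements of \<open>I\<close> in
  the order in which \<open>mixed_deriv N\<close> runs through all indices, so that the derivatives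
  on a face match those on the orthant as lists.\<close>

lemma sorted_list_of_set_eq_filter:
  "I \<subseteq> {1..N} \<Longrightarrow> sorted_list_of_set I = filter (\<lambda>i. i \<in> I) [1..<Suc N]"
proof -
  assume I: "I \<subseteq> {1..N}"
  let ?l = "filter (\<lambda>i. i \<in> I) [1..<Suc N]"
  have "set ?l = I" using I by auto
  moreover have "sorted ?l" "distinct ?l" by (simp_all add: sorted_wrt_filter del: upt_Suc)
  ultimately show "sorted_list_of_set I = ?l"
    using sorted_list_of_set.idem_if_sorted_distinct[of ?l] by (simp del: upt_Suc)
qed

text \<open>The general type serves two purposes: at real points it describes how restricted
  polynomials are evaluated, and at natural numbers it embeds the index tuples of a face into those
  of the orthant.\<close>

definition restrict_point :: "(nat \<Rightarrow> nat) \<Rightarrow> nat set \<Rightarrow> (nat \<Rightarrow> nat) \<Rightarrow> (nat \<Rightarrow> 'a::semiring_1) \<Rightarrow> nat \<Rightarrow> 'a" where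
  "restrict_point a I b x = (\<lambda>i. if i \<in> I then of_nat (a i) + x (card {j\<in>I. j \<le> i}) else of_nat (b i))"

lemma peval_restrict_point: "peval (restrict_poly a I b p) x = peval p (restrict_point a I b x)"
  by (simp add: peval_restrict restrict_point_def)

lemma restrict_point_upd:
  assumes "finite I" "k \<in> {1..card I}"
  shows "restrict_point a I b (x(k := t)) = (restrict_point a I b x)(idx I k := of_nat (a (idx I k)) + t)"
  unfolding restrict_point_def
  using idx_props[OF assms] idx_card_le[OF assms(1)] by (intro ext) auto

text \<open>This is the chain rule for a coordinate that is merely shifted by
  \<open>a (idx I k)\<close>. The hypothesis compares values only, not polynomials, so that the
  lemma applies again to its own conclusion.\<close>

lemma partial_deriv_restrict:
  fixes r p :: mpoly
  assumes I: "finite I" "k \<in> {1..card I}"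
    and eq: "\<And>x::nat \<Rightarrow> real. peval r x = peval p (restrict_point a I b x)"
  shows "peval (partial_deriv k r) (x::nat \<Rightarrow> real) = peval (partial_deriv (idx I k) p) (restrict_point a I b x)"
proof -
  let ?i = "idx I k" and ?y = "restrict_point a I b x"
  have "((\<lambda>t. peval r (x(k := t))) has_field_derivative peval (partial_deriv k r) (x(k := x k))) (at (x k))"
    by (rule peval_has_derivative)
  moreover have "((\<lambda>t. peval p (?y(?i := t))) has_field_derivative
      peval (partial_deriv ?i p) (?y(?i := real (a ?i) + x k))) (at (real (a ?i) + x k))"
    by (rule peval_has_derivative)
  then have "((\<lambda>t. peval p (?y(?i := real (a ?i) + t))) has_field_derivative
      peval (partial_deriv ?i p) (?y(?i := real (a ?i) + x k))) (at (x k))"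
    unfolding add.commute[of "real (a ?i)"] by (rule DERIV_shift[THEN iffD1])
  moreover have "(\<lambda>t. peval r (x(k := t))) = (\<lambda>t. peval p (?y(?i := real (a ?i) + t)))"
    unfolding eq restrict_point_upd[OF I] ..
  moreover have "?y(?i := real (a ?i) + x k) = ?y"
    using restrict_point_upd[OF I, of a b x "x k"] by simp
  ultimately show ?thesis using DERIV_unique by fastforce
qed

lemma partial_deriv_iter_restrict:
  assumes I: "finite I" "k \<in> {1..card I}"
    and eq: "\<And>x::nat \<Rightarrow> real. peval r x = peval p (restrict_point a I b x)"
  shows "peval ((partial_deriv k ^^ n) r) (x::nat \<Rightarrow> real) = peval ((partial_deriv (idx I k) ^^ n) p) (restrict_point a I b x)"
  by (induction n arbitrary: x) (use eq partial_deriv_restrict[OF I] in auto)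

lemma fold_partial_deriv_restrict:
  assumes I: "finite I" "set ks \<subseteq> {1..card I}"
    and eq: "\<And>x::nat \<Rightarrow> real. peval r x = peval p (restrict_point a I b x)"
  shows "peval (fold (\<lambda>k. partial_deriv k ^^ e k) ks r) (x::nat \<Rightarrow> real) =
     peval (fold (\<lambda>k. partial_deriv (idx I k) ^^ e k) ks p) (restrict_point a I b x)"
  using I(2) eq
proof (induction ks arbitrary: r p)
  case (Cons k ks)
  have "\<And>x::nat \<Rightarrow> real. peval ((partial_deriv k ^^ e k) r) x = peval ((partial_deriv (idx I k) ^^ e k) p) (restrict_point a I b x)"
    by (rule partial_deriv_iter_restrict) (use Cons.prems I(1) in auto)
  then show ?case using Cons.IH Cons.prems by simp
qed simp

lemma fold_filter_id: "(\<And>x. x \<in> set xs \<Longrightarrow> \<not> Q x \<Longrightarrow> f x = id) \<Longrightarrow> fold f (filter Q xs) = fold f xs"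
  by (induction xs) auto

text \<open>The exponent of the k-th variable is moved to the k-th element of \<open>I\<close>, and
  indices outside \<open>I\<close> get exponent 0; restriction then commutes with
  differentiation.\<close>

lemma mixed_deriv_restrict:
  assumes I: "I \<subseteq> {1..N}" and \<alpha>: "Poly_Mapping.keys \<alpha> \<subseteq> {1..card I}" "\<alpha> \<noteq> 0"
  shows "\<exists>\<alpha>'. Poly_Mapping.keys \<alpha>' \<subseteq> {1..N} \<and> \<alpha>' \<noteq> 0 \<and>
    (\<forall>x::nat \<Rightarrow> real. peval (mixed_deriv (card I) \<alpha> (restrict_poly a I b p)) x =
       peval (mixed_deriv N \<alpha>' p) (restrict_point a I b x))"
proof -
  have fin: "finite I" using I finite_subset by blast
  define g where "g i = (if i \<in> I then Poly_Mapping.lookup \<alpha> (card {j\<in>I. j \<le> i}) else 0)" for i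
  define \<alpha>' where "\<alpha>' = Poly_Mapping.Abs_poly_mapping g"
  have "finite {i. g i \<noteq> 0}" by (rule finite_subset[OF _ fin]) (auto simp: g_def)
  then have lk: "Poly_Mapping.lookup \<alpha>' = g" by (simp add: \<alpha>'_def)
  have lk_idx: "Poly_Mapping.lookup \<alpha>' (idx I k) = Poly_Mapping.lookup \<alpha> k" if "k \<in> {1..card I}" for k
    using idx_props[OF fin that] by (simp add: lk g_def)
  have "Poly_Mapping.keys \<alpha> \<noteq> {}" using \<alpha>(2) by (rule keys_nonempty)
  then obtain k where k: "k \<in> Poly_Mapping.keys \<alpha>" by blast
  then have "Poly_Mapping.lookup \<alpha>' (idx I k) \<noteq> 0" using lk_idx[OF subsetD[OF \<alpha>(1) k]] by (simp add: in_keys_iff)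
  then have "\<alpha>' \<noteq> 0" by auto
  moreover have "Poly_Mapping.keys \<alpha>' \<subseteq> {1..N}"
    using I by (auto simp: in_keys_iff lk g_def split: if_splits)
  moreover have "peval (mixed_deriv (card I) \<alpha> (restrict_poly a I b p)) x =
       peval (mixed_deriv N \<alpha>' p) (restrict_point a I b x)" for x :: "nat \<Rightarrow> real"
  proof -
    have "peval (mixed_deriv (card I) \<alpha> (restrict_poly a I b p)) x =
        peval (fold (\<lambda>k. partial_deriv (idx I k) ^^ Poly_Mapping.lookup \<alpha> k) [1..<Suc (card I)] p) (restrict_point a I b x)"
      unfolding mixed_deriv_def
      by (rule fold_partial_deriv_restrict[OF fin]) (auto simp: peval_restrict_point)
    also have "fold (\<lambda>k. partial_deriv (idx I k) ^^ Poly_Mapping.lookup \<alpha> k) [1..<Suc (card I)] p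
        = fold (\<lambda>k. partial_deriv (idx I k) ^^ Poly_Mapping.lookup \<alpha>' (idx I k)) [1..<Suc (card I)] p"
      by (rule fold_cong) (auto simp: lk_idx simp del: upt_Suc)
    also have "\<dots> = fold (\<lambda>i. partial_deriv i ^^ Poly_Mapping.lookup \<alpha>' i) (map (idx I) [1..<Suc (card I)]) p"
      by (simp add: fold_map comp_def del: upt_Suc)
    also have "map (idx I) [1..<Suc (card I)] = filter (\<lambda>i. i \<in> I) [1..<Suc N]"
      using map_idx_upt[OF fin] sorted_list_of_set_eq_filter[OF I] by simp
    also have "fold (\<lambda>i. partial_deriv i ^^ Poly_Mapping.lookup \<alpha>' i) (filter (\<lambda>i. i \<in> I) [1..<Suc N]) p
        = mixed_deriv N \<alpha>' p"
      unfolding mixed_deriv_def by (subst fold_filter_id) (auto simp: lk g_def)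
    finally show ?thesis .
  qed
  ultimately show ?thesis by blast
qed

lemma polys_restrict:
  assumes "I \<subseteq> {1..N}" "p \<in> polys N"
  shows "restrict_poly a I b p \<in> polys (card I)"
proof -
  have "finite I" using assms finite_subset by blast
  then show ?thesis
    unfolding restrict_poly_def using idx_card_le(2)
    by (intro polys_subst[OF assms(2)]) (auto intro!: polys_add polys_Var)
qed

lemma restrict_point_ge_1:
  assumes I: "I \<subseteq> {1..N}" and b: "\<And>i. i \<in> {1..N} - I \<Longrightarrow> 1 \<le> b i"
    and x: "\<forall>n\<in>{1..card I}. (1::real) \<le> x n" and n: "n \<in> {1..N}"
  shows "1 \<le> restrict_point a I b x n"
proof (cases "n \<in> I")
  case True
  have "finite I" using I finite_subset by blast
  then have "1 \<le> x (card {j\<in>I. j \<le> n})" using x idx_card_le(2)[OF _ True] by blast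
  then show ?thesis using True by (simp add: restrict_point_def)
next
  case False
  then show ?thesis using b[of n] n by (auto simp: restrict_point_def)
qed

lemma sum_le_sum_restrict_point:
  assumes I: "I \<subseteq> {1..N}" and b: "\<And>i. i \<in> {1..N} - I \<Longrightarrow> 1 \<le> b i"
    and x: "\<forall>n\<in>{1..card I}. (1::real) \<le> x n"
  shows "(\<Sum>n=1..card I. x n) \<le> (\<Sum>n=1..N. restrict_point a I b x n)"
proof -
  have fin: "finite I" using I finite_subset by blast
  have "(\<Sum>n=1..card I. x n) \<le> (\<Sum>n=1..card I. restrict_point a I b x (idx I n))"
    using idx_props[OF fin] by (intro sum_mono) (auto simp: restrict_point_def)
  also have "\<dots> = (\<Sum>i\<in>I. restrict_point a I b x i)"
    by (rule sum.reindex_bij_betw[OF bij_betw_idx[OF fin]])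
  also have "\<dots> \<le> (\<Sum>n=1..N. restrict_point a I b x n)"
  proof (rule sum_mono2)
    fix n assume "n \<in> {1..N} - I"
    then show "0 \<le> restrict_point a I b x n"
      using restrict_point_ge_1[OF I b x, where n = n and a = a] by fastforce
  qed (use I in auto)
  finally show ?thesis .
qed

text \<open>By \<open>sum_le_sum_restrict_point\<close> the coordinate sum does not decrease under
  the embedding of a face, so going to infinity on the face is going to infinity in the orthant. The
  bound \<open>1 \<le> b i\<close> keeps the face inside the orthant.\<close>

lemma little_o_restrict:
  assumes I: "I \<subseteq> {1..N}" and b: "\<And>i. i \<in> {1..N} - I \<Longrightarrow> 1 \<le> b i"
    and o: "little_o N f g"
    and f: "\<And>x::nat \<Rightarrow> real. peval f' x = peval f (restrict_point a I b x)"
    and g: "\<And>x::nat \<Rightarrow> real. peval g' x = peval g (restrict_point a I b x)"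
  shows "little_o (card I) f' g'"
  unfolding little_o_def
proof (intro allI impI)
  fix e :: real assume "e > 0"
  then obtain R where R: "\<forall>x. (\<forall>n\<in>{1..N}. 1 \<le> x n) \<and> R \<le> (\<Sum>n=1..N. x n) \<longrightarrow> \<bar>peval f x\<bar> \<le> e * peval g x"
    using o unfolding little_o_def by blast
  have "\<bar>peval f' x\<bar> \<le> e * peval g' x" if x: "\<forall>n\<in>{1..card I}. 1 \<le> x n" "R \<le> (\<Sum>n=1..card I. x n)" for x
    unfolding f g using R restrict_point_ge_1[OF I b x(1)] sum_le_sum_restrict_point[OF I b x(1)] x(2)
    by (meson order_trans)
  then show "\<exists>R. \<forall>x. (\<forall>n\<in>{1..card I}. 1 \<le> x n) \<and> R \<le> (\<Sum>n=1..card I. x n) \<longrightarrow> \<bar>peval f' x\<bar> \<le> e * peval g' x"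
    by blast
qed

text \<open>Derivatives of the restriction are restrictions of derivatives, hence all conditions are
  inherited. This keeps the induction on the number of variables within one class of series.\<close>

lemma hypoelliptic_restrict:
  assumes I: "I \<subseteq> {1..N}" and b: "\<And>i. i \<in> {1..N} - I \<Longrightarrow> 1 \<le> b i"
    and p: "hypoelliptic N p"
  shows "hypoelliptic (card I) (restrict_poly a I b p)"
  unfolding hypoelliptic_iff
proof (intro conjI allI impI)
  show "restrict_poly a I b p \<in> polys (card I)"
    using polys_restrict[OF I] p by (auto simp: hypoelliptic_iff)
next
  fix x :: "nat \<Rightarrow> real" assume "\<forall>n\<in>{1..card I}. 1 \<le> x n"
  then show "peval (restrict_poly a I b p) x > 0"
    unfolding peval_restrict_point
    by (intro hypoelliptic_pos[OF p] restrict_point_ge_1[OF I b])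
next
  fix \<alpha> :: "nat \<Rightarrow>\<^sub>0 nat" assume "Poly_Mapping.keys \<alpha> \<subseteq> {1..card I} \<and> \<alpha> \<noteq> 0"
  then obtain \<alpha>' where \<alpha>': "Poly_Mapping.keys \<alpha>' \<subseteq> {1..N}" "\<alpha>' \<noteq> 0"
      "\<And>x::nat \<Rightarrow> real. peval (mixed_deriv (card I) \<alpha> (restrict_poly a I b p)) x =
       peval (mixed_deriv N \<alpha>' p) (restrict_point a I b x)"
    using mixed_deriv_restrict[OF I] by blast
  then have o: "little_o N (mixed_deriv N \<alpha>' p) p" using p by (simp add: hypoelliptic_iff)
  show "little_o (card I) (mixed_deriv (card I) \<alpha> (restrict_poly a I b p)) (restrict_poly a I b p)"
    by (rule little_o_restrict[where f' = "mixed_deriv (card I) \<alpha> (restrict_poly a I b p)" and a = a, OF I b o])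
       (simp_all add: peval_restrict_point \<alpha>'(3))
qed

lemma little_o_1_restrict:
  assumes I: "I \<subseteq> {1..N}" and b: "\<And>i. i \<in> {1..N} - I \<Longrightarrow> 1 \<le> b i" and p: "little_o N 1 p"
  shows "little_o (card I) 1 (restrict_poly a I b p)"
  by (rule little_o_restrict[OF I b p]) (simp_all add: peval_restrict_point)

section \<open>A Lojasiewicz inequality at infinity\<close>

text \<open>Fraction-free Gaussian elimination: a pivot \<open>w k b\<close> removes the coordinate
  \<open>b\<close>, and the remaining \<open>card J - 1\<close> vectors have one coordinate less. A
  domain suffices because the pivot stays a nonzero factor of the coefficients.\<close>

lemma idom_linear_dependence:
  fixes w :: "'j \<Rightarrow> 'b \<Rightarrow> 'a::idom"
  assumes "finite B" "finite J" "card B < card J"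
  shows "\<exists>\<phi>. (\<exists>j\<in>J. \<phi> j \<noteq> 0) \<and> (\<forall>\<gamma>\<in>B. (\<Sum>j\<in>J. \<phi> j * w j \<gamma>) = 0)"
  using assms
proof (induction B arbitrary: J w rule: finite_induct)
  case empty
  then have "J \<noteq> {}" by auto
  then show ?case by (intro exI[of _ "\<lambda>_. 1"]) auto
next
  case (insert b B)
  show ?case
  proof (cases "\<forall>j\<in>J. w j b = 0")
    case True
    obtain \<phi> where "\<exists>j\<in>J. \<phi> j \<noteq> 0" "\<forall>\<gamma>\<in>B. (\<Sum>j\<in>J. \<phi> j * w j \<gamma>) = 0"
      using insert.IH[of J w] insert.prems insert.hyps by auto
    then show ?thesis using True by (intro exI[of _ \<phi>]) auto
  next
    case False
    then obtain k where k: "k \<in> J" "w k b \<noteq> 0" by blast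
    have card: "card B < card (J - {k})"
      using insert.prems insert.hyps k(1) by simp
    obtain \<phi> where \<phi>: "\<exists>j\<in>J - {k}. \<phi> j \<noteq> 0"
      "\<forall>\<gamma>\<in>B. (\<Sum>j\<in>J - {k}. \<phi> j * (w k b * w j \<gamma> - w j b * w k \<gamma>)) = 0"
      using insert.IH[of "J - {k}" "\<lambda>j \<gamma>. w k b * w j \<gamma> - w j b * w k \<gamma>", OF _ card] insert.prems(1)
      by blast
    \<comment> \<open>The relation of the eliminated vectors, rewritten in the old ones: all other
      coefficients are multiplied by the pivot, and the coefficient at \<open>k\<close> is what
      makes the coordinate \<open>b\<close> cancel.\<close>
    define \<psi> where "\<psi> j = (if j = k then - (\<Sum>j\<in>J - {k}. \<phi> j * w j b) else \<phi> j * w k b)" for j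
    have s: "(\<Sum>j\<in>J. \<psi> j * w j \<gamma>) = (\<Sum>j\<in>J - {k}. \<phi> j * (w k b * w j \<gamma> - w j b * w k \<gamma>))" for \<gamma>
    proof -
      have "(\<Sum>j\<in>J. \<psi> j * w j \<gamma>) = \<psi> k * w k \<gamma> + (\<Sum>j\<in>J - {k}. \<psi> j * w j \<gamma>)"
        using k(1) insert.prems(1) by (simp add: sum.remove)
      also have "(\<Sum>j\<in>J - {k}. \<psi> j * w j \<gamma>) = (\<Sum>j\<in>J - {k}. \<phi> j * w k b * w j \<gamma>)"
        by (intro sum.cong) (auto simp: \<psi>_def)
      finally have "(\<Sum>j\<in>J. \<psi> j * w j \<gamma>) = - (\<Sum>j\<in>J - {k}. \<phi> j * w j b * w k \<gamma>) + (\<Sum>j\<in>J - {k}. \<phi> j * w k b * w j \<gamma>)"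
        by (simp add: \<psi>_def sum_distrib_right)
      then show ?thesis
        by (simp add: right_diff_distrib sum_subtractf mult.assoc)
    qed
    have "\<exists>j\<in>J. \<psi> j \<noteq> 0" using \<phi>(1) k by (auto simp: \<psi>_def)
    moreover have "(\<Sum>j\<in>J. \<psi> j * w j \<gamma>) = 0" if "\<gamma> \<in> insert b B" for \<gamma>
      unfolding s using \<phi>(2) that by (cases "\<gamma> = b") (auto simp: mult.commute)
    ultimately show ?thesis by blast
  qed
qed

section \<open>Elimination of variables modulo equations with pure leading powers\<close>

definition tdeg :: "nat \<Rightarrow> (nat \<Rightarrow>\<^sub>0 nat) \<Rightarrow> nat" where
  "tdeg N \<beta> = (\<Sum>i=1..N. Poly_Mapping.lookup \<beta> i)"

text \<open>These monomials span the quotient by equations that express each \<open>d\<close>-th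
  power of a variable through monomials of total degree less than \<open>d\<close>. Their finite
  number bounds the degree of the resulting relation.\<close>

definition small_monos :: "nat \<Rightarrow> nat \<Rightarrow> (nat \<Rightarrow>\<^sub>0 nat) set" where
  "small_monos N d = {\<beta>. Poly_Mapping.keys \<beta> \<subseteq> {1..N} \<and> (\<forall>i. Poly_Mapping.lookup \<beta> i < d)}"

lemma finite_small_monos: "finite (small_monos N d)"
proof (rule inj_on_finite[of "\<lambda>\<beta>. restrict (Poly_Mapping.lookup \<beta>) {1..N}"])
  show "inj_on (\<lambda>\<beta>. restrict (Poly_Mapping.lookup \<beta>) {1..N}) (small_monos N d)"
  proof (rule inj_onI)
    fix x y assume xy: "x \<in> small_monos N d" "y \<in> small_monos N d"
      "restrict (Poly_Mapping.lookup x) {1..N} = restrict (Poly_Mapping.lookup y) {1..N}"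
    show "x = y"
    proof (rule poly_mapping_eqI)
      fix k
      show "Poly_Mapping.lookup x k = Poly_Mapping.lookup y k"
      proof (cases "k \<in> {1..N}")
        case True
        then show ?thesis using fun_cong[OF xy(3), of k] by simp
      next
        case False
        then have "k \<notin> Poly_Mapping.keys x" "k \<notin> Poly_Mapping.keys y"
          using xy(1,2) unfolding small_monos_def by blast+
        then show ?thesis by (simp add: in_keys_iff)
      qed
    qed
  qed
  show "(\<lambda>\<beta>. restrict (Poly_Mapping.lookup \<beta>) {1..N}) ` small_monos N d \<subseteq> {1..N} \<rightarrow>\<^sub>E {..<d}"
    by (auto simp: small_monos_def)
qed (auto intro: finite_PiE)

text \<open>The domain \<open>'r\<close> holds polynomials in the parameters, \<open>E\<close>
  evaluates them at a point, \<open>K\<close> embeds the real constants, and \<open>V\<close> reads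
  off the variables of the point. Assumption \<open>crit\<close> is the family of equations with
  leading coefficient \<open>c\<close>, valid only on \<open>X\<close>. The equations are thus used
  as identities between values, while linear dependence is taken over \<open>'r\<close> and so is
  uniform in the points.\<close>

locale reduction =
  fixes X :: "'x set" and E :: "'r::idom \<Rightarrow> 'x \<Rightarrow> real" and V :: "'x \<Rightarrow> nat \<Rightarrow> real"
    and N d :: nat and c :: 'r and G :: "(nat \<Rightarrow>\<^sub>0 nat) set" and m :: "nat \<Rightarrow> (nat \<Rightarrow>\<^sub>0 nat) \<Rightarrow> 'r"
    and K :: "real \<Rightarrow> 'r"
  assumes E_add: "E (a + b) x = E a x + E b x"
    and E_mult: "E (a * b) x = E a x * E b x"
    and E_1: "E 1 x = 1"
    and E_K: "E (K t) x = t"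
    and d: "d > 0"
    and G: "finite G" "\<gamma> \<in> G \<Longrightarrow> Poly_Mapping.keys \<gamma> \<subseteq> {1..N}" "\<gamma> \<in> G \<Longrightarrow> tdeg N \<gamma> < d"
    and crit: "x \<in> X \<Longrightarrow> i \<in> {1..N} \<Longrightarrow> E c x * V x i ^ d = (\<Sum>\<gamma>\<in>G. E (m i \<gamma>) x * mono_eval \<gamma> (V x))"
begin

lemma E_0: "E 0 x = 0"
  using E_add[of 0 0 x] by simp

lemma E_sum: "E (sum f S) x = (\<Sum>i\<in>S. E (f i) x)"
  by (induction S rule: infinite_finite_induct) (auto simp: E_0 E_add)

lemma E_power: "E (a ^ n) x = E a x ^ n"
  by (induction n) (auto simp: E_1 E_mult)

text \<open>The power of \<open>c\<close> clears the denominators that arise from solving the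
  equations for their leading terms.\<close>

definition red :: "('x \<Rightarrow> real) \<Rightarrow> bool" where
  "red h \<longleftrightarrow> (\<exists>L r. \<forall>x\<in>X. E c x ^ L * h x = (\<Sum>\<beta>\<in>small_monos N d. E (r \<beta>) x * mono_eval \<beta> (V x)))"

lemma red_raise:
  assumes "\<forall>x\<in>X. E c x ^ L * h x = (\<Sum>\<beta>\<in>small_monos N d. E (r \<beta>) x * mono_eval \<beta> (V x))" "L \<le> L'"
  shows "\<exists>r. \<forall>x\<in>X. E c x ^ L' * h x = (\<Sum>\<beta>\<in>small_monos N d. E (r \<beta>) x * mono_eval \<beta> (V x))"
proof (intro exI[of _ "\<lambda>\<beta>. c ^ (L' - L) * r \<beta>"] ballI)
  fix x assume "x \<in> X"
  have "E c x ^ L' * h x = E c x ^ (L' - L) * (E c x ^ L * h x)"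
    using assms(2) by (simp add: power_add[symmetric] mult.assoc[symmetric])
  also have "\<dots> = (\<Sum>\<beta>\<in>small_monos N d. E (c ^ (L' - L) * r \<beta>) x * mono_eval \<beta> (V x))"
    using assms(1) \<open>x \<in> X\<close> by (simp add: E_mult E_power sum_distrib_left mult.assoc)
  finally show "E c x ^ L' * h x = (\<Sum>\<beta>\<in>small_monos N d. E (c ^ (L' - L) * r \<beta>) x * mono_eval \<beta> (V x))" .
qed

lemma red_0: "red (\<lambda>x. 0)"
  unfolding red_def by (rule exI[of _ 0], rule exI[of _ "\<lambda>_. 0"]) (simp add: E_0)

lemma red_add:
  assumes "red h" "red g"
  shows "red (\<lambda>x. h x + g x)"
proof -
  obtain L1 r1 where 1: "\<forall>x\<in>X. E c x ^ L1 * h x = (\<Sum>\<beta>\<in>small_monos N d. E (r1 \<beta>) x * mono_eval \<beta> (V x))"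
    using assms(1) unfolding red_def by blast
  obtain L2 r2 where 2: "\<forall>x\<in>X. E c x ^ L2 * g x = (\<Sum>\<beta>\<in>small_monos N d. E (r2 \<beta>) x * mono_eval \<beta> (V x))"
    using assms(2) unfolding red_def by blast
  define L where "L = max L1 L2"
  obtain r1' where 1: "\<forall>x\<in>X. E c x ^ L * h x = (\<Sum>\<beta>\<in>small_monos N d. E (r1' \<beta>) x * mono_eval \<beta> (V x))"
    using red_raise[OF 1, of L] unfolding L_def by auto
  obtain r2' where 2: "\<forall>x\<in>X. E c x ^ L * g x = (\<Sum>\<beta>\<in>small_monos N d. E (r2' \<beta>) x * mono_eval \<beta> (V x))"
    using red_raise[OF 2, of L] unfolding L_def by auto
  show ?thesis unfolding red_def
    by (rule exI[of _ L], rule exI[of _ "\<lambda>\<beta>. r1' \<beta> + r2' \<beta>"])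
       (simp add: E_add distrib_left distrib_right sum.distrib 1 2)
qed

lemma red_sum: "(\<And>i. i \<in> S \<Longrightarrow> red (h i)) \<Longrightarrow> red (\<lambda>x. \<Sum>i\<in>S. h i x)"
  by (induction S rule: infinite_finite_induct) (auto intro: red_0 red_add)

lemma red_scale:
  assumes "red h"
  shows "red (\<lambda>x. E a x * h x)"
proof -
  obtain L r where 1: "\<forall>x\<in>X. E c x ^ L * h x = (\<Sum>\<beta>\<in>small_monos N d. E (r \<beta>) x * mono_eval \<beta> (V x))"
    using assms unfolding red_def by blast
  show ?thesis unfolding red_def
  proof (intro exI[of _ L] exI[of _ "\<lambda>\<beta>. a * r \<beta>"] ballI)
    fix x assume "x \<in> X"
    have "E c x ^ L * (E a x * h x) = E a x * (E c x ^ L * h x)" by simp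
    also have "\<dots> = (\<Sum>\<beta>\<in>small_monos N d. E (a * r \<beta>) x * mono_eval \<beta> (V x))"
      using 1 \<open>x \<in> X\<close> by (simp add: E_mult sum_distrib_left mult.assoc)
    finally show "E c x ^ L * (E a x * h x) = (\<Sum>\<beta>\<in>small_monos N d. E (a * r \<beta>) x * mono_eval \<beta> (V x))" .
  qed
qed

text \<open>Induction on the total degree: a monomial that is not small contains some
  \<open>d\<close>-th power, and replacing it by the equation lowers the total degree at the cost of
  one factor \<open>c\<close>.\<close>

lemma red_mono: "Poly_Mapping.keys \<beta> \<subseteq> {1..N} \<Longrightarrow> red (\<lambda>x. mono_eval \<beta> (V x))"
proof (induction "tdeg N \<beta>" arbitrary: \<beta> rule: less_induct)
  case less
  show ?case
  proof (cases "\<beta> \<in> small_monos N d")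
    case True
    have "(\<Sum>\<gamma>\<in>small_monos N d. E (if \<gamma> = \<beta> then 1 else 0) x * mono_eval \<gamma> (V x)) = mono_eval \<beta> (V x)" for x
    proof -
      have "(\<Sum>\<gamma>\<in>small_monos N d. E (if \<gamma> = \<beta> then 1 else 0) x * mono_eval \<gamma> (V x))
          = (\<Sum>\<gamma>\<in>small_monos N d. if \<gamma> = \<beta> then mono_eval \<gamma> (V x) else 0)"
        by (intro sum.cong) (auto simp: E_0 E_1)
      then show ?thesis using True finite_small_monos by simp
    qed
    then show ?thesis unfolding red_def
      by (intro exI[of _ 0] exI[of _ "\<lambda>\<gamma>. if \<gamma> = \<beta> then 1 else 0"]) simp
  next
    case False
    then obtain i where i: "Poly_Mapping.lookup \<beta> i \<ge> d"
      using less.prems by (auto simp: small_monos_def not_less)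
    \<comment> \<open>The exponent of an index outside \<open>{1..N}\<close> is 0, which is less
      than \<open>d\<close>; the large exponent therefore belongs to one of the first
      \<open>N\<close> variables.\<close>
    have "\<exists>i\<in>{1..N}. Poly_Mapping.lookup \<beta> i \<ge> d"
    proof (cases "i \<in> {1..N}")
      case False
      then have "i \<notin> Poly_Mapping.keys \<beta>" using less.prems by blast
      then show ?thesis using i d by (simp add: in_keys_iff)
    qed (use i in auto)
    then obtain i where i: "i \<in> {1..N}" "Poly_Mapping.lookup \<beta> i \<ge> d" by blast
    define \<beta>' where "\<beta>' = \<beta> - Poly_Mapping.single i d"
    have \<beta>: "\<beta> = \<beta>' + Poly_Mapping.single i d"
      by (rule poly_mapping_eqI) (use i in \<open>auto simp: \<beta>'_def lookup_add lookup_minus lookup_single when_def\<close>)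
    have k: "Poly_Mapping.keys \<beta>' \<subseteq> {1..N}"
      using less.prems by (auto simp: \<beta>'_def in_keys_iff lookup_minus subset_iff)
    have td: "tdeg N \<beta> = tdeg N \<beta>' + d"
    proof -
      have "(\<Sum>j=1..N. Poly_Mapping.lookup (Poly_Mapping.single i d) j) = (\<Sum>j=1..N. if j = i then d else 0)"
        by (intro sum.cong) (auto simp: lookup_single when_def)
      also have "\<dots> = d" using i(1) by simp
      finally show ?thesis unfolding \<beta> tdeg_def by (simp add: lookup_add sum.distrib)
    qed
    have "red (\<lambda>x. mono_eval (\<beta>' + \<gamma>) (V x))" if "\<gamma> \<in> G" for \<gamma>
    proof (rule less.hyps)
      show "tdeg N (\<beta>' + \<gamma>) < tdeg N \<beta>"
        unfolding td using G(3)[OF that] by (simp add: tdeg_def lookup_add sum.distrib)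
      show "Poly_Mapping.keys (\<beta>' + \<gamma>) \<subseteq> {1..N}"
        using keys_add[of \<beta>' \<gamma>] k G(2)[OF that] by blast
    qed
    then have "red (\<lambda>x. \<Sum>\<gamma>\<in>G. E (m i \<gamma>) x * mono_eval (\<beta>' + \<gamma>) (V x))"
      by (intro red_sum red_scale)
    then obtain L r where 1: "\<forall>x\<in>X. E c x ^ L * (\<Sum>\<gamma>\<in>G. E (m i \<gamma>) x * mono_eval (\<beta>' + \<gamma>) (V x))
        = (\<Sum>\<beta>\<in>small_monos N d. E (r \<beta>) x * mono_eval \<beta> (V x))"
      unfolding red_def by blast
    show ?thesis unfolding red_def
    proof (intro exI[of _ "Suc L"] exI[of _ r] ballI)
      fix x assume x: "x \<in> X"
      have "mono_eval (Poly_Mapping.single i d) (V x) = V x i ^ d"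
        by (cases "d = 0") (auto simp: mono_eval_def)
      then have "E c x ^ Suc L * mono_eval \<beta> (V x) = E c x ^ L * (mono_eval \<beta>' (V x) * (E c x * V x i ^ d))"
        unfolding \<beta> mono_eval_add by (simp add: mult_ac)
      also have "mono_eval \<beta>' (V x) * (E c x * V x i ^ d) = (\<Sum>\<gamma>\<in>G. E (m i \<gamma>) x * mono_eval (\<beta>' + \<gamma>) (V x))"
        unfolding crit[OF x i(1)] by (simp add: sum_distrib_left mono_eval_add mult_ac)
      also have "E c x ^ L * \<dots> = (\<Sum>\<beta>\<in>small_monos N d. E (r \<beta>) x * mono_eval \<beta> (V x))"
        using 1 x by blast
      finally show "E c x ^ Suc L * mono_eval \<beta> (V x) = (\<Sum>\<beta>\<in>small_monos N d. E (r \<beta>) x * mono_eval \<beta> (V x))" .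
    qed
  qed
qed

lemma red_peval: "p \<in> polys N \<Longrightarrow> red (\<lambda>x. peval p (V x))"
proof -
  assume p: "p \<in> polys N"
  have "red (\<lambda>x. \<Sum>\<beta>\<in>Poly_Mapping.keys p. E (K (Poly_Mapping.lookup p \<beta>)) x * mono_eval \<beta> (V x))"
    by (intro red_sum red_scale red_mono) (use p in \<open>auto simp: polys_def\<close>)
  then show ?thesis by (simp add: E_K peval_def)
qed

text \<open>Modulo the critical equations every polynomial is a combination of the finitely many small monomials,
  so the powers of \<open>p\<close> are linearly dependent over the ring of parameters.\<close>

lemma ex_algebraic_relation:
  assumes "p \<in> polys N"
  shows "\<exists>M \<phi>. (\<exists>j\<le>M. \<phi> j \<noteq> 0) \<and>
     (\<forall>x\<in>X. E c x \<noteq> 0 \<longrightarrow> (\<Sum>j\<le>M. E (\<phi> j) x * peval p (V x) ^ j) = 0)"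
proof -
  let ?B = "small_monos N d"
  \<comment> \<open>The \<open>M + 1\<close> powers with exponents 0 to \<open>M\<close> are
    combinations of only \<open>M\<close> small monomials.\<close>
  define M where "M = card ?B"
  have "\<exists>L r. \<forall>x\<in>X. E c x ^ L * peval p (V x) ^ j = (\<Sum>\<beta>\<in>?B. E (r \<beta>) x * mono_eval \<beta> (V x))" for j
    using red_peval[OF polys_power[OF assms, of j]] unfolding red_def peval_power .
  then obtain L r where Lr: "\<And>j x. x \<in> X \<Longrightarrow> E c x ^ L j * peval p (V x) ^ j = (\<Sum>\<beta>\<in>?B. E (r j \<beta>) x * mono_eval \<beta> (V x))"
    by metis
  define L0 where "L0 = (\<Sum>j\<le>M. L j)"
  have "\<exists>r. \<forall>x\<in>X. E c x ^ L0 * peval p (V x) ^ j = (\<Sum>\<beta>\<in>?B. E (r \<beta>) x * mono_eval \<beta> (V x))" if "j \<le> M" for j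
    by (rule red_raise[of "L j" _ "r j"]) (use that Lr in \<open>auto simp: L0_def intro: member_le_sum\<close>)
  then obtain s where s: "\<And>j x. j \<le> M \<Longrightarrow> x \<in> X \<Longrightarrow> E c x ^ L0 * peval p (V x) ^ j = (\<Sum>\<beta>\<in>?B. E (s j \<beta>) x * mono_eval \<beta> (V x))"
    by metis
  obtain \<phi> where \<phi>: "\<exists>j\<in>{..M}. \<phi> j \<noteq> 0" "\<forall>\<gamma>\<in>?B. (\<Sum>j\<in>{..M}. \<phi> j * s j \<gamma>) = 0"
    using idom_linear_dependence[of ?B "{..M}" s] finite_small_monos by (auto simp: M_def)
  have "(\<Sum>j\<le>M. E (\<phi> j) x * peval p (V x) ^ j) = 0" if x: "x \<in> X" "E c x \<noteq> 0" for x
  proof -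
    have "E c x ^ L0 * (\<Sum>j\<le>M. E (\<phi> j) x * peval p (V x) ^ j) =
        (\<Sum>j\<le>M. E (\<phi> j) x * (\<Sum>\<beta>\<in>?B. E (s j \<beta>) x * mono_eval \<beta> (V x)))"
      using s[OF _ x(1)] by (simp add: sum_distrib_left mult_ac flip: s)
    also have "\<dots> = (\<Sum>\<beta>\<in>?B. E (\<Sum>j\<le>M. \<phi> j * s j \<beta>) x * mono_eval \<beta> (V x))"
      unfolding E_sum E_mult sum_distrib_left sum_distrib_right
      by (subst sum.swap) (simp add: mult_ac)
    also have "\<dots> = 0" using \<phi>(2) by (simp add: E_0)
    finally show ?thesis using x(2) by simp
  qed
  then show ?thesis using \<phi>(1) by blast
qed

end

text \<open>The exponent \<open>e\<close> is the least order of vanishing at 0 among the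
  coefficients, so dividing all of them by \<open>x ^ e\<close> leaves at least one that is nonzero
  at 0. This is what keeps a relation nontrivial when a parameter tends to 0.\<close>

lemma poly_strip:
  fixes \<phi> :: "nat \<Rightarrow> 'a::idom poly"
  assumes "\<exists>j\<le>M. \<phi> j \<noteq> 0"
  shows "\<exists>e \<psi>. (\<forall>j\<le>M. \<forall>x. poly (\<phi> j) x = x ^ e * poly (\<psi> j) x) \<and> (\<exists>j\<le>M. poly (\<psi> j) 0 \<noteq> 0)"
proof -
  let ?P = "\<lambda>n. \<exists>j\<le>M. coeff (\<phi> j) n \<noteq> 0"
  define e where "e = (LEAST n. ?P n)"
  have "\<exists>n. ?P n" using assms by (auto simp: poly_eq_iff)
  then have e: "?P e" unfolding e_def by (rule LeastI_ex)
  have least: "coeff (\<phi> j) n = 0" if "j \<le> M" "n < e" for j n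
    using not_less_Least[of n ?P] that unfolding e_def by blast
  have "\<phi> j = monom 1 e * poly_shift e (\<phi> j)" if "j \<le> M" for j
    by (rule poly_eqI) (auto simp: coeff_monom_mult coeff_poly_shift least[OF that])
  then have "poly (\<phi> j) x = x ^ e * poly (poly_shift e (\<phi> j)) x" if "j \<le> M" for j x
    using that by (metis mult.left_neutral poly_monom poly_mult)
  moreover have "\<exists>j\<le>M. poly (poly_shift e (\<phi> j)) 0 \<noteq> 0"
    using e by (simp add: poly_0_coeff_0 coeff_poly_shift)
  ultimately show ?thesis by (intro exI[of _ e] exI[of _ "\<lambda>j. poly_shift e (\<phi> j)"]) auto
qed

text \<open>The leading coefficient in \<open>T\<close> is at least a constant times
  \<open>\<bar>d\<bar> ^ e\<close> near 0, whereas the lower coefficients are bounded for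
  \<open>\<bar>d\<bar> \<le> 1\<close>. Comparing the leading term with the rest bounds every root
  \<open>T \<ge> 1\<close>.\<close>

lemma root_bound:
  fixes \<phi> :: "nat \<Rightarrow> real poly"
  assumes "\<exists>j\<le>M. \<phi> j \<noteq> 0"
  shows "\<exists>C>0. \<exists>k. \<exists>d0>0. \<forall>d T. 0 < \<bar>d\<bar> \<and> \<bar>d\<bar> < d0 \<and> 1 \<le> T \<and> (\<Sum>j\<le>M. poly (\<phi> j) d * T ^ j) = 0 \<longrightarrow>
     T * \<bar>d\<bar> ^ k \<le> C"
proof -
  \<comment> \<open>The degree in \<open>T\<close>; vanishing top coefficients must be skipped
    before a lower bound for the leading one makes sense.\<close>
  define J where "J = Max {j. j \<le> M \<and> \<phi> j \<noteq> 0}"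
  have "J \<in> {j. j \<le> M \<and> \<phi> j \<noteq> 0}" unfolding J_def
    by (rule Max_in) (use assms in auto)
  then have J: "J \<le> M" "\<phi> J \<noteq> 0" by auto
  have J0: "\<phi> j = 0" if "j \<le> M" "j > J" for j
  proof (rule ccontr)
    assume "\<phi> j \<noteq> 0"
    then have "j \<le> J" unfolding J_def using that(1) by (intro Max_ge) auto
    then show False using that(2) by simp
  qed
  obtain e \<psi> where \<psi>: "\<And>x. poly (\<phi> J) x = x ^ e * poly \<psi> x" "poly \<psi> 0 \<noteq> 0"
    using poly_strip[of 0 "\<lambda>_. \<phi> J"] J(2) by auto
  have "\<forall>\<^sub>F x in at 0. \<bar>poly \<psi> x\<bar> > \<bar>poly \<psi> 0\<bar> / 2"
  proof (rule order_tendstoD(1))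
    show "((\<lambda>x. \<bar>poly \<psi> x\<bar>) \<longlongrightarrow> \<bar>poly \<psi> 0\<bar>) (at 0)"
      by (intro tendsto_rabs isContD) simp
  qed (use \<psi>(2) in simp)
  then obtain d0 where d0: "d0 > 0" "\<And>x. x \<noteq> 0 \<Longrightarrow> \<bar>x\<bar> < d0 \<Longrightarrow> \<bar>poly \<psi> x\<bar> > \<bar>poly \<psi> 0\<bar> / 2"
    unfolding eventually_at by (auto simp: dist_real_def)
  have "\<exists>C. \<forall>x. \<bar>x\<bar> \<le> 1 \<longrightarrow> \<bar>poly (\<phi> j) x\<bar> \<le> C" for j
  proof -
    have "compact ((\<lambda>x. poly (\<phi> j) x) ` cball 0 1)"
      by (intro compact_continuous_image continuous_intros) auto
    then have "bounded ((\<lambda>x. poly (\<phi> j) x) ` cball 0 1)" by (rule compact_imp_bounded)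
    then obtain a where "\<forall>y\<in>(\<lambda>x. poly (\<phi> j) x) ` cball 0 1. norm y \<le> a" unfolding bounded_iff by blast
    then have "\<bar>poly (\<phi> j) x\<bar> \<le> a" if "\<bar>x\<bar> \<le> 1" for x using that by force
    then show ?thesis by blast
  qed
  then obtain B where B: "\<And>j x. \<bar>x\<bar> \<le> 1 \<Longrightarrow> \<bar>poly (\<phi> j) x\<bar> \<le> B j" by metis
  have B0: "0 \<le> B j" for j using B[of 0 j] by simp
  define S where "S = (\<Sum>j<J. B j)"
  have S0: "S \<ge> 0" unfolding S_def by (intro sum_nonneg B0)
  define c where "c = \<bar>poly \<psi> 0\<bar> / 2"
  have c: "c > 0" using \<psi>(2) by (simp add: c_def)
  show ?thesis
  proof (rule exI[of _ "S / c + 1"], rule conjI[rotated], rule exI[of _ e], rule exI[of _ "min d0 1"],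
      rule conjI[rotated], intro allI impI)
    fix d T :: real
    assume H: "0 < \<bar>d\<bar> \<and> \<bar>d\<bar> < min d0 1 \<and> 1 \<le> T \<and> (\<Sum>j\<le>M. poly (\<phi> j) d * T ^ j) = 0"
    have T: "T \<ge> 1" using H by simp
    have "(\<Sum>j\<le>M. poly (\<phi> j) d * T ^ j) = (\<Sum>j\<le>J. poly (\<phi> j) d * T ^ j)"
      by (rule sum.mono_neutral_right) (use J J0 in auto)
    also have "\<dots> = (\<Sum>j<J. poly (\<phi> j) d * T ^ j) + poly (\<phi> J) d * T ^ J"
      by (simp add: lessThan_Suc_atMost[symmetric])
    finally have eq: "poly (\<phi> J) d * T ^ J = - (\<Sum>j<J. poly (\<phi> j) d * T ^ j)" using H by simp
    have "c * \<bar>d\<bar> ^ e * T ^ J \<le> \<bar>poly (\<phi> J) d * T ^ J\<bar>"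
    proof -
      have "c * \<bar>d\<bar> ^ e \<le> \<bar>poly (\<phi> J) d\<bar>"
        unfolding \<psi>(1) abs_mult power_abs using d0(2)[of d] H
        by (subst mult.commute, intro mult_left_mono) (auto simp: c_def)
      then show ?thesis unfolding abs_mult using T by (intro mult_mono) auto
    qed
    also have "\<dots> \<le> (\<Sum>j<J. \<bar>poly (\<phi> j) d * T ^ j\<bar>)" unfolding eq abs_minus_cancel by (rule sum_abs)
    also have "\<dots> \<le> (\<Sum>j<J. B j * T ^ (J - 1))"
    proof (rule sum_mono)
      fix j assume "j \<in> {..<J}"
      then have "T ^ j \<le> T ^ (J - 1)" using T by (intro power_increasing) auto
      then show "\<bar>poly (\<phi> j) d * T ^ j\<bar> \<le> B j * T ^ (J - 1)"
        unfolding abs_mult using B[of d j] H T B0 by (intro mult_mono) auto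
    qed
    also have "\<dots> = S * T ^ (J - 1)" by (simp add: S_def sum_distrib_right)
    finally have main: "c * \<bar>d\<bar> ^ e * T ^ J \<le> S * T ^ (J - 1)" .
    have "J \<noteq> 0"
    proof
      assume "J = 0"
      then have "c * \<bar>d\<bar> ^ e \<le> 0" using main by (simp add: S_def)
      moreover have "c * \<bar>d\<bar> ^ e > 0" using c H by simp
      ultimately show False by simp
    qed
    then have "T ^ J = T * T ^ (J - 1)" by (cases J) auto
    then have "(c * \<bar>d\<bar> ^ e * T) * T ^ (J - 1) \<le> S * T ^ (J - 1)" using main by (simp add: mult_ac)
    then have "c * \<bar>d\<bar> ^ e * T \<le> S" using T by (subst (asm) mult_le_cancel_right_pos) auto
    then have "T * \<bar>d\<bar> ^ e \<le> S / c" using c by (simp add: field_simps)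
    then show "T * \<bar>d\<bar> ^ e \<le> S / c + 1" by simp
  qed (use S0 c d0 in \<open>auto intro: add_nonneg_pos\<close>)
qed

section \<open>The penalised problem and its critical points\<close>

type_synonym poly3 = "real poly poly poly"

text \<open>The nesting follows the order of the limits: \<open>e\<close> is the outermost variable
  and is sent to 0 first, then \<open>z\<close>; the level \<open>d\<close> remains.\<close>

definition eval3 :: "poly3 \<Rightarrow> real \<Rightarrow> real \<Rightarrow> real \<Rightarrow> real" where
  "eval3 \<phi> d z e = poly (poly (poly \<phi> [:[:e:]:]) [:z:]) d"

lemma eval3_simps:
  "eval3 (a + b) d z e = eval3 a d z e + eval3 b d z e"
  "eval3 (a * b) d z e = eval3 a d z e * eval3 b d z e"
  "eval3 (a - b) d z e = eval3 a d z e - eval3 b d z e"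
  "eval3 (- a) d z e = - eval3 a d z e"
  "eval3 1 d z e = 1"
  "eval3 0 d z e = 0"
  "eval3 [:[:[:t:]:]:] d z e = t"
  "eval3 [:[:[:0, 1:]:]:] d z e = d"
  "eval3 [:[:0, 1:]:] d z e = z"
  "eval3 [:0, 1:] d z e = e"
  "eval3 [:[:[:0, 0, 1:]:]:] d z e = d * d"
  by (simp_all add: eval3_def)

lemma tendsto_poly_const:
  "((\<lambda>z. poly (poly p [:z:]) d) \<longlongrightarrow> poly (poly p 0) d) (at (0::real))" for p :: "real poly poly"
proof -
  have "isCont (\<lambda>z. poly (poly p [:z:]) d) z" for z :: real
    by (induction p) auto
  from isContD[OF this[of 0]] show ?thesis by simp
qed

lemma tendsto_eval3: "((\<lambda>e. eval3 \<phi> d z e) \<longlongrightarrow> poly (poly (poly \<phi> 0) [:z:]) d) (at 0)"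
proof -
  have "isCont (\<lambda>e. eval3 \<phi> d z e) e" for e :: real
    unfolding eval3_def by (induction \<phi>) auto
  from isContD[OF this[of 0]] show ?thesis by (simp add: eval3_def)
qed

lemma peval_has_derivative_self:
  fixes x :: "nat \<Rightarrow> real"
  shows "((\<lambda>t. peval p (x(n := t))) has_field_derivative peval (partial_deriv n p) x) (at (x n))"
  using peval_has_derivative[of p x n "x n"] by simp

lemma continuous_on_peval: "continuous_on S (\<lambda>v::nat \<Rightarrow> real. peval p v)"
  unfolding peval_def mono_eval_def
  by (intro continuous_intros continuous_on_product_coordinates continuous_on_subset[OF _ subset_UNIV])

text \<open>Points are functions on all of \<open>nat\<close>. Freezing the coordinates outside
  \<open>{1..N}\<close> at 0 makes the box a product of compact sets, hence compact in the product
  topology.\<close>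

definition box_upto :: "nat \<Rightarrow> real \<Rightarrow> (nat \<Rightarrow> real) set" where
  "box_upto N b = PiE UNIV (\<lambda>i. if i \<in> {1..N} then {-b..b} else {0})"

lemma compact_box_upto: "compact (box_upto N b)"
proof -
  have "compactin (product_topology (\<lambda>i. euclidean) UNIV) (box_upto N b)"
    unfolding box_upto_def compactin_PiE by (auto simp: compactin_euclidean_iff)
  then show ?thesis
    by (simp add: euclidean_product_topology compactin_euclidean_iff)
qed

lemma box_upto_iff: "v \<in> box_upto N b \<longleftrightarrow> (\<forall>i\<in>{1..N}. \<bar>v i\<bar> \<le> b) \<and> (\<forall>i. i \<notin> {1..N} \<longrightarrow> v i = 0)"
  unfolding box_upto_def PiE_UNIV_domain by (auto simp: Pi_iff abs_le_iff split: if_splits) force+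

text \<open>For \<open>\<bar>t\<bar> \<ge> 1\<close> reduce to the exponent 4 and complete the
  square: \<open>z * t ^ 4 - 2 * t\<^sup>2 + 1 / z = z * (t\<^sup>2 - 1 / z)\<^sup>2\<close>; for
  smaller t the constant 2 suffices. The coefficient 2 leaves one square over after the penalty has
  subtracted \<open>t\<^sup>2\<close>, which gives coercivity.\<close>

lemma even_power_dominates:
  fixes z t :: real
  assumes "z > 0" "D \<ge> 2"
  shows "z * t ^ (2 * D) \<ge> 2 * t\<^sup>2 - (2 + 1 / z)"
proof (cases "\<bar>t\<bar> \<ge> 1")
  case True
  have "t ^ 4 = \<bar>t\<bar> ^ 4" by (simp add: power_even_abs)
  also have "\<dots> \<le> \<bar>t\<bar> ^ (2 * D)" using True assms(2) by (intro power_increasing) auto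
  also have "\<dots> = t ^ (2 * D)" by (simp add: power_even_abs)
  finally have "z * t ^ 4 \<le> z * t ^ (2 * D)" using assms(1) by simp
  moreover have "z * t ^ 4 - 2 * t\<^sup>2 + 1 / z = z * (t\<^sup>2 - 1 / z)\<^sup>2"
    using assms(1) by (simp add: power2_eq_square power4_eq_xxxx field_simps)
  then have "z * t ^ 4 - 2 * t\<^sup>2 + 1 / z \<ge> 0" using assms(1) by simp
  ultimately show ?thesis by linarith
next
  case False
  then have "t\<^sup>2 \<le> 1" by (simp add: abs_square_le_1)
  moreover have "z * t ^ (2 * D) \<ge> 0" using assms(1) by (simp add: power_mult)
  moreover have "1 / z > 0" using assms(1) by simp
  ultimately show ?thesis by linarith
qed

text \<open>The penalised problem: for small \<open>e\<close> and then small \<open>z\<close>, minimisers of \<open>penalty\<close> approach points of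
  \<open>{A = d B}\<close> at which the sum of squares is at least as large as at any prescribed point of that set.\<close>

definition penalty :: "nat \<Rightarrow> mpoly \<Rightarrow> mpoly \<Rightarrow> nat \<Rightarrow> real \<Rightarrow> real \<Rightarrow> real \<Rightarrow> (nat \<Rightarrow> real) \<Rightarrow> real" where
  "penalty N A B D d z e v = (peval A v - d * peval B v)\<^sup>2
     + e * (z * (\<Sum>i=1..N. v i ^ (2 * D)) - (\<Sum>i=1..N. (v i)\<^sup>2))"

text \<open>Minus the i-th partial derivative of the penalty, without its term in \<open>z\<close>,
  is a combination of 1, d, d^2 and e with these four coefficients; the matching parameters are
  listed by \<open>crit_coeff\<close>.\<close>

definition crit_poly :: "mpoly \<Rightarrow> mpoly \<Rightarrow> nat \<Rightarrow> nat \<Rightarrow> mpoly" where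
  "crit_poly A B i k = (if k = 0 then - partial_deriv i (A * A) else if k = 1 then Const 2 * partial_deriv i (A * B)
     else if k = 2 then - partial_deriv i (B * B) else Const 2 * Var i)"

definition crit_coeff :: "nat \<Rightarrow> poly3" where
  "crit_coeff k = (if k = 0 then 1 else if k = 1 then [:[:[:0, 1:]:]:] else if k = 2 then [:[:[:0, 1:]:]:] * [:[:[:0, 1:]:]:]
     else [:0, 1:])"

text \<open>This is the vanishing of the gradient of \<open>penalty\<close>, solved for the leading
  power as the locale \<open>reduction\<close> requires.\<close>

definition critical :: "nat \<Rightarrow> mpoly \<Rightarrow> mpoly \<Rightarrow> nat \<Rightarrow> real \<Rightarrow> real \<Rightarrow> real \<Rightarrow> (nat \<Rightarrow> real) \<Rightarrow> bool" where
  "critical N A B D d z e v \<longleftrightarrow> (\<forall>i\<in>{1..N}. 2 * real D * z * e * v i ^ (2 * D - 1) =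
     (\<Sum>k<4. eval3 (crit_coeff k) d z e * peval (crit_poly A B i k) v))"

lemma penalty_has_derivative:
  assumes "i \<in> {1..N}" "D \<ge> 1"
  shows "((\<lambda>t. penalty N A B D d z e (v(i := t))) has_field_derivative
    (2 * real D * z * e * v i ^ (2 * D - 1) - (\<Sum>k<4. eval3 (crit_coeff k) d z e * peval (crit_poly A B i k) v))) (at (v i))"
proof -
  have s: "(\<Sum>j=1..N. (v(i := t)) j ^ n) = t ^ n + (\<Sum>j\<in>{1..N} - {i}. v j ^ n)" for t n
    using assms(1) by (subst sum.remove[of _ i]) (auto intro!: sum.cong)
  have eq: "penalty N A B D d z e (v(i := t)) = peval (A * A) (v(i := t)) - 2 * d * peval (A * B) (v(i := t))
     + d * d * peval (B * B) (v(i := t))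
     + e * (z * (t ^ (2 * D) + (\<Sum>j\<in>{1..N} - {i}. v j ^ (2 * D))) - (t\<^sup>2 + (\<Sum>j\<in>{1..N} - {i}. (v j)\<^sup>2)))" for t
    unfolding penalty_def s peval_mult by (simp add: power2_eq_square algebra_simps)
  have four: "{..<4::nat} = {0,1,2,3}" by auto
  show ?thesis
    unfolding eq four
    by (rule derivative_eq_intros peval_has_derivative_self refl)+
       (use assms in \<open>simp add: crit_coeff_def crit_poly_def eval3_simps peval_uminus peval_mult algebra_simps\<close>)
qed

text \<open>For large \<open>D\<close> the power \<open>2 * D - 1\<close> exceeds the degrees of all
  other terms of the gradient, so critical points satisfy the equations of \<open>reduction\<close>
  with leading coefficient \<open>2 * D * z * e\<close>, which is nonzero for positive parameters.
  The relation is the one for the sum of squares.\<close>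

lemma ex_relation_critical:
  assumes A: "A \<in> polys N" and B: "B \<in> polys N"
  shows "\<exists>D\<ge>2. \<exists>M \<phi>. (\<exists>j\<le>M. \<phi> j \<noteq> 0) \<and> (\<forall>d z e v. critical N A B D d z e v \<and> z > 0 \<and> e > 0 \<longrightarrow>
     (\<Sum>j\<le>M. eval3 (\<phi> j) d z e * (\<Sum>i=1..N. (v i)\<^sup>2) ^ j) = 0)"
proof -
  have cp: "crit_poly A B i k \<in> polys N" if "i \<in> {1..N}" for i k
    using that A B unfolding crit_poly_def
    by (auto intro!: polys_uminus polys_mult polys_partial_deriv polys_Var)
  define G where "G = (\<Union>i\<in>{1..N}. \<Union>k\<in>{..<4}. Poly_Mapping.keys (crit_poly A B i k))"
  have finG: "finite G" by (simp add: G_def)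
  have subG: "Poly_Mapping.keys \<gamma> \<subseteq> {1..N}" if "\<gamma> \<in> G" for \<gamma>
    using that cp unfolding G_def polys_def by blast
  \<comment> \<open>The sum bounds every total degree that occurs in the gradient; the summand 2
    provides \<open>D \<ge> 2\<close> for \<open>even_power_dominates\<close>.\<close>
  define D where "D = (\<Sum>\<gamma>\<in>G. tdeg N \<gamma>) + 2"
  have tdG: "tdeg N \<gamma> < 2 * D - 1" if "\<gamma> \<in> G" for \<gamma>
    using member_le_sum[OF that, of "tdeg N"] finG by (auto simp: D_def)
  let ?X = "{(d,z,e,v). critical N A B D d z e v}"
  let ?E = "\<lambda>r (d,z,e,v::nat \<Rightarrow> real). eval3 r d z e"
  let ?V = "\<lambda>(d::real,z::real,e::real,v::nat \<Rightarrow> real). v"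
  let ?c = "[:[:[:2 * real D:]:]:] * [:[:0, 1:]:] * [:0, 1:] :: poly3"
  let ?m = "\<lambda>i \<gamma>. \<Sum>k<4. crit_coeff k * [:[:[:Poly_Mapping.lookup (crit_poly A B i k) \<gamma>:]:]:]"
  have eval3_sum: "eval3 (sum f S) d z e = (\<Sum>i\<in>S. eval3 (f i) d z e)" for f d z e and S :: "nat set"
    by (induction S rule: infinite_finite_induct) (auto simp: eval3_simps)
  interpret reduction ?X ?E ?V N "2 * D - 1" ?c G ?m "\<lambda>t. [:[:[:t:]:]:]"
  proof
    fix x :: "real \<times> real \<times> real \<times> (nat \<Rightarrow> real)" and i assume x: "x \<in> ?X" and i: "i \<in> {1..N}"
    obtain d z e v where xeq: "x = (d,z,e,v)" by (cases x)
    have "2 * real D * z * e * v i ^ (2 * D - 1) = (\<Sum>k<4. eval3 (crit_coeff k) d z e * peval (crit_poly A B i k) v)"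
      using x i unfolding xeq critical_def by blast
    also have "\<dots> = (\<Sum>k<4. eval3 (crit_coeff k) d z e *
        (\<Sum>\<gamma>\<in>G. Poly_Mapping.lookup (crit_poly A B i k) \<gamma> * mono_eval \<gamma> v))"
    proof (intro sum.cong refl arg_cong2[of _ _ _ _ "(*)"])
      fix k assume "k \<in> {..<4::nat}"
      then have "Poly_Mapping.keys (crit_poly A B i k) \<subseteq> G" using i unfolding G_def by blast
      from peval_superset[OF finG this, of v]
      show "peval (crit_poly A B i k) v = (\<Sum>\<gamma>\<in>G. Poly_Mapping.lookup (crit_poly A B i k) \<gamma> * mono_eval \<gamma> v)" by simp
    qed
    also have "\<dots> = (\<Sum>\<gamma>\<in>G. eval3 (?m i \<gamma>) d z e * mono_eval \<gamma> v)"
      unfolding eval3_sum eval3_simps sum_distrib_left sum_distrib_right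
      by (subst sum.swap) (simp add: mult_ac)
    finally show "?E ?c x * ?V x i ^ (2 * D - 1) = (\<Sum>\<gamma>\<in>G. ?E (?m i \<gamma>) x * mono_eval \<gamma> (?V x))"
      unfolding xeq by (simp only: prod.case eval3_simps)
  qed (use finG subG tdG in \<open>auto simp: eval3_simps D_def split: prod.splits\<close>)
  define p where "p = (\<Sum>i=1..N. Var i * Var i)"
  have p: "p \<in> polys N" unfolding p_def by (intro polys_sum polys_mult polys_Var)
  have pe: "peval p v = (\<Sum>i=1..N. (v i)\<^sup>2)" for v :: "nat \<Rightarrow> real"
    by (simp add: p_def peval_sum peval_mult power2_eq_square)
  obtain M \<phi> where *: "\<exists>j\<le>M. \<phi> j \<noteq> 0"
     "\<forall>x\<in>?X. ?E ?c x \<noteq> 0 \<longrightarrow> (\<Sum>j\<le>M. ?E (\<phi> j) x * peval p (?V x) ^ j) = 0"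
    using ex_algebraic_relation[OF p] by blast
  have "(\<Sum>j\<le>M. eval3 (\<phi> j) d z e * (\<Sum>i=1..N. (v i)\<^sup>2) ^ j) = 0"
    if "critical N A B D d z e v \<and> z > 0 \<and> e > 0" for d z e v
  proof -
    have "D \<ge> 2" by (simp add: D_def)
    then have "real D > 0" by simp
    then have "?E ?c (d,z,e,v) \<noteq> 0" using that by (simp only: prod.case eval3_simps) simp
    then show ?thesis using *(2)[rule_format, of "(d,z,e,v)"] that by (simp add: pe)
  qed
  then show ?thesis using *(1) by (intro exI[of _ D]) (auto simp: D_def)
qed

text \<open>Compare with \<open>y\<close>, where the squared term of the penalty vanishes. By
  coercivity every point that is not worse than \<open>y\<close> lies strictly inside the box, so a
  minimiser over the compact box is an interior critical point. The other two bounds express that it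
  is not worse than \<open>y\<close>.\<close>

lemma ex_penalty_minimiser:
  assumes N: "D \<ge> 2" and z: "z > 0" and e: "e > 0" and y0: "\<And>i. i \<notin> {1..N} \<Longrightarrow> y i = 0"
    and y: "peval A y = d * peval B y"
    and b: "b > 0" "b\<^sup>2 > z * (\<Sum>i=1..N. y i ^ (2 * D)) - (\<Sum>i=1..N. (y i)\<^sup>2) + real N * (2 + 1 / z)"
  shows "\<exists>v\<in>box_upto N b. critical N A B D d z e v \<and>
     (peval A v - d * peval B v)\<^sup>2 \<le> e * b\<^sup>2 \<and>
     (\<Sum>i=1..N. (v i)\<^sup>2) \<ge> (\<Sum>i=1..N. (y i)\<^sup>2) - z * (\<Sum>i=1..N. y i ^ (2 * D))"
proof -
  let ?Z = "\<lambda>v. z * (\<Sum>i=1..N. v i ^ (2 * D)) - (\<Sum>i=1..N. (v i)\<^sup>2)"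
  let ?K = "penalty N A B D d z e"
  have lower: "?Z v \<ge> (\<Sum>i=1..N. (v i)\<^sup>2) - real N * (2 + 1 / z)" for v
  proof -
    have "(\<Sum>i=1..N. z * v i ^ (2 * D)) \<ge> (\<Sum>i=1..N. 2 * (v i)\<^sup>2 - (2 + 1 / z))"
      by (intro sum_mono even_power_dominates z N)
    then show ?thesis by (simp add: sum_distrib_left[symmetric] sum_subtractf)
  qed
  have Ky: "?K y = e * ?Z y" by (simp add: penalty_def y)
  \<comment> \<open>One comparison gives three facts: the penalty part does not exceed that at
    \<open>y\<close>, the point lies in the open ball of radius \<open>b\<close>, and the defect of
    the level equation is of order \<open>e\<close>.\<close>
  have sub: "?Z v \<le> ?Z y \<and> (\<Sum>i=1..N. (v i)\<^sup>2) < b\<^sup>2 \<and> (peval A v - d * peval B v)\<^sup>2 \<le> e * b\<^sup>2" if "?K v \<le> ?K y" for v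
  proof -
    have *: "(peval A v - d * peval B v)\<^sup>2 + e * ?Z v \<le> e * ?Z y"
      using that unfolding Ky by (simp add: penalty_def)
    then have "e * ?Z v \<le> e * ?Z y" using zero_le_power2[of "peval A v - d * peval B v"] by linarith
    then have le: "?Z v \<le> ?Z y" using e by simp
    moreover have "(\<Sum>i=1..N. (v i)\<^sup>2) < b\<^sup>2" using lower[of v] le b(2) by linarith
    moreover have "(peval A v - d * peval B v)\<^sup>2 \<le> e * (?Z y - ?Z v)" using * by (simp add: algebra_simps)
    moreover have "?Z y - ?Z v \<le> b\<^sup>2"
      using lower[of v] b(2) sum_nonneg[of "{1..N}" "\<lambda>i. (v i)\<^sup>2"] by simp
    then have "e * (?Z y - ?Z v) \<le> e * b\<^sup>2" using e by (intro mult_left_mono) auto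
    ultimately show ?thesis by linarith
  qed
  have coord: "\<bar>v i\<bar> < b" if "(\<Sum>i=1..N. (v i)\<^sup>2) < b\<^sup>2" "i \<in> {1..N}" for v :: "nat \<Rightarrow> real" and i
  proof -
    have "(v i)\<^sup>2 \<le> (\<Sum>i=1..N. (v i)\<^sup>2)" by (rule member_le_sum) (use that in auto)
    then have "\<bar>v i\<bar>\<^sup>2 < b\<^sup>2" using that by simp
    then show ?thesis using b(1) by (intro power2_less_imp_less[of "\<bar>v i\<bar>"]) auto
  qed
  have yS: "y \<in> box_upto N b"
    unfolding box_upto_iff using coord[of y] sub[of y] y0 by (auto intro: less_imp_le)
  have "continuous_on (box_upto N b) ?K"
    unfolding penalty_def
    by (intro continuous_intros continuous_on_peval continuous_on_product_coordinates continuous_on_subset[OF _ subset_UNIV])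
  then obtain v where v: "v \<in> box_upto N b" "\<And>u. u \<in> box_upto N b \<Longrightarrow> ?K v \<le> ?K u"
    using continuous_attains_inf[OF compact_box_upto, of N b ?K] yS by blast
  have props: "?Z v \<le> ?Z y" "(\<Sum>i=1..N. (v i)\<^sup>2) < b\<^sup>2" "(peval A v - d * peval B v)\<^sup>2 \<le> e * b\<^sup>2"
    using sub[OF v(2)[OF yS]] by auto
  have "critical N A B D d z e v"
    unfolding critical_def
  proof
    fix i assume i: "i \<in> {1..N}"
    have "2 * real D * z * e * v i ^ (2 * D - 1) - (\<Sum>k<4. eval3 (crit_coeff k) d z e * peval (crit_poly A B i k) v) = 0"
    proof (rule DERIV_local_min[OF penalty_has_derivative[OF i]])
      show "0 < b - \<bar>v i\<bar>" using coord[OF props(2) i] by simp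
      show "\<forall>t. \<bar>v i - t\<bar> < b - \<bar>v i\<bar> \<longrightarrow> ?K (v(i := v i)) \<le> ?K (v(i := t))"
      proof (intro allI impI)
        fix t assume "\<bar>v i - t\<bar> < b - \<bar>v i\<bar>"
        then have "\<bar>t\<bar> \<le> b" by linarith
        then have "v(i := t) \<in> box_upto N b" using v(1) i unfolding box_upto_iff by auto
        then show "?K (v(i := v i)) \<le> ?K (v(i := t))" using v(2) by simp
      qed
    qed (use N in simp)
    then show "2 * real D * z * e * v i ^ (2 * D - 1) = (\<Sum>k<4. eval3 (crit_coeff k) d z e * peval (crit_poly A B i k) v)"
      by simp
  qed
  moreover have "(\<Sum>i=1..N. (v i)\<^sup>2) \<ge> (\<Sum>i=1..N. (y i)\<^sup>2) - z * (\<Sum>i=1..N. y i ^ (2 * D))"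
  proof -
    have "z * (\<Sum>i=1..N. v i ^ (2 * D)) \<ge> 0"
      using z by (intro mult_nonneg_nonneg sum_nonneg) (auto simp: power_mult)
    then show ?thesis using props(1) by linarith
  qed
  ultimately show ?thesis using v(1) props(3) by blast
qed

text \<open>The witness \<open>T\<close> is the limit of the sums of squares at the minimisers, first for \<open>e\<close> and then for
  \<open>z\<close> tending to 0. Dividing the relation by powers of \<open>e\<close> and \<open>z\<close> keeps it nontrivial in the limit.\<close>

lemma ex_relation_level_set:
  assumes A: "A \<in> polys N" and B: "B \<in> polys N"
  shows "\<exists>M \<phi>. (\<exists>j\<le>M. \<phi> j \<noteq> 0) \<and> (\<forall>d y R. peval A y = d * peval B y \<and>
      (\<forall>v. peval A v = d * peval B v \<longrightarrow> (\<Sum>i=1..N. (v i)\<^sup>2) \<le> R) \<longrightarrow>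
      (\<exists>T\<ge>(\<Sum>i=1..N. (y i)\<^sup>2). (\<Sum>j\<le>M. poly (\<phi> j) d * T ^ j) = (0::real)))"
proof -
  let ?\<rho> = "\<lambda>v::nat \<Rightarrow> real. \<Sum>i=1..N. (v i)\<^sup>2"
  obtain D M \<phi>3 where D: "D \<ge> 2" and \<phi>3: "\<exists>j\<le>M. \<phi>3 j \<noteq> 0"
    "\<And>d z e v. critical N A B D d z e v \<Longrightarrow> z > 0 \<Longrightarrow> e > 0 \<Longrightarrow>
     (\<Sum>j\<le>M. eval3 (\<phi>3 j) d z e * ?\<rho> v ^ j) = 0"
    using ex_relation_critical[OF A B] by blast
  obtain e3 \<psi>3 where \<psi>3: "\<And>j x. j \<le> M \<Longrightarrow> poly (\<phi>3 j) x = x ^ e3 * poly (\<psi>3 j) x" "\<exists>j\<le>M. poly (\<psi>3 j) 0 \<noteq> 0"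
    using poly_strip[OF \<phi>3(1)] by blast
  define \<phi>2 where "\<phi>2 j = poly (\<psi>3 j) 0" for j
  obtain e2 \<psi>2 where \<psi>2: "\<And>j x. j \<le> M \<Longrightarrow> poly (\<phi>2 j) x = x ^ e2 * poly (\<psi>2 j) x" "\<exists>j\<le>M. poly (\<psi>2 j) 0 \<noteq> 0"
    using poly_strip[OF \<psi>3(2)] unfolding \<phi>2_def by blast
  define \<phi>1 where "\<phi>1 j = poly (\<psi>2 j) 0" for j
  let ?eval2 = "\<lambda>p z d. poly (poly p [:z:]) d"
  have pow: "eval3 (\<phi>3 j) d z e = e ^ e3 * eval3 (\<psi>3 j) d z e" if "j \<le> M" for j d z e
    unfolding eval3_def \<psi>3(1)[OF that] by (simp add: poly_mult poly_power)
  have pow2: "?eval2 (\<phi>2 j) z d = z ^ e2 * ?eval2 (\<psi>2 j) z d" if "j \<le> M" for j d z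
    unfolding \<psi>2(1)[OF that] by (simp add: poly_mult poly_power)
  have harm: "(\<lambda>n. inverse (real (Suc n))) \<longlonglongrightarrow> 0" "\<And>n. inverse (real (Suc n)) > 0"
    using LIMSEQ_inverse_real_of_nat by auto
  have at0: "filterlim (\<lambda>n. inverse (real (Suc n))) (at 0) sequentially"
    unfolding filterlim_at using harm by auto
  have "\<exists>T\<ge>?\<rho> y. (\<Sum>j\<le>M. poly (\<phi>1 j) d * T ^ j) = 0"
    if y: "peval A y = d * peval B y" and R: "\<And>v. peval A v = d * peval B v \<Longrightarrow> ?\<rho> v \<le> R" for d y R
  proof -
    \<comment> \<open>The minimisers are compared with a point of the box, whose coordinates outside
      \<open>{1..N}\<close> have to be 0; the values of \<open>A\<close> and \<open>B\<close> do not
      change.\<close>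
    define y0 where "y0 i = (if i \<in> {1..N} then y i else 0)" for i
    have y0: "\<And>i. i \<notin> {1..N} \<Longrightarrow> y0 i = 0" "peval A y0 = d * peval B y0" "?\<rho> y0 = ?\<rho> y"
      using peval_cong[OF A, of y0 y] peval_cong[OF B, of y0 y] y by (auto simp: y0_def)
    define \<Sigma> where "\<Sigma> = (\<Sum>i=1..N. y0 i ^ (2 * D))"
    \<comment> \<open>The limit for \<open>e\<close> tending to 0 at fixed \<open>z\<close>. The
      limit point lies on the level set, so the hypothesis bounds its sum of squares by
      \<open>R\<close>; this uniform bound is the compactness needed for the limit in
      \<open>z\<close>.\<close>
    have step: "\<exists>T. ?\<rho> y - z * \<Sigma> \<le> T \<and> T \<le> R \<and> (\<Sum>j\<le>M. ?eval2 (\<phi>2 j) z d * T ^ j) = 0" if z: "z > 0" for z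
    proof -
      define \<kappa> where "\<kappa> = z * \<Sigma> - ?\<rho> y0 + real N * (2 + 1 / z)"
      \<comment> \<open>The bound depends on \<open>z\<close> and \<open>y\<close> but not on
        \<open>e\<close>, so the minimisers for all \<open>e\<close> lie in one compact box. With
        \<open>b \<ge> 1\<close> the square of \<open>b\<close> is at least \<open>b\<close>, which
        exceeds \<open>\<kappa>\<close>.\<close>
      define b where "b = \<bar>\<kappa>\<bar> + 1"
      have b1: "b \<ge> 1" "b > \<kappa>" unfolding b_def by auto
      then have "b * b \<ge> b * 1" by (intro mult_left_mono) auto
      then have b: "b > 0" "b\<^sup>2 > \<kappa>" using b1 unfolding power2_eq_square by linarith+
      have "\<forall>n. \<exists>v\<in>box_upto N b. critical N A B D d z (inverse (real (Suc n))) v \<and>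
         (peval A v - d * peval B v)\<^sup>2 \<le> inverse (real (Suc n)) * b\<^sup>2 \<and> ?\<rho> v \<ge> ?\<rho> y0 - z * \<Sigma>"
        unfolding \<Sigma>_def
        by (intro allI ex_penalty_minimiser D z harm(2) y0(1,2) b(1) b(2)[unfolded \<kappa>_def \<Sigma>_def])
      then obtain v where v: "\<And>n. v n \<in> box_upto N b" "\<And>n. critical N A B D d z (inverse (real (Suc n))) (v n)"
         "\<And>n. (peval A (v n) - d * peval B (v n))\<^sup>2 \<le> inverse (real (Suc n)) * b\<^sup>2"
         "\<And>n. ?\<rho> (v n) \<ge> ?\<rho> y0 - z * \<Sigma>" by metis
      obtain l r where l: "l \<in> box_upto N b" "strict_mono r" "(v \<circ> r) \<longlonglongrightarrow> l"
        using compact_box_upto[of N b] v(1) unfolding compact_eq_seq_compact_metric seq_compact_def by metis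
      have lim: "(\<lambda>n. h (v (r n))) \<longlonglongrightarrow> h l" if "continuous_on UNIV h" for h :: "(nat \<Rightarrow> real) \<Rightarrow> real"
        using continuous_on_tendsto_compose[OF that l(3)] by (simp add: o_def)
      have c\<rho>: "continuous_on UNIV ?\<rho>"
        by (intro continuous_intros continuous_on_product_coordinates)
      have e0: "filterlim (\<lambda>n. inverse (real (Suc (r n)))) (at 0) sequentially"
        using filterlim_compose[OF at0 filterlim_subseq[OF l(2)]] .
      have e0': "(\<lambda>n. inverse (real (Suc (r n))) * b\<^sup>2) \<longlonglongrightarrow> 0 * b\<^sup>2"
        using e0 by (intro tendsto_intros) (simp add: filterlim_at)
      have "(\<lambda>n. (peval A (v (r n)) - d * peval B (v (r n)))\<^sup>2) \<longlonglongrightarrow> (peval A l - d * peval B l)\<^sup>2"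
        by (rule lim) (intro continuous_intros continuous_on_peval)
      from LIMSEQ_le[OF this e0'] have "(peval A l - d * peval B l)\<^sup>2 \<le> 0 * b\<^sup>2" using v(3) by blast
      then have lV: "peval A l = d * peval B l" by simp
      have "?\<rho> l \<ge> ?\<rho> y - z * \<Sigma>"
        by (rule LIMSEQ_le_const[OF lim[OF c\<rho>]]) (use v(4) y0(3) in auto)
      moreover have "(\<Sum>j\<le>M. ?eval2 (\<phi>2 j) z d * ?\<rho> l ^ j) = 0"
      proof -
        have "(\<lambda>n. \<Sum>j\<le>M. eval3 (\<psi>3 j) d z (inverse (real (Suc (r n)))) * ?\<rho> (v (r n)) ^ j) \<longlonglongrightarrow>
          (\<Sum>j\<le>M. ?eval2 (\<phi>2 j) z d * ?\<rho> l ^ j)"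
          unfolding \<phi>2_def
          by (intro tendsto_sum tendsto_mult tendsto_power lim[OF c\<rho>] filterlim_compose[OF tendsto_eval3 e0])
        moreover have "(\<Sum>j\<le>M. eval3 (\<psi>3 j) d z (inverse (real (Suc (r n)))) * ?\<rho> (v (r n)) ^ j) = 0" for n
        proof -
          have "(\<Sum>j\<le>M. eval3 (\<phi>3 j) d z (inverse (real (Suc (r n)))) * ?\<rho> (v (r n)) ^ j) = 0"
            by (rule \<phi>3(2)[OF v(2) z harm(2)])
          moreover have "(\<Sum>j\<le>M. eval3 (\<phi>3 j) d z (inverse (real (Suc (r n)))) * ?\<rho> (v (r n)) ^ j)
             = inverse (real (Suc (r n))) ^ e3 * (\<Sum>j\<le>M. eval3 (\<psi>3 j) d z (inverse (real (Suc (r n)))) * ?\<rho> (v (r n)) ^ j)"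
            unfolding sum_distrib_left by (intro sum.cong refl) (simp add: pow)
          ultimately have "inverse (real (Suc (r n))) ^ e3 * (\<Sum>j\<le>M. eval3 (\<psi>3 j) d z (inverse (real (Suc (r n)))) * ?\<rho> (v (r n)) ^ j) = 0"
            by (simp only:)
          moreover have "inverse (real (Suc (r n))) ^ e3 \<noteq> 0" by simp
          ultimately show ?thesis by (simp only: mult_eq_0_iff simp_thms)
        qed
        ultimately show ?thesis by (simp add: LIMSEQ_const_iff)
      qed
      ultimately show ?thesis using R[OF lV] by blast
    qed
    then have "\<forall>n. \<exists>T. ?\<rho> y - inverse (real (Suc n)) * \<Sigma> \<le> T \<and> T \<le> R \<and> (\<Sum>j\<le>M. ?eval2 (\<phi>2 j) (inverse (real (Suc n))) d * T ^ j) = 0"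
      by (intro allI step harm(2))
    from choice[OF this] obtain T where T0: "\<forall>n. ?\<rho> y - inverse (real (Suc n)) * \<Sigma> \<le> T n \<and> T n \<le> R \<and>
       (\<Sum>j\<le>M. ?eval2 (\<phi>2 j) (inverse (real (Suc n))) d * T n ^ j) = 0" ..
    then have T: "\<And>n. ?\<rho> y - inverse (real (Suc n)) * \<Sigma> \<le> T n" "\<And>n. T n \<le> R"
       "\<And>n. (\<Sum>j\<le>M. ?eval2 (\<phi>2 j) (inverse (real (Suc n))) d * T n ^ j) = 0"
      by (simp_all only:)
    have \<Sigma>: "\<Sigma> \<ge> 0" unfolding \<Sigma>_def by (intro sum_nonneg) (auto simp: power_mult)
    have "inverse (real (Suc n)) * \<Sigma> \<le> 1 * \<Sigma>" for n
      by (intro mult_right_mono \<Sigma>) (simp add: field_simps)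
    then have "T n \<in> {?\<rho> y - \<Sigma>..R}" for n using T(1,2)[of n] by (smt (verit) atLeastAtMost_iff)
    then obtain l r where l: "strict_mono r" "(T \<circ> r) \<longlonglongrightarrow> l"
      using compact_Icc[of "?\<rho> y - \<Sigma>" R] unfolding compact_eq_seq_compact_metric seq_compact_def by metis
    have e0: "filterlim (\<lambda>n. inverse (real (Suc (r n)))) (at 0) sequentially"
      using filterlim_compose[OF at0 filterlim_subseq[OF l(1)]] .
    have e0': "(\<lambda>n. ?\<rho> y - inverse (real (Suc (r n))) * \<Sigma>) \<longlonglongrightarrow> ?\<rho> y - 0 * \<Sigma>"
      using e0 by (intro tendsto_intros) (simp add: filterlim_at)
    have lT: "(\<lambda>n. T (r n)) \<longlonglongrightarrow> l" using l(2) by (simp add: o_def)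
    have "?\<rho> y - 0 * \<Sigma> \<le> l"
      by (rule LIMSEQ_le[OF e0' lT]) (use T(1) in blast)
    moreover have "(\<Sum>j\<le>M. poly (\<phi>1 j) d * l ^ j) = 0"
    proof -
      have "(\<lambda>n. \<Sum>j\<le>M. ?eval2 (\<psi>2 j) (inverse (real (Suc (r n)))) d * T (r n) ^ j) \<longlonglongrightarrow> (\<Sum>j\<le>M. poly (\<phi>1 j) d * l ^ j)"
        unfolding \<phi>1_def
        by (intro tendsto_sum tendsto_mult tendsto_power lT filterlim_compose[OF tendsto_poly_const e0])
      moreover have "(\<Sum>j\<le>M. ?eval2 (\<psi>2 j) (inverse (real (Suc (r n)))) d * T (r n) ^ j) = 0" for n
      proof -
        have "(\<Sum>j\<le>M. ?eval2 (\<phi>2 j) (inverse (real (Suc (r n)))) d * T (r n) ^ j)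
           = inverse (real (Suc (r n))) ^ e2 * (\<Sum>j\<le>M. ?eval2 (\<psi>2 j) (inverse (real (Suc (r n)))) d * T (r n) ^ j)"
          unfolding sum_distrib_left by (intro sum.cong refl) (simp add: pow2)
        then have "inverse (real (Suc (r n))) ^ e2 * (\<Sum>j\<le>M. ?eval2 (\<psi>2 j) (inverse (real (Suc (r n)))) d * T (r n) ^ j) = 0"
          using T(3)[of "r n"] by (simp only:)
        moreover have "inverse (real (Suc (r n))) ^ e2 \<noteq> 0" by simp
        ultimately show ?thesis by (simp only: mult_eq_0_iff simp_thms)
      qed
      ultimately show ?thesis by (simp add: LIMSEQ_const_iff)
    qed
    ultimately show ?thesis by auto
  qed
  moreover have "\<exists>j\<le>M. \<phi>1 j \<noteq> 0" using \<psi>2(2) by (simp add: \<phi>1_def)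
  ultimately show ?thesis by (intro exI[of _ M] exI[of _ \<phi>1]) blast
qed

text \<open>Let d be the value of f / g at x. Unless d = 0, the level set of d is bounded, and the
  algebraic relation has a root \<open>T\<close> at least as large as the sum of squares at the
  point over x. Then \<open>root_bound\<close> limits \<open>T\<close>, and hence |x|, by a negative
  power of |d|; solved for d this is the claim.\<close>

lemma Lojasiewicz_at_infinity:
  assumes f: "f \<in> polys N" and g: "g \<in> polys N"
    and pos: "\<And>x::nat \<Rightarrow> real. (\<And>n. n \<in> {1..N} \<Longrightarrow> 1 \<le> x n) \<Longrightarrow> peval g x > 0"
    and o: "little_o N f g"
  shows "\<exists>\<epsilon>>0. \<exists>R\<ge>1. \<forall>x::nat \<Rightarrow> real. (\<forall>n\<in>{1..N}. 1 \<le> x n) \<and> R \<le> (\<Sum>n=1..N. x n) \<longrightarrow>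
      \<bar>peval f x\<bar> \<le> peval g x * (\<Sum>n=1..N. x n) powr (- \<epsilon>)"
proof -
  define \<sigma> where "\<sigma> i = Const 1 + Var i * Var i" for i
  define A B where "A = mpoly_subst f \<sigma>" and "B = mpoly_subst g \<sigma>"
  have AB: "A \<in> polys N" "B \<in> polys N"
    unfolding A_def B_def \<sigma>_def by (intro polys_subst[OF f] polys_subst[OF g] polys_add polys_mult polys_Var polys_Const; assumption)+
  have ev: "peval A v = peval f (\<lambda>i. 1 + (v i)\<^sup>2)" "peval B v = peval g (\<lambda>i. 1 + (v i)\<^sup>2)" for v :: "nat \<Rightarrow> real"
    by (simp_all add: A_def B_def \<sigma>_def peval_subst peval_add peval_mult power2_eq_square)
  have Bpos: "peval B v > 0" for v :: "nat \<Rightarrow> real"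
    unfolding ev by (rule pos) simp
  obtain M \<phi> where \<phi>: "\<exists>j\<le>M. \<phi> j \<noteq> 0" "\<And>d y R. peval A y = d * peval B y \<Longrightarrow>
      (\<forall>v. peval A v = d * peval B v \<longrightarrow> (\<Sum>i=1..N. (v i)\<^sup>2) \<le> R) \<Longrightarrow>
      (\<exists>T\<ge>(\<Sum>i=1..N. (y i)\<^sup>2). (\<Sum>j\<le>M. poly (\<phi> j) d * T ^ j) = (0::real))"
    using ex_relation_level_set[OF AB] by blast
  obtain C k0 d0 where C: "C > 0" "d0 > 0" "\<And>d T. 0 < \<bar>d\<bar> \<Longrightarrow> \<bar>d\<bar> < d0 \<Longrightarrow> 1 \<le> T \<Longrightarrow> (\<Sum>j\<le>M. poly (\<phi> j) d * T ^ j) = 0 \<Longrightarrow>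
     T * \<bar>d\<bar> ^ k0 \<le> C"
    using root_bound[OF \<phi>(1)] by blast
  obtain R0 where R0: "\<And>x::nat \<Rightarrow> real. (\<forall>n\<in>{1..N}. 1 \<le> x n) \<Longrightarrow> R0 \<le> (\<Sum>n=1..N. x n) \<Longrightarrow> \<bar>peval f x\<bar> \<le> min (d0/2) 1 * peval g x"
    using o C(2) unfolding little_o_def by (metis half_gt_zero min_less_iff_conj zero_less_one)
  \<comment> \<open>The successor makes \<open>k\<close> positive, so that the exponent
    \<open>1 / (2 * k)\<close> is meaningful.\<close>
  define k where "k = Suc k0"
  \<comment> \<open>Beyond \<open>R0\<close> the quotient is small enough for
    \<open>root_bound\<close>; \<open>2 * N + 2\<close> gives \<open>T \<ge> 1\<close> and
    \<open>X \<le> 2 * T\<close> for the coordinate sum \<open>X\<close>; and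
    \<open>4 * C\<^sup>2\<close> gives \<open>2 * C \<le> sqrt X\<close>, which trades the constant
    for half of the exponent.\<close>
  define R where "R = max (max R0 (2 * real N + 2)) (4 * C\<^sup>2)"
  show ?thesis
  proof (rule exI[of _ "1 / (2 * real k)"], rule conjI[rotated], rule exI[of _ R], rule conjI[rotated], intro allI impI)
    fix x :: "nat \<Rightarrow> real" assume x: "(\<forall>n\<in>{1..N}. 1 \<le> x n) \<and> R \<le> (\<Sum>n=1..N. x n)"
    define X where "X = (\<Sum>n=1..N. x n)"
    have X: "X \<ge> R0" "X \<ge> 2 * real N + 2" "X \<ge> 4 * C\<^sup>2" using x by (auto simp: X_def R_def)
    define d where "d = peval f x / peval g x"
    have gp: "peval g x > 0" using pos x by blast
    have fd: "peval f x = d * peval g x" using gp by (simp add: d_def)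
    have "\<bar>peval f x\<bar> \<le> min (d0/2) 1 * peval g x" using R0 x X unfolding X_def by blast
    then have "\<bar>d\<bar> * peval g x \<le> min (d0/2) 1 * peval g x" using gp by (simp add: fd abs_mult)
    then have dle: "\<bar>d\<bar> \<le> min (d0/2) 1" using gp by simp
    show "\<bar>peval f x\<bar> \<le> peval g x * (\<Sum>n=1..N. x n) powr (- (1 / (2 * real k)))"
    proof (cases "d = 0")
      case True then show ?thesis using gp by (simp add: fd)
    next
      case False
      define y where "y n = sqrt (x n - 1)" for n
      have y: "1 + (y n)\<^sup>2 = x n" if "n \<in> {1..N}" for n using x that by (simp add: y_def)
      have fy: "peval A y = peval f x" "peval B y = peval g x"
        unfolding ev by (rule peval_cong[OF f] peval_cong[OF g], use y in simp)+
      have \<rho>: "(\<Sum>i=1..N. 1 + (v i)\<^sup>2) = real N + (\<Sum>i=1..N. (v i)\<^sup>2)" for v :: "nat \<Rightarrow> real"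
        by (simp add: sum.distrib)
      have \<rho>y: "(\<Sum>i=1..N. (y i)\<^sup>2) = X - real N"
        using \<rho>[of y] y unfolding X_def by (simp add: sum.cong[OF refl y])
      \<comment> \<open>Beyond \<open>R1\<close> the quotient is at most half of |d|, so no point of
        the level set of d lies there.\<close>
      obtain R1 where R1: "\<And>x::nat \<Rightarrow> real. (\<forall>n\<in>{1..N}. 1 \<le> x n) \<Longrightarrow> R1 \<le> (\<Sum>n=1..N. x n) \<Longrightarrow> \<bar>peval f x\<bar> \<le> \<bar>d\<bar>/2 * peval g x"
        using o False unfolding little_o_def by (metis half_gt_zero zero_less_abs_iff)
      have bd: "(\<Sum>i=1..N. (v i)\<^sup>2) \<le> R1" if v: "peval A v = d * peval B v" for v
      proof (rule ccontr)
        assume "\<not> ?thesis"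
        then have "R1 \<le> (\<Sum>i=1..N. 1 + (v i)\<^sup>2)" unfolding \<rho> by simp
        then have "\<bar>peval A v\<bar> \<le> \<bar>d\<bar>/2 * peval B v" unfolding ev using R1[of "\<lambda>i. 1 + (v i)\<^sup>2"] by simp
        then have "\<bar>d\<bar> * peval B v \<le> \<bar>d\<bar>/2 * peval B v" using Bpos[of v] by (simp add: v abs_mult)
        then have "\<bar>d\<bar> \<le> \<bar>d\<bar>/2" using Bpos[of v] by (subst (asm) mult_le_cancel_right_pos) auto
        then show False using False by simp
      qed
      obtain T where T: "T \<ge> X - real N" "(\<Sum>j\<le>M. poly (\<phi> j) d * T ^ j) = 0"
        using \<phi>(2)[of y d R1] bd fy fd \<rho>y by auto
      have T1: "1 \<le> T" "X \<le> 2 * T" using T(1) X(2) by linarith+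
      have "T * \<bar>d\<bar> ^ k0 \<le> C" by (rule C(3)) (use False dle C(2) T1 T(2) in auto)
      moreover have "\<bar>d\<bar> ^ k \<le> \<bar>d\<bar> ^ k0" unfolding k_def using dle by (intro power_decreasing) auto
      then have "T * \<bar>d\<bar> ^ k \<le> T * \<bar>d\<bar> ^ k0" using T1(1) by (intro mult_left_mono) auto
      moreover have "X * \<bar>d\<bar> ^ k \<le> 2 * T * \<bar>d\<bar> ^ k" using T1(2) by (intro mult_right_mono) auto
      ultimately have "X * \<bar>d\<bar> ^ k \<le> 2 * C" by linarith
      also have "\<dots> \<le> sqrt X" using X(3) by (intro real_le_rsqrt) (simp add: power_mult_distrib)
      finally have *: "X * \<bar>d\<bar> ^ k \<le> sqrt X" .
      have Xp: "X > 0" using X(2) by linarith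
      have "sqrt X * (sqrt X * \<bar>d\<bar> ^ k) \<le> sqrt X * 1" using * Xp by (simp add: mult.assoc[symmetric])
      then have "sqrt X * \<bar>d\<bar> ^ k \<le> 1" using Xp by (subst (asm) mult_le_cancel_left_pos) auto
      then have "\<bar>d\<bar> ^ k \<le> X powr (- (1/2))"
        using Xp by (simp add: powr_minus powr_half_sqrt field_simps)
      also have "\<dots> = (X powr (- (1 / (2 * real k)))) ^ k"
      proof -
        have "real k > 0" by (simp add: k_def)
        then have "real k * (- (1 / (2 * real k))) = - (1/2)" by simp
        then show ?thesis using Xp powr_power[of X "- (1 / (2 * real k))" k] by (simp only:)
      qed
      finally have "\<bar>d\<bar> \<le> X powr (- (1 / (2 * real k)))"
        by (rule power_le_imp_le_base[of _ k0, folded k_def]) simp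
      then show ?thesis unfolding fd abs_mult X_def using gp by (simp add: mult.commute)
    qed
  qed (simp_all add: k_def R_def)
qed

section \<open>Holomorphic functions of several variables\<close>

definition holo_at :: "(complex ^ 't::finite \<Rightarrow> complex) \<Rightarrow> complex ^ 't \<Rightarrow> bool" where
  "holo_at F s \<longleftrightarrow> (\<exists>D. (F has_derivative D) (at s) \<and> (\<forall>c v. D (c *s v) = c * D v))"

lemma entire_iff_holo_at: "entire F \<longleftrightarrow> (\<forall>s. holo_at F s)"
  by (simp add: entire_def holo_at_def)

lemma holo_at_const: "holo_at (\<lambda>s. c) s"
  unfolding holo_at_def by (intro exI[of _ "\<lambda>_. 0"]) auto

lemma holo_at_add: "holo_at F s \<Longrightarrow> holo_at G s \<Longrightarrow> holo_at (\<lambda>s. F s + G s) s"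
  unfolding holo_at_def
proof (elim exE conjE)
  fix D E
  assume "(F has_derivative D) (at s)" "\<forall>c v. D (c *s v) = c * D v" "(G has_derivative E) (at s)" "\<forall>c v. E (c *s v) = c * E v"
  then show "\<exists>D. ((\<lambda>s. F s + G s) has_derivative D) (at s) \<and> (\<forall>c v. D (c *s v) = c * D v)"
    by (intro exI[of _ "\<lambda>h. D h + E h"] conjI has_derivative_add) (simp_all add: algebra_simps)
qed

lemma holo_at_mult: "holo_at F s \<Longrightarrow> holo_at G s \<Longrightarrow> holo_at (\<lambda>s. F s * G s) s"
  unfolding holo_at_def
proof (elim exE conjE)
  fix D E
  assume "(F has_derivative D) (at s)" "\<forall>c v. D (c *s v) = c * D v" "(G has_derivative E) (at s)" "\<forall>c v. E (c *s v) = c * E v"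
  then show "\<exists>D. ((\<lambda>s. F s * G s) has_derivative D) (at s) \<and> (\<forall>c v. D (c *s v) = c * D v)"
    by (intro exI[of _ "\<lambda>h. F s * E h + D h * G s"] conjI has_derivative_mult) (simp_all add: algebra_simps)
qed

lemma holo_at_cmult: "holo_at F s \<Longrightarrow> holo_at (\<lambda>s. c * F s) s"
  by (intro holo_at_mult holo_at_const)

lemma holo_at_diff: "holo_at F s \<Longrightarrow> holo_at G s \<Longrightarrow> holo_at (\<lambda>s. F s - G s) s"
  using holo_at_add[of F s "\<lambda>s. - 1 * G s"] holo_at_cmult[of G s "- 1"] by simp

lemma holo_at_sum: "(\<And>i. i \<in> S \<Longrightarrow> holo_at (F i) s) \<Longrightarrow> holo_at (\<lambda>s. \<Sum>i\<in>S. F i s) s"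
  by (induction S rule: infinite_finite_induct) (auto intro: holo_at_const holo_at_add)

lemma holo_at_prod: "(\<And>i. i \<in> S \<Longrightarrow> holo_at (F i) s) \<Longrightarrow> holo_at (\<lambda>s. \<Prod>i\<in>S. F i s) s"
  by (induction S rule: infinite_finite_induct) (auto intro: holo_at_const holo_at_mult)

lemma holo_at_exp_component:
  fixes t :: "'t::finite"
  shows "holo_at (\<lambda>s. exp (c * s $ t)) s"
proof -
  have "((\<lambda>s::complex^'t. s $ t) has_derivative (\<lambda>h. h $ t)) (at s)"
    by (rule bounded_linear_imp_has_derivative[OF bounded_linear_vec_nth])
  then have 1: "((\<lambda>s. c * s $ t) has_derivative (\<lambda>h. c * h $ t)) (at s)"
    by (rule has_derivative_mult_right)
  have 2: "(exp has_derivative (\<lambda>h. h * exp (c * s $ t))) (at (c * s $ t))"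
    using DERIV_exp[of "c * s $ t"] unfolding has_field_derivative_def by (simp add: mult_commute_abs)
  have "((\<lambda>s. exp (c * s $ t)) has_derivative (\<lambda>h. c * h $ t * exp (c * s $ t))) (at s)"
    using has_derivative_compose[OF 1 2] .
  then show ?thesis unfolding holo_at_def
    by (intro exI[of _ "\<lambda>h. c * h $ t * exp (c * s $ t)"]) auto
qed

lemma holo_at_transform:
  assumes "holo_at F s" "open S" "s \<in> S" "\<And>x. x \<in> S \<Longrightarrow> F x = G x"
  shows "holo_at G s"
  using assms has_derivative_transform_within_open[of F _ s UNIV S G] unfolding holo_at_def by blast

section \<open>Complex lines, uniqueness of the continuation and uniform limits\<close>

lemma norm_vector_scalar_mult: "norm (c *s x) = norm c * norm x" for x :: "complex ^ 't::finite"
  by (simp add: norm_vec_def norm_mult L2_set_right_distrib)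

lemma has_derivative_line: "((\<lambda>w. s + w *s v) has_derivative (\<lambda>h. h *s v)) (at w)" for v :: "complex ^ 't::finite"
proof -
  have "linear (\<lambda>w::complex. w *s v)"
    by (rule linearI) (auto simp: vec_eq_iff algebra_simps)
  then have "bounded_linear (\<lambda>w::complex. w *s v)" by (simp add: linear_conv_bounded_linear)
  then have "((\<lambda>w. w *s v) has_derivative (\<lambda>h. h *s v)) (at w)" by (rule bounded_linear_imp_has_derivative)
  from has_derivative_add[OF has_derivative_const this] show ?thesis by simp
qed

lemma holo_line:
  fixes F :: "complex ^ 't::finite \<Rightarrow> complex"
  assumes "(F has_derivative D) (at (s + w *s v))" "\<And>c v. D (c *s v) = c * D v"
  shows "((\<lambda>w. F (s + w *s v)) has_field_derivative D v) (at w)"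
proof -
  have "((\<lambda>w. F (s + w *s v)) has_derivative (\<lambda>h. D (h *s v))) (at w)"
    by (rule has_derivative_compose[of "\<lambda>w. s + w *s v" "\<lambda>h. h *s v" w UNIV F D])
       (rule has_derivative_line assms(1))+
  then show ?thesis unfolding has_field_derivative_def by (simp add: assms(2) mult_commute_abs)
qed

text \<open>Join the given point to a point \<open>a\<close> deep inside the half space by a complex
  line. On the line both functions are entire in one variable and agree near \<open>w = 0\<close>,
  so the identity theorem gives equality at \<open>w = 1\<close>.\<close>

lemma entire_eqI:
  assumes F: "entire F" and G: "entire G"
    and eq: "\<And>s. (\<And>t. Re (s $ t) > \<sigma>) \<Longrightarrow> F s = G s"
  shows "F = (G :: complex ^ 't::finite \<Rightarrow> complex)"
proof
  fix s :: "complex ^ 't"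
  define a :: "complex ^ 't" where "a = (\<chi> t. of_real (\<sigma> + 1))"
  let ?h = "\<lambda>F w. F (a + w *s (s - a))"
  have hol: "?h F holomorphic_on UNIV" if "entire F" for F :: "complex ^ 't \<Rightarrow> complex"
    unfolding holomorphic_on_def field_differentiable_def using that holo_line unfolding entire_def by blast
  define \<delta> where "\<delta> = 1 / (norm (s - a) + 1)"
  have \<delta>: "\<delta> > 0" by (simp add: \<delta>_def add_nonneg_pos)
  have "?h F 1 = ?h G 1"
  proof (rule analytic_continuation_open[where s = "ball 0 \<delta>" and s' = UNIV and f = "?h F" and g = "?h G"])
    fix w :: complex assume "w \<in> ball 0 \<delta>"
    then have "norm w < 1 / (norm (s - a) + 1)" by (simp add: \<delta>_def)
    moreover have "norm (s - a) + 1 > 0" by (simp add: add_nonneg_pos)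
    ultimately have w: "norm w * (norm (s - a) + 1) < 1" by (simp only: pos_less_divide_eq)
    show "?h F w = ?h G w"
    proof (rule eq)
      fix t
      have "norm ((w *s (s - a)) $ t) \<le> norm (w *s (s - a))" by (rule Finite_Cartesian_Product.norm_nth_le)
      also have "\<dots> \<le> norm w * (norm (s - a) + 1)"
        unfolding norm_vector_scalar_mult by (intro mult_left_mono) auto
      finally have "norm ((w *s (s - a)) $ t) < 1" using w by simp
      then have "\<bar>Re ((w *s (s - a)) $ t)\<bar> < 1" using abs_Re_le_cmod[of "(w *s (s - a)) $ t"] by linarith
      then show "Re ((a + w *s (s - a)) $ t) > \<sigma>" unfolding vector_add_component by (simp add: a_def)
    qed
  qed (use \<delta> hol F G in auto)
  then show "F s = G s" by simp
qed

lemma continuation_eqI: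
  assumes "continues_series A f F"
  shows "continuation A f = F"
  unfolding continuation_def
proof (rule the_equality)
  fix G assume "continues_series A f G"
  with assms obtain \<sigma>1 \<sigma>2 where *: "entire F" "entire G"
    "\<And>s. (\<forall>t. Re (s $ t) > \<sigma>1) \<Longrightarrow> (f s has_sum F s) A"
    "\<And>s. (\<forall>t. Re (s $ t) > \<sigma>2) \<Longrightarrow> (f s has_sum G s) A"
    unfolding continues_series_def by blast
  show "G = F"
  proof (rule entire_eqI[OF *(2,1)])
    fix s :: "complex ^ 'b" assume "\<And>t. Re (s $ t) > max \<sigma>1 \<sigma>2"
    then show "G s = F s" using *(3)[of s] *(4)[of s] by (intro has_sum_unique) auto
  qed
qed (rule assms)

text \<open>Cauchy's inequality on discs in complex lines shows that the derivatives are uniformly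
  Cauchy as linear maps; differentiation of limits then applies. Complex linearity passes to the
  limit pointwise.\<close>

lemma holo_at_uniform_limit:
  fixes F :: "nat \<Rightarrow> complex ^ 't::finite \<Rightarrow> complex"
  assumes hol: "\<And>n s. s \<in> ball a \<rho> \<Longrightarrow> holo_at (F n) s"
    and lim: "uniform_limit (ball a \<rho>) F G sequentially"
    and s: "s \<in> ball a \<rho>"
  shows "holo_at G s"
proof -
  define \<delta> where "\<delta> = (\<rho> - dist a s) / 2"
  have \<delta>: "\<delta> > 0" using s by (simp add: \<delta>_def)
  have sub: "ball s (2 * \<delta>) \<subseteq> ball a \<rho>"
  proof
    fix x assume "x \<in> ball s (2 * \<delta>)"
    then have "dist s x < \<rho> - dist a s" by (simp add: \<delta>_def)
    then show "x \<in> ball a \<rho>" using dist_triangle[of a x s] by simp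
  qed
  have xin: "x \<in> ball a \<rho>" if "x \<in> ball s \<delta>" for x
    using subsetD[OF sub, of x] that \<delta> by simp
  have "\<forall>n. \<forall>x. \<exists>D. x \<in> ball a \<rho> \<longrightarrow> (F n has_derivative D) (at x) \<and> (\<forall>c v. D (c *s v) = c * D v)"
    using hol unfolding holo_at_def by blast
  then obtain D where D: "\<And>n x. x \<in> ball a \<rho> \<Longrightarrow> (F n has_derivative D n x) (at x)"
    "\<And>n x c v. x \<in> ball a \<rho> \<Longrightarrow> D n x (c *s v) = c * D n x v" by metis
  have est: "norm (D n x v - D m x v) \<le> 2 * e / \<delta> * norm v"
    if x: "x \<in> ball s \<delta>" and e: "\<And>y. y \<in> ball a \<rho> \<Longrightarrow> norm (F n y - F m y) \<le> e" for n m x v e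
  proof (cases "v = 0")
    case True
    have "D n x 0 = 0" for n
      using D(2)[OF xin[OF x], of n 0 0] by simp
    then show ?thesis using True by simp
  next
    case False
    \<comment> \<open>The disc of radius \<open>r\<close> in direction \<open>v\<close> moves a
      point by at most \<open>\<delta> / 2\<close>, hence stays in the ball. Scaling by the norm of
      \<open>v\<close> makes the estimate homogeneous in \<open>v\<close>.\<close>
    define r where "r = \<delta> / (2 * norm v)"
    have r: "r > 0" using False \<delta> by (simp add: r_def)
    let ?h = "\<lambda>w. F n (x + w *s v) - F m (x + w *s v)"
    have inb: "x + w *s v \<in> ball a \<rho>" if "norm w \<le> r" for w
    proof -
      have "norm (w *s v) \<le> r * norm v" unfolding norm_vector_scalar_mult using that by (intro mult_right_mono) auto
      also have "\<dots> = \<delta> / 2" using False by (simp add: r_def)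
      finally have "dist x (x + w *s v) \<le> \<delta> / 2" by (simp add: dist_norm)
      then have "dist s (x + w *s v) < 2 * \<delta>"
        using dist_triangle[of s "x + w *s v" x] x \<delta> by (simp add: dist_commute)
      then show ?thesis using sub by auto
    qed
    have der: "(?h has_field_derivative (D n (x + w *s v) v - D m (x + w *s v) v)) (at w)" if "norm w \<le> r" for w
      by (intro DERIV_diff holo_line D inb that)
    have "norm ((deriv ^^ 1) ?h 0) \<le> fact 1 * e / r ^ 1"
    proof (rule Cauchy_inequality)
      show "?h holomorphic_on ball 0 r"
        unfolding holomorphic_on_def field_differentiable_def
      proof
        fix w :: complex assume "w \<in> ball 0 r"
        then have "norm w \<le> r" by simp
        from der[OF this] show "\<exists>D. (?h has_field_derivative D) (at w within ball 0 r)"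
          using has_field_derivative_at_within by blast
      qed
      show "continuous_on (cball 0 r) ?h"
      proof (rule continuous_at_imp_continuous_on, rule ballI)
        fix w :: complex assume "w \<in> cball 0 r"
        then have "norm w \<le> r" by simp
        from der[OF this] show "isCont ?h w" by (rule DERIV_isCont)
      qed
      show "norm (?h w) \<le> e" if "norm (0 - w) = r" for w using e[OF inb] that by simp
    qed (use r in auto)
    moreover have "deriv ?h 0 = D n x v - D m x v"
      using der[of 0] r by (intro DERIV_imp_deriv) simp
    ultimately have "norm (D n x v - D m x v) \<le> e / r" by simp
    also have "\<dots> = 2 * e / \<delta> * norm v" using False \<delta> by (simp add: r_def)
    finally show ?thesis .
  qed

  have unif: "\<exists>K. \<forall>n\<ge>K. \<forall>m\<ge>K. \<forall>x\<in>ball s \<delta>. \<forall>v. norm (D n x v - D m x v) \<le> \<epsilon> * norm v" if \<epsilon>: "\<epsilon> > 0" for \<epsilon>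
  proof -
    \<comment> \<open>Two functions within \<open>e\<close> of \<open>G\<close> differ by at most
      \<open>2 * e\<close>, and \<open>est\<close> multiplies this by
      \<open>2 / \<delta>\<close>.\<close>
    define e where "e = \<epsilon> * \<delta> / 4"
    have "e > 0" using \<epsilon> \<delta> by (simp add: e_def)
    then obtain K where K: "\<And>n y. n \<ge> K \<Longrightarrow> y \<in> ball a \<rho> \<Longrightarrow> dist (F n y) (G y) < e"
      using lim unfolding uniform_limit_iff eventually_sequentially by blast
    have "norm (D n x v - D m x v) \<le> \<epsilon> * norm v" if "n \<ge> K" "m \<ge> K" "x \<in> ball s \<delta>" for n m x v
    proof -
      have "norm (F n y - F m y) \<le> 2 * e" if y: "y \<in> ball a \<rho>" for y
        using K[OF \<open>n \<ge> K\<close> y] K[OF \<open>m \<ge> K\<close> y] dist_triangle2[of "F n y" "F m y" "G y"] by (simp add: dist_norm)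
      then have "norm (D n x v - D m x v) \<le> 2 * (2 * e) / \<delta> * norm v" by (intro est that)
      then show ?thesis using \<delta> by (simp add: e_def)
    qed
    then show ?thesis by blast
  qed
  have "Cauchy (\<lambda>n. D n x v)" if x: "x \<in> ball s \<delta>" for x v
  proof (rule metric_CauchyI)
    fix \<epsilon> :: real assume "\<epsilon> > 0"
    define \<epsilon>' where "\<epsilon>' = \<epsilon> / (norm v + 1)"
    have "\<epsilon>' > 0" using \<open>\<epsilon> > 0\<close> by (simp add: \<epsilon>'_def add_nonneg_pos)
    then obtain K where K: "\<forall>n\<ge>K. \<forall>m\<ge>K. \<forall>x\<in>ball s \<delta>. \<forall>v. norm (D n x v - D m x v) \<le> \<epsilon>' * norm v" using unif by blast
    have "norm v + 1 > 0" by (simp add: add_nonneg_pos)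
    then have "\<epsilon>' * (norm v + 1) = \<epsilon>" by (simp add: \<epsilon>'_def)
    then have "\<epsilon>' * norm v < \<epsilon>" using \<open>\<epsilon>' > 0\<close> by (simp add: distrib_left)
    then show "\<exists>M. \<forall>m\<ge>M. \<forall>n\<ge>M. dist (D m x v) (D n x v) < \<epsilon>"
      using K x unfolding dist_norm by (meson le_less_trans)
  qed
  then have conv: "(\<lambda>n. D n x v) \<longlonglongrightarrow> lim (\<lambda>n. D n x v)" if "x \<in> ball s \<delta>" for x v
    using that Cauchy_convergent_iff convergent_LIMSEQ_iff by blast
  define g' where "g' x v = lim (\<lambda>n. D n x v)" for x v
  have sin: "s \<in> ball s \<delta>" using \<delta> by simp
  have "\<exists>g. \<forall>x\<in>ball s \<delta>. (\<lambda>n. F n x) \<longlonglongrightarrow> g x \<and> (g has_derivative g' x) (at x within ball s \<delta>)"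
  proof (rule has_derivative_sequence[OF convex_ball _ _ sin])
    show "(F n has_derivative D n x) (at x within ball s \<delta>)" if "x \<in> ball s \<delta>" for n x
      using D(1)[OF xin[OF that]] by (rule has_derivative_at_withinI)
    show "\<forall>\<^sub>F n in sequentially. \<forall>x\<in>ball s \<delta>. \<forall>h. norm (D n x h - g' x h) \<le> e * norm h" if e: "e > 0" for e
    proof -
      obtain K where K: "\<And>n m x v. n \<ge> K \<Longrightarrow> m \<ge> K \<Longrightarrow> x \<in> ball s \<delta> \<Longrightarrow> norm (D n x v - D m x v) \<le> e * norm v"
        using unif[OF e] by blast
      have "norm (D n x h - g' x h) \<le> e * norm h" if "n \<ge> K" "x \<in> ball s \<delta>" for n x h
      proof (rule Lim_bounded[where M = K])
        show "(\<lambda>m. norm (D n x h - D m x h)) \<longlonglongrightarrow> norm (D n x h - g' x h)"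
          unfolding g'_def by (intro tendsto_intros conv that)
      qed (use K that in auto)
      then show ?thesis unfolding eventually_sequentially by blast
    qed
    show "(\<lambda>n. F n s) \<longlonglongrightarrow> G s"
      using tendsto_uniform_limitI[OF lim s] .
  qed
  then obtain g where g: "\<And>x. x \<in> ball s \<delta> \<Longrightarrow> (\<lambda>n. F n x) \<longlonglongrightarrow> g x"
    "\<And>x. x \<in> ball s \<delta> \<Longrightarrow> (g has_derivative g' x) (at x within ball s \<delta>)" by blast
  have gG: "g x = G x" if "x \<in> ball s \<delta>" for x
    using LIMSEQ_unique[OF g(1)[OF that] tendsto_uniform_limitI[OF lim xin[OF that]]] .
  have "(g has_derivative g' s) (at s)"
    using g(2)[OF sin] at_within_open[OF sin open_ball] by simp
  then have "(G has_derivative g' s) (at s)"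
    by (rule has_derivative_transform_within_open[OF _ open_ball sin]) (rule gG)
  moreover have "g' s (c *s v) = c * g' s v" for c v
  proof (rule LIMSEQ_unique)
    show "(\<lambda>n. D n s (c *s v)) \<longlonglongrightarrow> g' s (c *s v)" unfolding g'_def by (rule conv[OF sin])
    show "(\<lambda>n. D n s (c *s v)) \<longlonglongrightarrow> c * g' s v"
      unfolding D(2)[OF s] g'_def by (intro tendsto_intros conv[OF sin])
  qed
  ultimately show ?thesis unfolding holo_at_def by blast
qed

section \<open>Abel limits of multiple series\<close>

definition wt :: "nat \<Rightarrow> (nat \<Rightarrow> nat) \<Rightarrow> nat" where
  "wt N m = (\<Sum>n=1..N. m n)"

lemma pos_tuplesD: "m \<in> pos_tuples N \<Longrightarrow> n \<in> {1..N} \<Longrightarrow> m n \<ge> 1"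
  by (auto simp: pos_tuples_def PiE_iff)

lemma pos_tuples_ge_1: "m \<in> pos_tuples N \<Longrightarrow> n \<in> {1..N} \<Longrightarrow> 1 \<le> real (m n)"
  using pos_tuplesD[of m N n] by simp

lemma le_wt: "n \<in> {1..N} \<Longrightarrow> m n \<le> wt N m"
  unfolding wt_def by (rule member_le_sum) auto

lemma wt_ge_1: "m \<in> pos_tuples N \<Longrightarrow> N \<ge> 1 \<Longrightarrow> wt N m \<ge> 1"
  using le_wt[of 1 N m] pos_tuplesD[of m N 1] by simp

lemma real_wt: "real (wt N m) = (\<Sum>n=1..N. real (m n))"
  by (simp add: wt_def)

lemma finite_wt_le: "finite {m \<in> pos_tuples N. wt N m \<le> k}"
proof (rule finite_subset)
  show "{m \<in> pos_tuples N. wt N m \<le> k} \<subseteq> {1..N} \<rightarrow>\<^sub>E {..k}"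
  proof
    fix m assume "m \<in> {m \<in> pos_tuples N. wt N m \<le> k}"
    then have m: "m \<in> pos_tuples N" "wt N m \<le> k" by auto
    have "m n \<le> k" if "n \<in> {1..N}" for n using le_wt[OF that, of m] m(2) by simp
    then show "m \<in> {1..N} \<rightarrow>\<^sub>E {..k}" using m(1) by (simp add: pos_tuples_def PiE_iff)
  qed
qed (auto intro: finite_PiE)

text \<open>Unconditional sums are limits along finite subsets. This exhaustion replaces them by a
  sequence, the form required by \<open>holo_at_uniform_limit\<close>.\<close>

lemma filterlim_wt_le:
  "filterlim (\<lambda>k. {m \<in> pos_tuples N. wt N m \<le> k}) (finite_subsets_at_top (pos_tuples N)) sequentially"
  unfolding filterlim_finite_subsets_at_top
proof (intro allI impI)
  fix X assume X: "finite X \<and> X \<subseteq> pos_tuples N"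
  define K where "K = (\<Sum>m\<in>X. wt N m)"
  have "wt N m \<le> K" if "m \<in> X" for m unfolding K_def by (rule member_le_sum) (use X that in auto)
  then have "X \<subseteq> {m \<in> pos_tuples N. wt N m \<le> k}" if "k \<ge> K" for k
    using X that order_trans[OF _ that] by blast
  then show "\<forall>\<^sub>F k in sequentially. finite {m \<in> pos_tuples N. wt N m \<le> k} \<and>
      X \<subseteq> {m \<in> pos_tuples N. wt N m \<le> k} \<and> {m \<in> pos_tuples N. wt N m \<le> k} \<subseteq> pos_tuples N"
    unfolding eventually_sequentially using finite_wt_le by blast
qed

lemma holo_at_infsum:
  fixes f :: "complex ^ 't::finite \<Rightarrow> (nat \<Rightarrow> nat) \<Rightarrow> complex"
  assumes hol: "\<And>m s. m \<in> pos_tuples N \<Longrightarrow> s \<in> ball a \<rho> \<Longrightarrow> holo_at (\<lambda>s. f s m) s"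
    and bound: "\<And>m s. m \<in> pos_tuples N \<Longrightarrow> s \<in> ball a \<rho> \<Longrightarrow> norm (f s m) \<le> M m"
    and M: "M summable_on pos_tuples N"
    and s: "s \<in> ball a \<rho>"
  shows "holo_at (\<lambda>s. \<Sum>\<^sub>\<infinity>m\<in>pos_tuples N. f s m) s"
proof (rule holo_at_uniform_limit[where F = "\<lambda>k s. \<Sum>m\<in>{m \<in> pos_tuples N. wt N m \<le> k}. f s m", OF _ _ s])
  have "uniform_limit (ball a \<rho>) (\<lambda>X s. \<Sum>m\<in>X. f s m) (\<lambda>s. \<Sum>\<^sub>\<infinity>m\<in>pos_tuples N. f s m) (finite_subsets_at_top (pos_tuples N))"
    using Weierstrass_m_test_general[of "pos_tuples N" "ball a \<rho>" "\<lambda>m s. f s m" M] bound M by blast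
  then show "uniform_limit (ball a \<rho>) (\<lambda>k s. \<Sum>m\<in>{m \<in> pos_tuples N. wt N m \<le> k}. f s m)
     (\<lambda>s. \<Sum>\<^sub>\<infinity>m\<in>pos_tuples N. f s m) sequentially"
    by (rule filterlim_compose[OF _ filterlim_wt_le])
qed (auto intro!: holo_at_sum hol)

text \<open>Absolute summability for every \<open>r < 1\<close> is included so that damped sums may
  be added, reindexed and split freely before the limit is taken.\<close>

definition abel :: "'m set \<Rightarrow> ('m \<Rightarrow> nat) \<Rightarrow> ('m \<Rightarrow> complex) \<Rightarrow> complex \<Rightarrow> bool" where
  "abel A w f L \<longleftrightarrow> (\<forall>r::real. 0 < r \<and> r < 1 \<longrightarrow> (\<lambda>m. norm (of_real r ^ w m * f m)) summable_on A) \<and>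
     ((\<lambda>r. \<Sum>\<^sub>\<infinity>m\<in>A. of_real r ^ w m * f m) \<longlongrightarrow> L) (at_left (1::real))"

lemma eventually_at_left_1: "(\<And>r. 0 < r \<Longrightarrow> r < 1 \<Longrightarrow> P r) \<Longrightarrow> eventually P (at_left (1::real))"
  using eventually_at_left_field[of P 1] by (auto intro: exI[of _ 0])

lemma abel_unique: "abel A w f L \<Longrightarrow> abel A w f L' \<Longrightarrow> L = L'"
  unfolding abel_def by (meson tendsto_unique trivial_limit_at_left_real)

lemma abel_summable_on: "abel A w f L \<Longrightarrow> 0 < r \<Longrightarrow> r < 1 \<Longrightarrow> (\<lambda>m. of_real r ^ w m * f m) summable_on A"
  unfolding abel_def by (blast intro: abs_summable_summable)

lemma abel_cmult:
  assumes "abel A w f L" shows "abel A w (\<lambda>m. c * f m) (c * L)"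
proof -
  have eq: "of_real r ^ w m * (c * f m) = c * (of_real r ^ w m * f m)" for r m by simp
  show ?thesis unfolding abel_def eq infsum_cmult_right'
    using assms unfolding abel_def
    by (auto simp: norm_mult[of c] intro!: summable_on_cmult_right tendsto_mult_left)
qed

lemma abel_add:
  assumes f: "abel A w f L" and g: "abel A w g L'"
  shows "abel A w (\<lambda>m. f m + g m) (L + L')"
  unfolding abel_def
proof (intro conjI allI impI)
  fix r :: real assume r: "0 < r \<and> r < 1"
  have "(\<lambda>m. norm (of_real r ^ w m * f m) + norm (of_real r ^ w m * g m)) summable_on A"
    using f g r unfolding abel_def by (intro summable_on_add) auto
  then show "(\<lambda>m. norm (of_real r ^ w m * (f m + g m))) summable_on A"
    by (rule Infinite_Sum.abs_summable_on_comparison_test') (simp add: distrib_left norm_triangle_ineq)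
next
  have "((\<lambda>r. (\<Sum>\<^sub>\<infinity>m\<in>A. of_real r ^ w m * f m) + (\<Sum>\<^sub>\<infinity>m\<in>A. of_real r ^ w m * g m)) \<longlongrightarrow> L + L') (at_left 1)"
    using f g unfolding abel_def by (intro tendsto_add) auto
  then show "((\<lambda>r. \<Sum>\<^sub>\<infinity>m\<in>A. of_real r ^ w m * (f m + g m)) \<longlongrightarrow> L + L') (at_left 1)"
    by (rule Lim_transform_eventually)
       (auto intro!: eventually_at_left_1 infsum_add[symmetric] abel_summable_on[OF f] abel_summable_on[OF g] simp: distrib_left)
qed

lemma abel_0: "abel A w (\<lambda>m. 0) 0"
  unfolding abel_def by simp

lemma abel_sum: "(\<And>i. i \<in> S \<Longrightarrow> abel A w (f i) (L i)) \<Longrightarrow> abel A w (\<lambda>m. \<Sum>i\<in>S. f i m) (\<Sum>i\<in>S. L i)"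
  by (induction S rule: infinite_finite_induct) (auto intro: abel_0 abel_add)

lemma abel_diff: "abel A w f L \<Longrightarrow> abel A w g L' \<Longrightarrow> abel A w (\<lambda>m. f m - g m) (L - L')"
  using abel_add[of A w f L "\<lambda>m. - 1 * g m" "- 1 * L'"] abel_cmult[of A w g L' "- 1"] by simp

text \<open>The terms are dominated on \<open>0 \<le> r \<le> 1\<close> by the undamped ones, so the
  damped sum converges uniformly and is continuous up to \<open>r = 1\<close>.\<close>

lemma abel_of_summable:
  assumes "(\<lambda>m. norm (f m)) summable_on A"
  shows "abel A w f (\<Sum>\<^sub>\<infinity>m\<in>A. f m)"
  unfolding abel_def
proof (intro conjI allI impI)
  have le: "norm (of_real r ^ w m * f m) \<le> norm (f m)" if "0 \<le> r" "r \<le> 1" for r :: real and m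
  proof -
    have "r ^ w m * norm (f m) \<le> 1 * norm (f m)" using that by (intro mult_right_mono power_le_one) auto
    then show ?thesis using that by (simp add: norm_mult norm_power)
  qed
  show "(\<lambda>m. norm (of_real r ^ w m * f m)) summable_on A" if "0 < r \<and> r < 1" for r :: real
    by (rule Infinite_Sum.abs_summable_on_comparison_test'[OF assms]) (use le that in auto)
  let ?g = "\<lambda>r::real. \<Sum>\<^sub>\<infinity>m\<in>A. of_real r ^ w m * f m"
  have "uniform_limit {0..1} (\<lambda>X r. \<Sum>m\<in>X. of_real r ^ w m * f m) ?g (finite_subsets_at_top A)"
    by (rule Weierstrass_m_test_general[OF _ assms]) (use le in auto)
  then have "continuous_on {0..1} ?g"
    by (rule uniform_limit_theorem[rotated]) (auto intro!: always_eventually continuous_intros)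
  then have "(?g \<longlongrightarrow> ?g 1) (at 1 within {0..1})"
    unfolding continuous_on_def by (rule bspec) simp
  then show "(?g \<longlongrightarrow> (\<Sum>\<^sub>\<infinity>m\<in>A. f m)) (at_left 1)" by (simp add: at_within_Icc_at_left)
qed

section \<open>Summability measured by powers of the weight\<close>

lemma inverse_square_summable_on: "(\<lambda>k::nat. 1 / real k ^ 2) summable_on {1..}"
proof -
  have "summable (\<lambda>k::nat. 1 / real k ^ 2)"
    using inverse_power_summable[of 2, where 'a = real] by (simp add: inverse_eq_divide)
  then have "(\<lambda>k::nat. 1 / real k ^ 2) summable_on UNIV"
    by (subst summable_on_UNIV_nonneg_real_iff) auto
  then show ?thesis by (rule summable_on_subset_banach) simp
qed

text \<open>Each entry is at most the weight, so the summand is dominated by a product of inverse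
  squares, one for each variable.\<close>

lemma summable_on_wt_power: "(\<lambda>m. 1 / real (wt N m) ^ (2 * N)) summable_on pos_tuples N"
proof -
  have "(\<lambda>k::nat. norm (1 / real k ^ 2)) summable_on {1..}" using inverse_square_summable_on by simp
  then have *: "Infinite_Set_Sum.abs_summable_on (\<lambda>k::nat. 1 / real k ^ 2) {1..}"
    by (simp only: abs_summable_equivalent)
  have "Infinite_Set_Sum.abs_summable_on (\<lambda>m. \<Prod>n\<in>{1..N}. 1 / real (m n) ^ 2) (PiE {1..N} (\<lambda>_. {1..}))"
    by (rule abs_summable_on_prod_PiE) (use * in auto)
  then have "(\<lambda>m. norm (\<Prod>n\<in>{1..N}. 1 / real (m n) ^ 2)) summable_on pos_tuples N"
    unfolding pos_tuples_def by (simp only: abs_summable_equivalent)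
  then show ?thesis
  proof (rule summable_on_comparison_test)
    fix m assume m: "m \<in> pos_tuples N"
    have "(\<Prod>n\<in>{1..N}. real (m n) ^ 2) \<le> (\<Prod>n\<in>{1..N}. real (wt N m) ^ 2)"
      by (intro prod_mono conjI power_mono) (use le_wt in auto)
    also have "\<dots> = real (wt N m) ^ (2 * N)" by (simp add: power_mult)
    finally have "(\<Prod>n\<in>{1..N}. real (m n) ^ 2) \<le> real (wt N m) ^ (2 * N)" .
    have "1 / real (wt N m) ^ (2 * N) \<le> 1 / (\<Prod>n\<in>{1..N}. real (m n) ^ 2)"
    proof -
      have "(\<Prod>n\<in>{1..N}. real (m n) ^ 2) > 0"
        using pos_tuples_ge_1[OF m] by (intro prod_pos ballI zero_less_power) (fastforce intro: less_le_trans[OF zero_less_one])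
      then show ?thesis using \<open>(\<Prod>n\<in>{1..N}. real (m n) ^ 2) \<le> real (wt N m) ^ (2 * N)\<close>
        by (intro divide_left_mono mult_pos_pos) (simp_all only: less_le_trans zero_le_one)
    qed
    then show "1 / real (wt N m) ^ (2 * N) \<le> norm (\<Prod>n\<in>{1..N}. 1 / real (m n) ^ 2)"
      by (simp add: prod_dividef abs_prod)
  qed simp
qed

text \<open>Distribute the decay over \<open>a\<close> factors: with \<open>q\<close> the
  \<open>a\<close>-th root of \<open>r\<close>, \<open>k * q ^ k\<close> is at most the geometric
  sum of the first \<open>k\<close> powers of \<open>q\<close>.\<close>

lemma power_times_geometric_bounded:
  fixes r :: real
  assumes "0 < r" "r < 1"
  shows "\<exists>C. \<forall>k. r ^ k * real k ^ a \<le> C"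
proof (cases "a = 0")
  case True
  then show ?thesis using assms by (intro exI[of _ 1]) (simp add: power_le_one)
next
  case False
  define q where "q = root a r"
  have q: "0 < q" "q < 1" "q ^ a = r" using assms False by (auto simp: q_def)
  have "real k * q ^ k \<le> 1 / (1 - q)" for k
  proof -
    have "(\<Sum>i<k. q ^ k) \<le> (\<Sum>i<k. q ^ i)" by (intro sum_mono power_decreasing) (use q in auto)
    also have "\<dots> = (1 - q ^ k) / (1 - q)" using q by (simp add: sum_gp_strict)
    also have "\<dots> \<le> 1 / (1 - q)" using q by (intro divide_right_mono) auto
    finally show ?thesis by simp
  qed
  then have "(real k * q ^ k) ^ a \<le> (1 / (1 - q)) ^ a" for k using q by (intro power_mono) auto
  moreover have "(real k * q ^ k) ^ a = r ^ k * real k ^ a" for k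
    by (simp add: power_mult_distrib q(3)[symmetric] power_mult[symmetric] mult.commute)
  ultimately show ?thesis by auto
qed

lemma summable_on_damped:
  assumes f: "\<And>m. m \<in> pos_tuples N \<Longrightarrow> norm (f m) \<le> C * real (wt N m) ^ a" and r: "0 < r" "r < 1"
  shows "(\<lambda>m. norm (of_real r ^ wt N m * f m :: complex)) summable_on pos_tuples N"
proof -
  \<comment> \<open>The geometric factor absorbs the growth exponent \<open>a\<close> and in
    addition the \<open>2 * N\<close> powers that make the series summable.\<close>
  obtain B where B: "\<And>k. r ^ k * real k ^ (a + 2 * N) \<le> B" using power_times_geometric_bounded[OF r] by blast
  have "(\<lambda>m. \<bar>C\<bar> * B * (1 / real (wt N m) ^ (2 * N))) summable_on pos_tuples N"
    by (intro summable_on_cmult_right summable_on_wt_power)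
  then show ?thesis
  proof (rule Infinite_Sum.abs_summable_on_comparison_test')
    fix m assume m: "m \<in> pos_tuples N"
    have p: "real (wt N m) ^ (2 * N) > 0"
      using wt_ge_1[OF m] by (cases "N = 0") auto
    have "norm (of_real r ^ wt N m * f m) \<le> r ^ wt N m * (\<bar>C\<bar> * real (wt N m) ^ a)"
    proof -
      have "C * real (wt N m) ^ a \<le> \<bar>C\<bar> * real (wt N m) ^ a" by (intro mult_right_mono) auto
      then show ?thesis unfolding norm_mult norm_power using f[OF m] r by (intro mult_mono) auto
    qed
    also have "\<dots> = \<bar>C\<bar> * (r ^ wt N m * real (wt N m) ^ (a + 2 * N)) * (1 / real (wt N m) ^ (2 * N))"
    proof -
      have "x = y * (x / y)" if "y > 0" for x y :: real using that by simp
      from this[OF p, of 1] show ?thesis unfolding power_add by (simp only: mult.assoc mult.left_commute mult_1_right)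
    qed
    also have "\<dots> \<le> \<bar>C\<bar> * B * (1 / real (wt N m) ^ (2 * N))"
      using B p by (intro mult_right_mono mult_left_mono) auto
    finally show "norm (of_real r ^ wt N m * f m) \<le> \<bar>C\<bar> * B * (1 / real (wt N m) ^ (2 * N))" .
  qed
qed

section \<open>Growth and differences of the summands\<close>

lemma peval_growth:
  assumes p: "p \<in> polys N"
  shows "\<exists>C\<ge>0. \<exists>a. \<forall>(x::nat \<Rightarrow> 'a::real_normed_field) X. X \<ge> 1 \<and> (\<forall>i\<in>{1..N}. norm (x i) \<le> X) \<longrightarrow>
     norm (peval p x) \<le> C * X ^ a"
proof -
  define a where "a = (\<Sum>\<beta>\<in>Poly_Mapping.keys p. tdeg N \<beta>)"
  define C where "C = (\<Sum>\<beta>\<in>Poly_Mapping.keys p. \<bar>Poly_Mapping.lookup p \<beta>\<bar>)"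
  have "norm (peval p x) \<le> C * X ^ a" if X: "X \<ge> 1" "\<forall>i\<in>{1..N}. norm (x i) \<le> X" for x :: "nat \<Rightarrow> 'a" and X
  proof -
    have mono: "norm (mono_eval \<beta> x) \<le> X ^ a" if \<beta>: "\<beta> \<in> Poly_Mapping.keys p" for \<beta>
    proof -
      have "Poly_Mapping.keys \<beta> \<subseteq> {1..N}" using p \<beta> unfolding polys_def by blast
      then have "norm (mono_eval \<beta> x) = (\<Prod>i\<in>{1..N}. norm (x i) ^ Poly_Mapping.lookup \<beta> i)"
        by (subst mono_eval_superset[of "{1..N}"]) (simp_all add: prod_norm[symmetric] norm_power)
      also have "\<dots> \<le> (\<Prod>i\<in>{1..N}. X ^ Poly_Mapping.lookup \<beta> i)"
        by (intro prod_mono conjI power_mono) (use X in auto)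
      also have "\<dots> = X ^ tdeg N \<beta>" by (simp add: tdeg_def power_sum)
      also have "\<dots> \<le> X ^ a" unfolding a_def
        by (intro power_increasing member_le_sum) (use \<beta> X in auto)
      finally show ?thesis .
    qed
    have "norm (peval p x) \<le> (\<Sum>\<beta>\<in>Poly_Mapping.keys p. norm (of_real (Poly_Mapping.lookup p \<beta>) * mono_eval \<beta> x))"
      unfolding peval_def by (rule norm_sum)
    also have "\<dots> \<le> (\<Sum>\<beta>\<in>Poly_Mapping.keys p. \<bar>Poly_Mapping.lookup p \<beta>\<bar> * X ^ a)"
      by (intro sum_mono) (auto simp: norm_mult intro!: mult_left_mono mono)
    finally show ?thesis by (simp add: C_def sum_distrib_right)
  qed
  moreover have "C \<ge> 0" unfolding C_def by (intro sum_nonneg) auto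
  ultimately show ?thesis by blast
qed

text \<open>A nonconstant p tends to infinity, so it is at least 1 outside finitely many tuples, on
  which it is positive. The bound is needed for powers with negative exponents.\<close>

lemma hypoelliptic_lower_bound:
  assumes "hypoelliptic N p"
  shows "\<exists>c>0. \<forall>m\<in>pos_tuples N. c \<le> peval p (\<lambda>i. real (m i))"
proof -
  have pos: "peval p (\<lambda>i. real (m i)) > 0" if "m \<in> pos_tuples N" for m
    by (intro hypoelliptic_pos[OF assms] pos_tuples_ge_1[OF that])
  show ?thesis
  proof (cases "\<exists>c. p = Const c")
    case True
    then obtain c where c: "p = Const c" by blast
    have "c > 0" using hypoelliptic_pos[OF assms, of "\<lambda>_. 1"] by (simp add: c)
    then show ?thesis by (auto simp: c)
  next
    case False
    then have "little_o N 1 p" using hypoelliptic_little_o_1[OF assms] by blast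
    then obtain R where R: "\<And>x::nat \<Rightarrow> real. (\<forall>n\<in>{1..N}. 1 \<le> x n) \<Longrightarrow> R \<le> (\<Sum>n=1..N. x n) \<Longrightarrow> \<bar>peval 1 x\<bar> \<le> 1 * peval p x"
      unfolding little_o_def by (metis zero_less_one)
    define S where "S = insert 1 ((\<lambda>m. peval p (\<lambda>i. real (m i))) ` {m \<in> pos_tuples N. wt N m \<le> nat \<lceil>R\<rceil>})"
    have S: "finite S" "S \<noteq> {}" using finite_wt_le by (auto simp: S_def)
    have "Min S > 0" using S pos by (subst Min_gr_iff) (auto simp: S_def)
    moreover have "Min S \<le> peval p (\<lambda>i. real (m i))" if m: "m \<in> pos_tuples N" for m
    proof (cases "wt N m \<le> nat \<lceil>R\<rceil>")
      case True
      then show ?thesis using m by (intro Min_le S) (auto simp: S_def)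
    next
      case False
      then have "R \<le> real (wt N m)" by linarith
      then have "1 \<le> peval p (\<lambda>i. real (m i))"
        using R[of "\<lambda>i. real (m i)"] pos_tuples_ge_1[OF m] by (simp add: real_wt)
      moreover have "Min S \<le> 1" by (intro Min_le S) (simp add: S_def)
      ultimately show ?thesis by linarith
    qed
    ultimately show ?thesis by blast
  qed
qed

definition summand :: "mpoly \<Rightarrow> ('t::finite \<Rightarrow> mpoly) \<Rightarrow> complex ^ 't \<Rightarrow> (nat \<Rightarrow> nat) \<Rightarrow> complex" where
  "summand Q P s m = of_real (peval Q (\<lambda>n. real (m n))) *
     (\<Prod>t\<in>UNIV. of_real (peval (P t) (\<lambda>n. real (m n))) powr (- (s $ t)))"

lemma zeta_term_eq: "zeta_term N Q P \<mu> s m = mu_power N \<mu> m * summand Q P s m"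
  by (simp add: zeta_term_def summand_def mpoly_eval_eq_peval)

lemma norm_mu_power: "(\<forall>n\<in>{1..N}. norm (\<mu> n) = 1) \<Longrightarrow> norm (mu_power N \<mu> m) = 1"
  unfolding mu_power_def prod_norm[symmetric] norm_power by (intro prod.neutral) simp

lemma norm_of_real_powr: "p > 0 \<Longrightarrow> norm (of_real p powr w :: complex) = p powr Re w"
  by (simp add: norm_powr_real_powr)

text \<open>The base \<open>p + 1 / p\<close> dominates both \<open>p\<close> and its inverse, so
  one bound serves exponents of either sign and is uniform for s in a ball.\<close>

lemma powr_le_power:
  fixes p :: real
  assumes "p > 0" "\<bar>u\<bar> \<le> real k"
  shows "p powr u \<le> (p + 1 / p) ^ k"
proof -
  have "p powr u = exp (u * ln p)" using assms by (simp add: powr_def)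
  also have "\<dots> \<le> exp (real k * ln (p + 1 / p))"
  proof -
    have "\<bar>ln p\<bar> \<le> ln (p + 1 / p)"
    proof (cases "p \<ge> 1")
      case True
      then show ?thesis using assms(1) by (simp add: add_nonneg_pos)
    next
      case False
      then have "\<bar>ln p\<bar> = ln (1 / p)" using assms(1) by (simp add: ln_div)
      also have "\<dots> \<le> ln (p + 1 / p)" using assms(1) by (subst ln_le_cancel_iff) (auto intro: add_pos_pos)
      finally show ?thesis .
    qed
    then have "\<bar>u\<bar> * \<bar>ln p\<bar> \<le> real k * ln (p + 1 / p)" using assms(2) by (intro mult_mono) auto
    then show ?thesis by (simp add: abs_mult[symmetric])
  qed
  also have "\<dots> = (p + 1 / p) ^ k"
    using assms(1) by (simp add: exp_of_nat_mult add_pos_pos)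
  finally show ?thesis .
qed

lemma factor_growth:
  assumes p: "hypoelliptic N p" and N: "N \<ge> 1"
  shows "\<exists>C\<ge>0. \<exists>a. \<forall>u. \<forall>m\<in>pos_tuples N. \<bar>u\<bar> \<le> real k \<longrightarrow>
     peval p (\<lambda>i. real (m i)) powr u \<le> C * real (wt N m) ^ a"
proof -
  obtain c where c: "c > 0" "\<And>m. m \<in> pos_tuples N \<Longrightarrow> c \<le> peval p (\<lambda>i. real (m i))"
    using hypoelliptic_lower_bound[OF p] by blast
  obtain C a where C: "C \<ge> 0" "\<And>(x::nat \<Rightarrow> real) X. X \<ge> 1 \<Longrightarrow> (\<forall>i\<in>{1..N}. norm (x i) \<le> X) \<Longrightarrow> norm (peval p x) \<le> C * X ^ a"
  proof -
    have "p \<in> polys N" using p by (simp add: hypoelliptic_iff)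
    from peval_growth[OF this, where 'a = real] show ?thesis using that by blast
  qed
  have "peval p (\<lambda>i. real (m i)) powr u \<le> (C + 1 / c) ^ k * real (wt N m) ^ (a * k)"
    if m: "m \<in> pos_tuples N" and u: "\<bar>u\<bar> \<le> real k" for m u
  proof -
    let ?p = "peval p (\<lambda>i. real (m i))" and ?X = "real (wt N m)"
    have X: "?X \<ge> 1" using wt_ge_1[OF m N] by simp
    have p0: "?p > 0" using c(2)[OF m] c(1) by linarith
    have "?p \<le> C * ?X ^ a"
      using C(2)[OF X, of "\<lambda>i. real (m i)"] le_wt[of _ N m] p0 by simp
    moreover have "1 / ?p \<le> 1 / c" using c(1) c(2)[OF m] by (intro divide_left_mono) auto
    moreover have "1 / c * 1 \<le> 1 / c * ?X ^ a" using X c(1) by (intro mult_left_mono) auto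
    ultimately have "?p + 1 / ?p \<le> (C + 1 / c) * ?X ^ a" by (simp add: distrib_right)
    then have "(?p + 1 / ?p) ^ k \<le> ((C + 1 / c) * ?X ^ a) ^ k" using p0 by (intro power_mono) auto
    then show ?thesis using powr_le_power[OF p0 u] by (simp add: power_mult_distrib power_mult)
  qed
  moreover have "(C + 1 / c) ^ k \<ge> 0" using C(1) c(1) by simp
  ultimately show ?thesis by blast
qed

lemma prod_growth:
  fixes P :: "'t::finite \<Rightarrow> mpoly"
  assumes P: "\<And>t. hypoelliptic N (P t)" and N: "N \<ge> 1"
  shows "\<exists>C\<ge>0. \<exists>a. \<forall>(s::complex^'t). \<forall>m\<in>pos_tuples N. s \<in> ball 0 \<rho> \<longrightarrow>
     (\<Prod>t\<in>UNIV. peval (P t) (\<lambda>i. real (m i)) powr (- Re (s $ t))) \<le> C * real (wt N m) ^ a"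
proof -
  define k where "k = nat \<lceil>\<rho>\<rceil>"
  have "\<forall>t. \<exists>C\<ge>0. \<exists>a. \<forall>u. \<forall>m\<in>pos_tuples N. \<bar>u\<bar> \<le> real k \<longrightarrow> peval (P t) (\<lambda>i. real (m i)) powr u \<le> C * real (wt N m) ^ a"
    using factor_growth[OF P N] by blast
  then obtain C a where C: "\<And>t. C t \<ge> 0"
    "\<And>t u m. m \<in> pos_tuples N \<Longrightarrow> \<bar>u\<bar> \<le> real k \<Longrightarrow> peval (P t) (\<lambda>i. real (m i)) powr u \<le> C t * real (wt N m) ^ a t"
    by metis
  have "(\<Prod>t\<in>UNIV. peval (P t) (\<lambda>i. real (m i)) powr (- Re (s $ t))) \<le> (\<Prod>t\<in>UNIV. C t) * real (wt N m) ^ (\<Sum>t\<in>UNIV. a t)"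
    if m: "m \<in> pos_tuples N" and s: "s \<in> ball 0 \<rho>" for s :: "complex^'t" and m
  proof -
    have "\<bar>- Re (s $ t)\<bar> \<le> real k" for t
    proof -
      have "\<bar>- Re (s $ t)\<bar> \<le> norm (s $ t)" using abs_Re_le_cmod by simp
      also have "\<dots> \<le> norm s" by (rule Finite_Cartesian_Product.norm_nth_le)
      also have "\<dots> \<le> real k" using s unfolding k_def by (simp add: less_imp_le) linarith
      finally show ?thesis .
    qed
    then have "(\<Prod>t\<in>UNIV. peval (P t) (\<lambda>i. real (m i)) powr (- Re (s $ t))) \<le> (\<Prod>t\<in>UNIV. C t * real (wt N m) ^ a t)"
      by (intro prod_mono conjI C(2)[OF m]) auto
    then show ?thesis by (simp add: prod.distrib power_sum)
  qed
  moreover have "(\<Prod>t\<in>UNIV. C t) \<ge> 0" by (intro prod_nonneg) (use C in auto)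
  ultimately show ?thesis by blast
qed

lemma norm_summand:
  fixes P :: "'t::finite \<Rightarrow> mpoly"
  assumes "\<And>t. hypoelliptic N (P t)" "m \<in> pos_tuples N"
  shows "norm (summand Q P s m) = \<bar>peval Q (\<lambda>i. real (m i))\<bar> * (\<Prod>t\<in>UNIV. peval (P t) (\<lambda>i. real (m i)) powr (- Re (s $ t)))"
proof -
  have "peval (P t) (\<lambda>i. real (m i)) > 0" for t
    by (intro hypoelliptic_pos[OF assms(1)] pos_tuples_ge_1[OF assms(2)])
  then show ?thesis unfolding summand_def by (simp add: norm_mult prod_norm[symmetric] norm_of_real_powr)
qed

lemma peval_tuple_growth:
  assumes Q: "Q \<in> polys N" and N: "N \<ge> 1"
  shows "\<exists>C\<ge>0. \<exists>a. \<forall>m\<in>pos_tuples N. \<bar>peval Q (\<lambda>i. real (m i))\<bar> \<le> C * real (wt N m) ^ a"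
proof -
  obtain C a where C: "C \<ge> 0" "\<And>(x::nat \<Rightarrow> real) X. X \<ge> 1 \<Longrightarrow> (\<forall>i\<in>{1..N}. norm (x i) \<le> X) \<Longrightarrow> norm (peval Q x) \<le> C * X ^ a"
    using peval_growth[OF Q, where 'a = real] by blast
  have "\<bar>peval Q (\<lambda>i. real (m i))\<bar> \<le> C * real (wt N m) ^ a" if m: "m \<in> pos_tuples N" for m
    using C(2)[of "real (wt N m)" "\<lambda>i. real (m i)"] wt_ge_1[OF m N] le_wt[of _ N m] by simp
  then show ?thesis using C(1) by blast
qed

lemma summand_growth:
  fixes P :: "'t::finite \<Rightarrow> mpoly"
  assumes Q: "Q \<in> polys N" and P: "\<And>t. hypoelliptic N (P t)" and N: "N \<ge> 1"
  shows "\<exists>C\<ge>0. \<exists>a. \<forall>s\<in>ball 0 \<rho>. \<forall>m\<in>pos_tuples N. norm (summand Q P s m) \<le> C * real (wt N m) ^ a"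
proof -
  obtain C a where C0: "C \<ge> 0" and C1: "\<forall>(s::complex^'t). \<forall>m\<in>pos_tuples N. s \<in> ball 0 \<rho> \<longrightarrow>
     (\<Prod>t\<in>UNIV. peval (P t) (\<lambda>i. real (m i)) powr (- Re (s $ t))) \<le> C * real (wt N m) ^ a"
    using prod_growth[of N P \<rho>, OF P N] by (elim exE conjE)
  note C = C0 C1[rule_format]
  obtain C' a' where C': "C' \<ge> 0" "\<And>m. m \<in> pos_tuples N \<Longrightarrow> \<bar>peval Q (\<lambda>i. real (m i))\<bar> \<le> C' * real (wt N m) ^ a'"
    using peval_tuple_growth[OF Q N] by blast
  have "norm (summand Q P s m) \<le> C' * C * real (wt N m) ^ (a' + a)" if m: "m \<in> pos_tuples N" and s: "s \<in> ball 0 \<rho>" for s m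
  proof -
    have "norm (summand Q P s m) \<le> (C' * real (wt N m) ^ a') * (C * real (wt N m) ^ a)"
      unfolding norm_summand[OF P m] using C(1) C'(1) by (intro mult_mono C(2) C'(2) m s prod_nonneg) auto
    then show ?thesis by (simp add: power_add mult_ac)
  qed
  then show ?thesis using C(1) C'(1)
    by (intro exI[of _ "C' * C"] conjI exI[of _ "a' + a"] ballI) auto
qed

section \<open>Differences in one variable and Cauchy's estimate\<close>

definition incr :: "nat \<Rightarrow> (nat \<Rightarrow> nat) \<Rightarrow> nat \<Rightarrow> nat" where
  "incr n m = m(n := Suc (m n))"

definition Delta :: "nat \<Rightarrow> ((nat \<Rightarrow> nat) \<Rightarrow> complex) \<Rightarrow> (nat \<Rightarrow> nat) \<Rightarrow> complex" where
  "Delta n f m = f (incr n m) - f m"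

lemma wt_incr: "n \<in> {1..N} \<Longrightarrow> wt N (incr n m) = Suc (wt N m)"
  unfolding wt_def incr_def by (subst (1 2) sum.remove[of _ n]) (auto intro!: sum.cong)

lemma incr_pos_tuples: "n \<in> {1..N} \<Longrightarrow> m \<in> pos_tuples N \<Longrightarrow> incr n m \<in> pos_tuples N"
  by (auto simp: pos_tuples_def incr_def PiE_iff extensional_def)

lemma Delta_growth:
  assumes n: "n \<in> {1..N}" and f: "\<And>m. m \<in> pos_tuples N \<Longrightarrow> norm (f m) \<le> C * real (wt N m) ^ a" and C: "C \<ge> 0"
    and m: "m \<in> pos_tuples N"
  shows "norm (Delta n f m) \<le> C * (1 + 2 ^ a) * real (wt N m) ^ a"
proof -
  have X: "wt N m \<ge> 1" using wt_ge_1[OF m] n by auto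
  have "norm (Delta n f m) \<le> norm (f (incr n m)) + norm (f m)" unfolding Delta_def by (rule norm_triangle_ineq4)
  also have "\<dots> \<le> C * real (wt N (incr n m)) ^ a + C * real (wt N m) ^ a"
    by (intro add_mono f incr_pos_tuples n m)
  also have "C * real (wt N (incr n m)) ^ a \<le> C * (2 * real (wt N m)) ^ a"
    unfolding wt_incr[OF n] using X C by (intro mult_left_mono power_mono) auto
  finally show ?thesis by (simp add: power_mult_distrib algebra_simps)
qed

lemma Delta_iter_growth:
  assumes n: "n \<in> {1..N}" and f: "\<And>m. m \<in> pos_tuples N \<Longrightarrow> norm (f m) \<le> C * real (wt N m) ^ a" and C: "C \<ge> 0"
    and m: "m \<in> pos_tuples N"
  shows "norm ((Delta n ^^ K) f m) \<le> C * (1 + 2 ^ a) ^ K * real (wt N m) ^ a"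
  using m
proof (induction K arbitrary: m)
  case 0 then show ?case using f by simp
next
  case (Suc K)
  have "norm (Delta n ((Delta n ^^ K) f) m) \<le> C * (1 + 2 ^ a) ^ K * (1 + 2 ^ a) * real (wt N m) ^ a"
    by (rule Delta_growth[OF n Suc.IH]) (use C Suc.prems in auto)
  then show ?case by (simp add: mult_ac)
qed

text \<open>Cauchy's inequality on discs of radius \<open>h\<close> bounds the derivative by
  \<open>B / h\<close>, and the mean value inequality on the segment from z to z + 1 bounds the
  difference. The loss of radius is \<open>h\<close> for the first step and 1 for the
  second.\<close>

lemma difference_bound:
  assumes hol: "g holomorphic_on ball 0 r" and B: "\<And>z. z \<in> ball 0 r \<Longrightarrow> norm (g z) \<le> B" and h: "h > 0"
    and z: "z \<in> ball 0 (r - h - 1)"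
  shows "norm (g (z + 1) - g z) \<le> B / h"
proof -
  have der: "norm (deriv g w) \<le> B / h" "(g has_field_derivative deriv g w) (at w)" if w: "norm w < r - h" for w
  proof -
    have sub: "cball w h \<subseteq> ball 0 r"
    proof
      fix y assume "y \<in> cball w h"
      then show "y \<in> ball 0 r" using w dist_triangle[of 0 y w] by simp
    qed
    have "norm ((deriv ^^ 1) g w) \<le> fact 1 * B / h ^ 1"
    proof (rule Cauchy_inequality)
      show "g holomorphic_on ball w h" by (rule holomorphic_on_subset[OF hol]) (use sub ball_subset_cball in blast)
      show "continuous_on (cball w h) g" by (rule continuous_on_subset[OF holomorphic_on_imp_continuous_on[OF hol] sub])
      show "norm (g x) \<le> B" if "norm (w - x) = h" for x
        by (rule B) (use sub that in \<open>auto simp: dist_norm subset_iff\<close>)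
    qed (rule h)
    then show "norm (deriv g w) \<le> B / h" by simp
    show "(g has_field_derivative deriv g w) (at w)"
      by (rule holomorphic_derivI[OF hol open_ball]) (use w h in simp)
  qed
  have "norm (g (z + 1) - g z) \<le> B / h * norm (z + 1 - z)"
  proof (rule field_differentiable_bound[OF convex_ball[of 0 "r - h"]])
    show "(g has_field_derivative deriv g w) (at w within ball 0 (r - h))" if "w \<in> ball 0 (r - h)" for w
      using der(2)[of w] that has_field_derivative_at_within by auto
    show "norm (deriv g w) \<le> B / h" if "w \<in> ball 0 (r - h)" for w using der(1)[of w] that by simp
    show "z \<in> ball 0 (r - h)" using z by simp
    show "z + 1 \<in> ball 0 (r - h)" using z norm_triangle_ineq[of z 1] by simp
  qed
  then show ?thesis by simp
qed

definition fdiff :: "(complex \<Rightarrow> complex) \<Rightarrow> complex \<Rightarrow> complex" where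
  "fdiff g z = g (z + 1) - g z"

text \<open>Every difference gains a factor \<open>1 / h\<close> and costs \<open>h + 1\<close> of
  the radius.\<close>

lemma fdiff_iter_bound:
  assumes hol: "g holomorphic_on ball 0 r" and B: "\<And>z. z \<in> ball 0 r \<Longrightarrow> norm (g z) \<le> B" and h: "h > 0"
  shows "(fdiff ^^ K) g holomorphic_on ball 0 (r - real K * (h + 1)) \<and>
    (\<forall>z\<in>ball 0 (r - real K * (h + 1)). norm ((fdiff ^^ K) g z) \<le> B / h ^ K)"
proof (induction K)
  case 0
  then show ?case using hol B by simp
next
  case (Suc K)
  define r' where "r' = r - real K * (h + 1)"
  have r': "r - real (Suc K) * (h + 1) = r' - h - 1" by (simp add: r'_def algebra_simps)
  let ?g = "(fdiff ^^ K) g"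
  have IH: "?g holomorphic_on ball 0 r'" "\<And>z. z \<in> ball 0 r' \<Longrightarrow> norm (?g z) \<le> B / h ^ K"
    using Suc.IH unfolding r'_def by auto
  have sub: "(\<lambda>z. z + 1) ` ball 0 (r' - h - 1) \<subseteq> ball (0::complex) r'"
  proof (rule image_subsetI)
    fix z :: complex assume "z \<in> ball 0 (r' - h - 1)"
    then show "z + 1 \<in> ball 0 r'" using norm_triangle_ineq[of z 1] h by simp
  qed
  have "(\<lambda>z. z + 1) holomorphic_on ball (0::complex) (r' - h - 1)" by (intro holomorphic_intros)
  from holomorphic_on_compose_gen[OF this IH(1) sub]
  have "(\<lambda>z. ?g (z + 1)) holomorphic_on ball 0 (r' - h - 1)" by (simp add: o_def)
  moreover have "?g holomorphic_on ball 0 (r' - h - 1)"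
    by (rule holomorphic_on_subset[OF IH(1)]) (use h in auto)
  ultimately have "(fdiff ^^ Suc K) g holomorphic_on ball 0 (r' - h - 1)"
    by (simp add: fdiff_def[abs_def] holomorphic_on_diff)
  moreover have "norm ((fdiff ^^ Suc K) g z) \<le> B / h ^ Suc K" if "z \<in> ball 0 (r' - h - 1)" for z
    using difference_bound[OF IH h that] by (simp add: fdiff_def mult.commute)
  ultimately show ?case unfolding r' by blast
qed

text \<open>A \<open>K\<close>-fold difference at \<open>j\<close> involves only the values at
  \<open>j\<close> to \<open>j + K\<close>, so it is enough that \<open>g\<close> interpolates
  \<open>f\<close> at the integers up to \<open>L\<close>.\<close>

lemma Delta_iter_eq_fdiff_iter:
  assumes "\<And>j. j \<le> L \<Longrightarrow> f (m(n := m n + j)) = g (of_nat j)" "j + K \<le> L"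
  shows "(Delta n ^^ K) f (m(n := m n + j)) = (fdiff ^^ K) g (of_nat j)"
  using assms(2)
proof (induction K arbitrary: j)
  case 0
  then have "j \<le> L" by simp
  from assms(1)[OF this] show ?case by (simp only: funpow_0)
next
  case (Suc K)
  have incr: "incr n (m(n := m n + j)) = m(n := m n + Suc j)" by (simp add: incr_def)
  have "(Delta n ^^ Suc K) f (m(n := m n + j)) = (Delta n ^^ K) f (m(n := m n + Suc j)) - (Delta n ^^ K) f (m(n := m n + j))"
    unfolding funpow.simps o_apply Delta_def[of n "(Delta n ^^ K) f"] incr ..
  also have "\<dots> = (fdiff ^^ K) g (of_nat (Suc j)) - (fdiff ^^ K) g (of_nat j)"
  proof -
    have "j + K \<le> L" "Suc j + K \<le> L" using Suc.prems by auto
    then show ?thesis by (simp only: Suc.IH)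
  qed
  also have "\<dots> = (fdiff ^^ Suc K) g (of_nat j)"
    unfolding funpow.simps o_apply fdiff_def[of "(fdiff ^^ K) g"] by (simp only: of_nat_Suc add.commute)
  finally show ?case .
qed

section \<open>Holomorphic extension of the summand in one variable\<close>

lemma mixed_deriv_single:
  assumes "n \<in> {1..N}"
  shows "mixed_deriv N (Poly_Mapping.single n b) p = (partial_deriv n ^^ b) p"
proof -
  have "filter (\<lambda>i. i \<in> {n}) [1..<Suc N] = [n]"
    using sorted_list_of_set_eq_filter[of "{n}" N] assms by simp
  then have "mixed_deriv N (Poly_Mapping.single n b) p =
      fold (\<lambda>i. partial_deriv i ^^ Poly_Mapping.lookup (Poly_Mapping.single n b) i) [n] p"
    unfolding mixed_deriv_def
    by (subst fold_filter_id[of _ "\<lambda>i. i \<in> {n}", symmetric]) (auto simp: lookup_single)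
  then show ?thesis by simp
qed

lemma ex_partial_deriv_iter_eq_0: "\<exists>D. (partial_deriv n ^^ Suc D) p = 0"
proof -
  define D where "D = (\<Sum>\<beta>\<in>Poly_Mapping.keys p. Poly_Mapping.lookup \<beta> n)"
  have "Poly_Mapping.lookup ((partial_deriv n ^^ Suc D) p) \<gamma> = 0" for \<gamma>
  proof -
    obtain c where c: "Poly_Mapping.lookup ((partial_deriv n ^^ Suc D) p) \<gamma> =
        Poly_Mapping.lookup p (\<gamma> + Poly_Mapping.single n (Suc D)) * c"
      using lookup_partial_deriv_iter by blast
    have "\<gamma> + Poly_Mapping.single n (Suc D) \<notin> Poly_Mapping.keys p"
    proof
      assume "\<gamma> + Poly_Mapping.single n (Suc D) \<in> Poly_Mapping.keys p"
      then have "Poly_Mapping.lookup (\<gamma> + Poly_Mapping.single n (Suc D)) n \<le> D"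
        unfolding D_def by (rule member_le_sum) auto
      then show False by (simp add: lookup_add)
    qed
    then show ?thesis unfolding c by (simp add: in_keys_iff)
  qed
  then show ?thesis by (intro exI[of _ D] poly_mapping_eqI) simp
qed

lemma peval_Taylor:
  fixes x :: "nat \<Rightarrow> complex"
  assumes "(partial_deriv n ^^ Suc D) p = 0"
  shows "peval p (x(n := x n + z)) = (\<Sum>b\<le>D. peval ((partial_deriv n ^^ b) p) x * z ^ b / fact b)"
proof -
  have "norm (peval ((partial_deriv n ^^ 0) p) (x(n := x n + z)) -
      (\<Sum>b\<le>D. peval ((partial_deriv n ^^ b) p) (x(n := x n)) * (x n + z - x n) ^ b / fact b))
      \<le> 0 * norm (x n + z - x n) ^ Suc D / fact D"
  proof (rule complex_Taylor[of UNIV D "\<lambda>b w. peval ((partial_deriv n ^^ b) p) (x(n := w))"])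
    show "((\<lambda>w. peval ((partial_deriv n ^^ b) p) (x(n := w))) has_field_derivative
        peval ((partial_deriv n ^^ Suc b) p) (x(n := w))) (at w within UNIV)" for b w
      using peval_has_derivative[of "(partial_deriv n ^^ b) p" x n w] by simp
    show "norm (peval ((partial_deriv n ^^ Suc D) p) (x(n := w))) \<le> 0" for w
      unfolding assms by simp
  qed auto
  then show ?thesis by simp
qed

text \<open>In the finite Taylor expansion each derivative of positive order contributes a factor
  \<open>X powr (- e)\<close>, where \<open>X\<close> is the coordinate sum, while the powers of z
  cost at most \<open>X powr (e / 2)\<close>. So p varies by at most half of its value on the disc.
  Every smaller \<open>\<kappa>\<close> works too, which lets several polynomials share one.\<close>

lemma hypoelliptic_perturbation:
  assumes p: "hypoelliptic N p" and n: "n \<in> {1..N}"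
  shows "\<exists>\<kappa>0>0. \<forall>\<kappa>. 0 < \<kappa> \<and> \<kappa> \<le> \<kappa>0 \<longrightarrow> (\<exists>R. \<forall>(x::nat \<Rightarrow> real) z. (\<forall>i\<in>{1..N}. 1 \<le> x i) \<and> R \<le> (\<Sum>i=1..N. x i) \<and>
      norm z \<le> (\<Sum>i=1..N. x i) powr \<kappa> \<longrightarrow>
      norm (peval p ((\<lambda>i. of_real (x i))(n := of_real (x n) + z)) - of_real (peval p x) :: complex) \<le> 1/2 * peval p x)"
proof -
  obtain D where D: "(partial_deriv n ^^ Suc D) p = 0" using ex_partial_deriv_iter_eq_0 by blast
  have pp: "p \<in> polys N" using p by (simp add: hypoelliptic_iff)
  have "\<exists>\<epsilon>>0. \<exists>R\<ge>1. \<forall>x::nat \<Rightarrow> real. (\<forall>i\<in>{1..N}. 1 \<le> x i) \<and> R \<le> (\<Sum>i=1..N. x i) \<longrightarrow>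
      \<bar>peval ((partial_deriv n ^^ Suc b) p) x\<bar> \<le> peval p x * (\<Sum>i=1..N. x i) powr (- \<epsilon>)" for b
  proof (rule Lojasiewicz_at_infinity[OF polys_partial_deriv_iter[OF pp] pp])
    have "Poly_Mapping.keys (Poly_Mapping.single n (Suc b)) \<subseteq> {1..N}" using n by simp
    moreover have "Poly_Mapping.single n (Suc b) \<noteq> 0"
      by (metis lookup_single_eq lookup_zero nat.distinct(1))
    ultimately show "little_o N ((partial_deriv n ^^ Suc b) p) p"
      using p mixed_deriv_single[OF n, of "Suc b" p] unfolding hypoelliptic_iff by metis
    show "peval p x > 0" if "\<And>i. i \<in> {1..N} \<Longrightarrow> 1 \<le> x i" for x :: "nat \<Rightarrow> real"
      using hypoelliptic_pos[OF p that] .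
  qed
  then obtain \<epsilon> R where \<epsilon>: "\<And>b. \<epsilon> b > 0" and R: "\<And>b. R b \<ge> 1"
    and est: "\<And>b (x::nat \<Rightarrow> real). (\<forall>i\<in>{1..N}. 1 \<le> x i) \<Longrightarrow> R b \<le> (\<Sum>i=1..N. x i) \<Longrightarrow>
      \<bar>peval ((partial_deriv n ^^ Suc b) p) x\<bar> \<le> peval p x * (\<Sum>i=1..N. x i) powr (- \<epsilon> b)"
    by metis
  define e where "e = Min (\<epsilon> ` {..D})"
  have e: "e > 0" "\<And>b. b \<le> D \<Longrightarrow> e \<le> \<epsilon> b" using \<epsilon> by (auto simp: e_def)
  \<comment> \<open>With this bound \<open>\<kappa> * (D + 1) \<le> e / 2\<close>, so all powers of
    z in the expansion together use at most half of the gain.\<close>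
  define k0 where "k0 = e / (2 * (real D + 1))"
  have k0: "k0 > 0" using e by (simp add: k0_def)
  show ?thesis
  proof (rule exI[of _ k0], intro conjI k0 allI impI)
    fix \<kappa> assume \<kappa>: "0 < \<kappa> \<and> \<kappa> \<le> k0"
    have \<kappa>D: "\<kappa> * (real D + 1) \<le> e / 2"
    proof -
      have "\<kappa> * (real D + 1) \<le> k0 * (real D + 1)" using \<kappa> by (intro mult_right_mono) auto
      also have "\<dots> = e / 2"
      proof -
        have "e / (2 * d) * d = e / 2" if "d > 0" for d :: real using that by simp
        from this[of "real D + 1"] show ?thesis unfolding k0_def by simp
      qed
      finally show ?thesis .
    qed
    \<comment> \<open>The sum puts \<open>X\<close> beyond the thresholds of all derivatives; the
      second summand gives \<open>2 * (D + 1) \<le> X powr (e / 2)\<close>, so that the at most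
      \<open>D\<close> remaining terms add up to no more than half of p.\<close>
    define R0 where "R0 = (\<Sum>b\<le>D. R b) + (2 * (real D + 1)) powr (2 / e)"
    show "\<exists>R. \<forall>(x::nat \<Rightarrow> real) z. (\<forall>i\<in>{1..N}. 1 \<le> x i) \<and> R \<le> (\<Sum>i=1..N. x i) \<and>
      norm z \<le> (\<Sum>i=1..N. x i) powr \<kappa> \<longrightarrow>
      norm (peval p ((\<lambda>i. of_real (x i))(n := of_real (x n) + z)) - of_real (peval p x) :: complex) \<le> 1/2 * peval p x"
    proof (rule exI[of _ R0], intro allI impI)
      fix x :: "nat \<Rightarrow> real" and z :: complex
      define X where "X = (\<Sum>i=1..N. x i)"
      assume H: "(\<forall>i\<in>{1..N}. 1 \<le> x i) \<and> R0 \<le> (\<Sum>i=1..N. x i) \<and> norm z \<le> (\<Sum>i=1..N. x i) powr \<kappa>"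
      then have x: "\<forall>i\<in>{1..N}. 1 \<le> x i" and XR: "R0 \<le> X" and z: "norm z \<le> X powr \<kappa>" by (auto simp: X_def)
      have P0: "peval p x > 0" using hypoelliptic_pos[OF p] x by blast
      have Rb: "R b \<le> X" if "b \<le> D" for b
      proof -
        have "R b \<le> (\<Sum>b\<le>D. R b)" by (rule member_le_sum) (use that R in \<open>auto intro: order_trans[OF zero_le_one]\<close>)
        also have "\<dots> \<le> R0" by (simp add: R0_def)
        finally show ?thesis using XR by simp
      qed
      have X1: "X \<ge> 1" using Rb[of 0] R[of 0] by simp
      have Xpow: "2 * (real D + 1) \<le> X powr (e / 2)"
      proof -
        have "(2 * (real D + 1)) powr (2 / e) \<le> X" using XR R by (simp add: R0_def) (smt (verit) sum_nonneg)
        then have "((2 * (real D + 1)) powr (2 / e)) powr (e / 2) \<le> X powr (e / 2)"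
          using e by (intro powr_mono2) auto
        then show ?thesis using e by (simp add: powr_powr)
      qed
      have tbound: "norm (peval ((partial_deriv n ^^ Suc b) p) (\<lambda>i. of_real (x i)) * z ^ Suc b / fact (Suc b) :: complex)
          \<le> peval p x * X powr (- (e / 2))" if b: "b < D" for b
      proof -
        have "norm (peval ((partial_deriv n ^^ Suc b) p) (\<lambda>i. of_real (x i)) * z ^ Suc b / fact (Suc b) :: complex)
          \<le> norm (peval ((partial_deriv n ^^ Suc b) p) (\<lambda>i. of_real (x i)) * z ^ Suc b :: complex) / 1"
          unfolding norm_divide norm_fact by (intro divide_left_mono) (simp_all add: fact_ge_1 del: fact_Suc)
        also have "\<dots> = \<bar>peval ((partial_deriv n ^^ Suc b) p) x\<bar> * norm z ^ Suc b"
          by (simp only: peval_of_real norm_mult norm_power norm_of_real div_by_1 real_norm_def)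
        also have "\<dots> \<le> (peval p x * X powr (- e)) * X powr (e / 2)"
        proof (intro mult_mono)
          have "\<bar>peval ((partial_deriv n ^^ Suc b) p) x\<bar> \<le> peval p x * X powr (- \<epsilon> b)"
            unfolding X_def by (rule est[OF x]) (use Rb[of b] b in \<open>simp add: X_def\<close>)
          also have "\<dots> \<le> peval p x * X powr (- e)"
            using P0 X1 e(2)[of b] b by (intro mult_left_mono powr_mono) auto
          finally show "\<bar>peval ((partial_deriv n ^^ Suc b) p) x\<bar> \<le> peval p x * X powr (- e)" .
          have "norm z ^ Suc b \<le> (X powr \<kappa>) ^ Suc b" using z by (intro power_mono) auto
          also have "\<dots> = X powr (real (Suc b) * \<kappa>)" using X1 powr_power[of X \<kappa> "Suc b"] by simp
          also have "\<dots> \<le> X powr (e / 2)"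
          proof (rule powr_mono)
            have "real (Suc b) * \<kappa> \<le> (real D + 1) * \<kappa>" using b \<kappa> by (intro mult_right_mono) auto
            then show "real (Suc b) * \<kappa> \<le> e / 2" using \<kappa>D by (simp add: mult.commute)
          qed (use X1 in simp)
          finally show "norm z ^ Suc b \<le> X powr (e / 2)" .
        qed (use P0 in auto)
        also have "\<dots> = peval p x * X powr (- (e / 2))"
          by (simp add: mult.assoc powr_add[symmetric])
        finally show ?thesis .
      qed
      have "peval p ((\<lambda>i. of_real (x i))(n := of_real (x n) + z)) - of_real (peval p x) =
          (\<Sum>b<D. peval ((partial_deriv n ^^ Suc b) p) (\<lambda>i. of_real (x i)) * z ^ Suc b / fact (Suc b) :: complex)"
        using peval_Taylor[OF D, of "\<lambda>i. of_real (x i)" z]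
        by (simp add: sum.lessThan_Suc_shift peval_of_real del: sum.lessThan_Suc flip: lessThan_Suc_atMost)
      also have "norm \<dots> \<le> (\<Sum>b<D. peval p x * X powr (- (e / 2)))"
        by (rule order_trans[OF norm_sum]) (intro sum_mono tbound, simp)
      also have "\<dots> = peval p x * (real D * X powr (- (e / 2)))" by simp
      also have "\<dots> \<le> peval p x * (1 / 2)"
      proof (intro mult_left_mono)
        have "2 * real D \<le> X powr (e / 2)" using Xpow by simp
        then show "real D * X powr (- (e / 2)) \<le> 1 / 2"
          using X1 by (simp add: powr_minus field_simps)
      qed (use P0 in simp)
      finally show "norm (peval p ((\<lambda>i. of_real (x i))(n := of_real (x n) + z)) - of_real (peval p x) :: complex) \<le> 1/2 * peval p x"
        by simp
    qed
  qed
qed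

text \<open>Near 1 the logarithm of the modulus is at most 1 in absolute value and the argument at
  most 4 (a bound for pi).\<close>

lemma norm_Ln_le:
  fixes w :: complex
  assumes "norm (w - 1) \<le> 1/2"
  shows "norm (Ln w) \<le> 5"
proof -
  have w: "1/2 \<le> norm w" "norm w \<le> 3/2"
    using norm_triangle_ineq3[of w 1] assms by (auto simp: abs_le_iff)
  then have w0: "w \<noteq> 0" by auto
  have "ln (norm w) \<le> norm w - 1" "- ln (norm w) \<le> 1 / norm w - 1"
    using w w0 ln_le_minus_one[of "norm w"] ln_le_minus_one[of "1 / norm w"] by (auto simp: ln_div)
  moreover have "1 / norm w \<le> 1 / (1/2)" using w by (intro divide_left_mono) auto
  ultimately have "\<bar>Re (Ln w)\<bar> \<le> 1" using w w0 by (simp add: abs_le_iff)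
  moreover have "\<bar>Im (Ln w)\<bar> \<le> 4" using mpi_less_Im_Ln[OF w0] Im_Ln_le_pi[OF w0] pi_less_4 by linarith
  ultimately show ?thesis using cmod_le[of "Ln w"] by linarith
qed

lemma holomorphic_peval: "(\<lambda>z. peval p (y(n := c + z))) holomorphic_on S"
proof -
  have "(\<lambda>z. peval p (y(n := z))) holomorphic_on UNIV"
    unfolding holomorphic_on_def field_differentiable_def using peval_has_derivative by blast
  from holomorphic_on_compose_gen[OF _ this, of "\<lambda>z. c + z" S] show ?thesis
    by (simp add: o_def holomorphic_on_add holomorphic_on_const holomorphic_on_ident)
qed

lemma of_real_tuple_upd:
  "(\<lambda>i. of_real (real (m i)) :: complex)(n := of_real (real (m n)) + of_nat j) = (\<lambda>i. of_real (real ((m(n := m n + j)) i)))"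
  by (rule ext) simp

lemma upd_pos_tuples: "n \<in> {1..N} \<Longrightarrow> m \<in> pos_tuples N \<Longrightarrow> m(n := m n + j) \<in> pos_tuples N"
  by (auto simp: pos_tuples_def PiE_iff extensional_def intro: trans_le_add1)

text \<open>In the variable with index \<open>n\<close> the summand extends holomorphically to a disc whose radius is a power of the
  weight, so by Cauchy's estimate every difference gains a negative power of the weight.\<close>

lemma summand_difference_decay:
  fixes P :: "'t::finite \<Rightarrow> mpoly"
  assumes Q: "Q \<in> polys N" and P: "\<And>t. hypoelliptic N (P t)" and n: "n \<in> {1..N}" and \<rho>: "\<rho> > 0"
  shows "\<exists>K C. \<forall>s\<in>ball 0 \<rho>. \<forall>m\<in>pos_tuples N. norm ((Delta n ^^ K) (summand Q P s) m) \<le> C * (1 / real (wt N m) ^ a')"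
proof -
  have N: "N \<ge> 1" using n by auto
  let ?x = "\<lambda>m i. real (m i)"
  let ?cx = "\<lambda>m z. (\<lambda>i. of_real (real (m i)))(n := of_real (real (m n)) + z) :: nat \<Rightarrow> complex"
  have "\<forall>t. \<exists>\<kappa>0>0. \<forall>\<kappa>. 0 < \<kappa> \<and> \<kappa> \<le> \<kappa>0 \<longrightarrow> (\<exists>R. \<forall>(x::nat \<Rightarrow> real) z. (\<forall>i\<in>{1..N}. 1 \<le> x i) \<and> R \<le> (\<Sum>i=1..N. x i) \<and>
      norm z \<le> (\<Sum>i=1..N. x i) powr \<kappa> \<longrightarrow>
      norm (peval (P t) ((\<lambda>i. of_real (x i))(n := of_real (x n) + z)) - of_real (peval (P t) x) :: complex) \<le> 1/2 * peval (P t) x)"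
    using hypoelliptic_perturbation[OF P n] by blast
  from choice[OF this] obtain k where k0: "\<And>t. k t > 0" and k1: "\<And>t \<kappa>. 0 < \<kappa> \<Longrightarrow> \<kappa> \<le> k t \<Longrightarrow> (\<exists>R. \<forall>(x::nat \<Rightarrow> real) z. (\<forall>i\<in>{1..N}. 1 \<le> x i) \<and> R \<le> (\<Sum>i=1..N. x i) \<and>
      norm z \<le> (\<Sum>i=1..N. x i) powr \<kappa> \<longrightarrow>
      norm (peval (P t) ((\<lambda>i. of_real (x i))(n := of_real (x n) + z)) - of_real (peval (P t) x) :: complex) \<le> 1/2 * peval (P t) x)"
    by blast
  \<comment> \<open>One exponent for all \<open>P t\<close>; the bound 1 keeps the radius below the
    weight, so that \<open>Q\<close> grows polynomially on the disc.\<close>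
  define \<kappa> where "\<kappa> = min 1 (Min (range k))"
  have \<kappa>: "\<kappa> > 0" "\<kappa> \<le> 1" "\<And>t. \<kappa> \<le> k t" using k0 by (auto simp: \<kappa>_def min.coboundedI2)
  have "\<forall>t. \<exists>R. \<forall>(x::nat \<Rightarrow> real) z. (\<forall>i\<in>{1..N}. 1 \<le> x i) \<and> R \<le> (\<Sum>i=1..N. x i) \<and>
      norm z \<le> (\<Sum>i=1..N. x i) powr \<kappa> \<longrightarrow>
      norm (peval (P t) ((\<lambda>i. of_real (x i))(n := of_real (x n) + z)) - of_real (peval (P t) x) :: complex) \<le> 1/2 * peval (P t) x"
    using k1[OF \<kappa>(1) \<kappa>(3)] by blast
  from choice[OF this] obtain R where R: "\<And>t (x::nat \<Rightarrow> real) z. (\<forall>i\<in>{1..N}. 1 \<le> x i) \<Longrightarrow> R t \<le> (\<Sum>i=1..N. x i) \<Longrightarrow>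
      norm z \<le> (\<Sum>i=1..N. x i) powr \<kappa> \<Longrightarrow>
      norm (peval (P t) ((\<lambda>i. of_real (x i))(n := of_real (x n) + z)) - of_real (peval (P t) x) :: complex) \<le> 1/2 * peval (P t) x"
    by blast
  obtain C1 a1 where C1: "C1 \<ge> 0" "\<forall>s\<in>ball 0 \<rho>. \<forall>m\<in>pos_tuples N. norm (summand Q P s m) \<le> C1 * real (wt N m) ^ a1"
    using summand_growth[of Q N P \<rho>, OF Q P N] by blast
  obtain C2 a2 where C2: "C2 \<ge> 0" "\<forall>(s::complex^'t). \<forall>m\<in>pos_tuples N. s \<in> ball 0 \<rho> \<longrightarrow>
     (\<Prod>t\<in>UNIV. peval (P t) (?x m) powr (- Re (s $ t))) \<le> C2 * real (wt N m) ^ a2"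
    using prod_growth[of N P \<rho>, OF P N] by (elim exE conjE)
  obtain C3 a3 where C3: "C3 \<ge> 0" "\<And>(x::nat \<Rightarrow> complex) X. X \<ge> 1 \<Longrightarrow> (\<forall>i\<in>{1..N}. norm (x i) \<le> X) \<Longrightarrow> norm (peval Q x) \<le> C3 * X ^ a3"
    using peval_growth[OF Q, where 'a = complex] by blast
  define C4 where "C4 = C3 * 2 ^ a3 * C2 * exp (5 * \<rho>) ^ CARD('t)"
  have C4: "C4 \<ge> 0" unfolding C4_def using C3(1) C2(1) by simp
  define a4 where "a4 = a3 + a2"
  \<comment> \<open>Each difference gains about \<open>X powr (- \<kappa>)\<close>; after
    \<open>K\<close> of them the growth \<open>X ^ a4\<close> of the summand is undone and the
    desired decay \<open>X ^ a'\<close> is reached.\<close>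
  define K where "K = nat \<lceil>real (a4 + a') / \<kappa>\<rceil> + 1"
  have K: "real K * \<kappa> \<ge> real (a4 + a')" "K \<ge> 1"
  proof -
    have "real K \<ge> real (a4 + a') / \<kappa>" unfolding K_def by linarith
    then show "real K * \<kappa> \<ge> real (a4 + a')" using \<kappa>(1) by (simp add: pos_divide_le_eq)
  qed (simp add: K_def)
  \<comment> \<open>Beyond this weight all perturbation estimates hold and the radius
    \<open>X powr \<kappa>\<close> is at least \<open>4 * K\<close>, which leaves room for
    \<open>K\<close> unit steps.\<close>
  define R0 where "R0 = (\<Sum>t\<in>UNIV. \<bar>R t\<bar>) + 1 + (4 * real K) powr (1 / \<kappa>)"
  have R01: "R0 \<ge> 1" unfolding R0_def by (simp add: sum_nonneg)
  \<comment> \<open>The first summand is for weights from \<open>R0\<close> on; the second covers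
    smaller weights, where the crude growth bound suffices.\<close>
  define C where "C = C4 * (2 * real K) ^ K + C1 * (1 + 2 ^ a1) ^ K * R0 ^ (a1 + a')"
  have "norm ((Delta n ^^ K) (summand Q P s) m) \<le> C * (1 / real (wt N m) ^ a')"
    if s: "s \<in> ball 0 \<rho>" and m: "m \<in> pos_tuples N" for s m
  proof -
    define X where "X = real (wt N m)"
    have X1: "X \<ge> 1" using wt_ge_1[OF m N] by (simp add: X_def)
    have XS: "X = (\<Sum>i=1..N. ?x m i)" by (simp add: X_def real_wt)
    have x1: "\<forall>i\<in>{1..N}. 1 \<le> ?x m i" using pos_tuples_ge_1[OF m] by blast
    have Xa': "1 / X ^ a' > 0" using X1 by simp
    show ?thesis
    proof (cases "X < R0")
      case True
      have "norm ((Delta n ^^ K) (summand Q P s) m) \<le> C1 * (1 + 2 ^ a1) ^ K * X ^ a1"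
        unfolding X_def by (rule Delta_iter_growth[OF n _ C1(1) m]) (use C1(2) s in blast)
      also have "\<dots> = C1 * (1 + 2 ^ a1) ^ K * X ^ (a1 + a') * (1 / X ^ a')"
        using X1 by (simp add: power_add)
      also have "\<dots> \<le> C1 * (1 + 2 ^ a1) ^ K * R0 ^ (a1 + a') * (1 / X ^ a')"
        using C1(1) True X1 Xa' by (intro mult_right_mono mult_left_mono power_mono) auto
      also have "\<dots> \<le> C * (1 / X ^ a')"
        using Xa' C4 by (intro mult_right_mono) (auto simp: C_def)
      finally show ?thesis by (simp add: X_def)
    next
      case False
      then have XR: "X \<ge> R0" by simp
      have RX: "R t \<le> (\<Sum>i=1..N. ?x m i)" for t
      proof -
        have "\<bar>R t\<bar> \<le> (\<Sum>t\<in>UNIV. \<bar>R t\<bar>)" by (rule member_le_sum) auto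
        moreover have "(4 * real K) powr (1 / \<kappa>) \<ge> 0" by simp
        ultimately show ?thesis using XR unfolding R0_def XS by linarith
      qed
      define r where "r = X powr \<kappa>"
      have r4: "r \<ge> 4 * real K"
      proof -
        have "(\<Sum>t\<in>UNIV. \<bar>R t\<bar>) \<ge> 0" by (simp add: sum_nonneg)
        then have "(4 * real K) powr (1 / \<kappa>) \<le> X" using XR unfolding R0_def by linarith
        then have "((4 * real K) powr (1 / \<kappa>)) powr \<kappa> \<le> X powr \<kappa>" using \<kappa>(1) by (intro powr_mono2) auto
        then show ?thesis using \<kappa>(1) by (simp add: powr_powr r_def)
      qed
      have rX: "r \<le> X"
      proof -
        have "X powr \<kappa> \<le> X powr 1" using X1 \<kappa>(2) by (intro powr_mono) auto
        then show ?thesis using X1 by (simp add: r_def)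
      qed
      have Ppos: "peval (P t) (?x m) > 0" for t
        by (rule hypoelliptic_pos[OF P]) (use x1 in blast)
      define w where "w t z = peval (P t) (?cx m z) / of_real (peval (P t) (?x m))" for t z
      have w1: "norm (w t z - 1) \<le> 1/2" if "norm z \<le> r" for t z
      proof -
        have "norm (peval (P t) (?cx m z) - of_real (peval (P t) (?x m))) \<le> 1/2 * peval (P t) (?x m)"
          by (rule R[OF x1 RX]) (use that in \<open>simp add: r_def XS\<close>)
        moreover have "w t z - 1 = (peval (P t) (?cx m z) - of_real (peval (P t) (?x m))) / of_real (peval (P t) (?x m))"
          using Ppos[of t] by (simp add: w_def diff_divide_distrib)
        ultimately show ?thesis using Ppos[of t] by (simp add: norm_divide pos_divide_le_eq)
      qed
      \<comment> \<open>The logarithm of P at the shifted point is written as the real logarithm at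
        \<open>m\<close> plus \<open>Ln\<close> of the quotient \<open>w\<close>. The quotient stays
        in the right half plane, so the principal branch is holomorphic, and at integer points g
        agrees with the summand.\<close>
      define g where "g z = peval Q (?cx m z) * (\<Prod>t\<in>UNIV. exp (- (s $ t) * (of_real (ln (peval (P t) (?x m))) + Ln (w t z))))" for z
      have wnp: "w t z \<notin> \<real>\<^sub>\<le>\<^sub>0" if "norm z \<le> r" for t z
      proof -
        have "\<bar>Re (w t z - 1)\<bar> \<le> 1/2" using w1[OF that, of t] abs_Re_le_cmod[of "w t z - 1"] by linarith
        then have "\<bar>Re (w t z) - 1\<bar> \<le> 1/2" by simp
        then have "Re (w t z) > 0" by linarith
        then show ?thesis by (auto simp: complex_nonpos_Reals_iff)
      qed
      have hol: "g holomorphic_on ball 0 r"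
      proof -
        have wh: "(\<lambda>z. w t z) holomorphic_on ball 0 r" for t
          unfolding w_def using Ppos[of t] by (intro holomorphic_intros holomorphic_peval) auto
        show ?thesis unfolding g_def
          by (intro holomorphic_intros holomorphic_peval wh) (use wnp in auto)
      qed
      have bound: "norm (g z) \<le> C4 * X ^ a4" if z: "z \<in> ball 0 r" for z
      proof -
        have zr: "norm z \<le> r" using z by simp
        have "norm (peval Q (?cx m z)) \<le> C3 * (2 * X) ^ a3"
        proof (rule C3(2))
          show "\<forall>i\<in>{1..N}. norm (?cx m z i) \<le> 2 * X"
          proof
            fix i assume i: "i \<in> {1..N}"
            have mi: "real (m i) \<le> X" using le_wt[OF i, of m] by (simp add: X_def)
            have mn: "real (m n) \<le> X" using le_wt[OF n, of m] by (simp add: X_def)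
            show "norm (?cx m z i) \<le> 2 * X"
            proof (cases "i = n")
              case True
              have "norm (of_real (real (m n)) + z) \<le> real (m n) + norm z"
                using norm_triangle_ineq[of "of_real (real (m n))" z] by simp
              then show ?thesis using True mn zr rX by simp
            qed (use mi X1 in simp)
          qed
        qed (use X1 in simp)
        moreover have "norm (\<Prod>t\<in>UNIV. exp (- (s $ t) * (of_real (ln (peval (P t) (?x m))) + Ln (w t z))))
           \<le> C2 * X ^ a2 * exp (5 * \<rho>) ^ CARD('t)"
        proof -
          have "norm (exp (- (s $ t) * (of_real (ln (peval (P t) (?x m))) + Ln (w t z)))) \<le>
              peval (P t) (?x m) powr (- Re (s $ t)) * exp (5 * \<rho>)" for t
          proof -
            have "norm (s $ t * Ln (w t z)) \<le> \<rho> * 5"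
              unfolding norm_mult using norm_Ln_le[OF w1[OF zr, of t]] Finite_Cartesian_Product.norm_nth_le[of s t] s \<rho>
              by (intro mult_mono) auto
            then have "- Re (s $ t * Ln (w t z)) \<le> 5 * \<rho>"
              using abs_Re_le_cmod[of "s $ t * Ln (w t z)"] by linarith
            moreover have "Re (- (s $ t) * (of_real (ln (peval (P t) (?x m))) + Ln (w t z))) =
               - Re (s $ t) * ln (peval (P t) (?x m)) + (- Re (s $ t * Ln (w t z)))"
              by (simp add: algebra_simps)
            ultimately show ?thesis
              using Ppos[of t] by (simp add: powr_def exp_add[symmetric])
          qed
          then have "norm (\<Prod>t\<in>UNIV. exp (- (s $ t) * (of_real (ln (peval (P t) (?x m))) + Ln (w t z))))
              \<le> (\<Prod>t\<in>UNIV. peval (P t) (?x m) powr (- Re (s $ t)) * exp (5 * \<rho>))"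
            unfolding prod_norm[symmetric] by (intro prod_mono) auto
          also have "\<dots> = (\<Prod>t\<in>UNIV. peval (P t) (?x m) powr (- Re (s $ t))) * exp (5 * \<rho>) ^ CARD('t)"
            by (simp add: prod.distrib)
          also have "\<dots> \<le> C2 * X ^ a2 * exp (5 * \<rho>) ^ CARD('t)"
            unfolding X_def by (intro mult_right_mono C2(2)[rule_format] m s) auto
          finally show ?thesis .
        qed
        ultimately have "norm (g z) \<le> (C3 * (2 * X) ^ a3) * (C2 * X ^ a2 * exp (5 * \<rho>) ^ CARD('t))"
          unfolding g_def norm_mult using C3(1) X1 by (intro mult_mono) auto
        then show ?thesis by (simp add: C4_def a4_def power_add power_mult_distrib mult_ac)
      qed
      have eqf: "summand Q P s (m(n := m n + j)) = g (of_nat j)" if j: "j \<le> K" for j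
      proof -
        let ?m = "m(n := m n + j)"
        have "norm (of_nat j :: complex) \<le> r" using j r4 by simp
        have pm: "peval (P t) (?x ?m) > 0" for t
          by (intro hypoelliptic_pos[OF P] pos_tuples_ge_1[OF upd_pos_tuples[OF n m]])
        have "of_real (peval (P t) (?x ?m)) powr (- (s $ t)) =
            exp (- (s $ t) * (of_real (ln (peval (P t) (?x m))) + Ln (w t (of_nat j))))" for t
        proof -
          have "w t (of_nat j) = of_real (peval (P t) (?x ?m) / peval (P t) (?x m))"
            unfolding w_def of_real_tuple_upd peval_of_real by simp
          then have "Ln (w t (of_nat j)) = of_real (ln (peval (P t) (?x ?m) / peval (P t) (?x m)))"
            using pm[of t] Ppos[of t] by (simp only: Ln_of_real divide_pos_pos)
          also have "\<dots> = of_real (ln (peval (P t) (?x ?m))) - of_real (ln (peval (P t) (?x m)))"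
            using pm[of t] Ppos[of t] by (simp add: ln_div)
          finally show ?thesis using pm[of t] by (simp add: powr_def Ln_of_real)
        qed
        then show ?thesis unfolding summand_def g_def of_real_tuple_upd peval_of_real by simp
      qed
      have Kp: "real K > 0" using K(2) by simp
      \<comment> \<open>With this \<open>h\<close>, \<open>K\<close> differences consume
        \<open>r / 2 + K\<close> of the radius, which is less than \<open>r\<close>, so the centre 0
        remains in the final disc.\<close>
      define h where "h = r / (2 * real K)"
      have h: "h > 0" using r4 Kp by (simp add: h_def)
      have "real K * (h + 1) = r / 2 + real K" using Kp by (simp add: h_def field_simps)
      then have "r - real K * (h + 1) > 0" using r4 Kp by linarith
      then have "norm ((fdiff ^^ K) g 0) \<le> C4 * X ^ a4 / h ^ K"
        using fdiff_iter_bound[OF hol bound h, of K] by simp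
      moreover have "(Delta n ^^ K) (summand Q P s) (m(n := m n + 0)) = (fdiff ^^ K) g (of_nat 0)"
        by (rule Delta_iter_eq_fdiff_iter[of K]) (use eqf in auto)
      ultimately have "norm ((Delta n ^^ K) (summand Q P s) m) \<le> C4 * X ^ a4 / h ^ K" by simp
      also have "\<dots> = C4 * (2 * real K) ^ K * (X ^ a4 / r ^ K)" by (simp add: h_def power_divide)
      also have "\<dots> \<le> C4 * (2 * real K) ^ K * (1 / X ^ a')"
      proof (intro mult_left_mono)
        have "X ^ (a4 + a') = X powr real (a4 + a')" using X1 by (simp only: powr_realpow)
        also have "\<dots> \<le> X powr (real K * \<kappa>)" using X1 K(1) by (intro powr_mono) auto
        also have "\<dots> = r ^ K" using X1 powr_power[of X \<kappa> K] by (simp add: r_def)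
        finally have "X ^ a4 * X ^ a' \<le> r ^ K" by (simp add: power_add)
        moreover have "r ^ K > 0" using r4 Kp by simp
        ultimately show "X ^ a4 / r ^ K \<le> 1 / X ^ a'" using X1 by (simp add: field_simps)
      qed (use C4 in simp)
      also have "\<dots> \<le> C * (1 / X ^ a')"
        using Xa' C1(1) R01 by (intro mult_right_mono) (auto simp: C_def)
      finally show ?thesis by (simp add: X_def)
    qed
  qed
  then show ?thesis by blast
qed

section \<open>The entire continuation\<close>

lemma mu_power_incr: "n \<in> {1..N} \<Longrightarrow> mu_power N \<mu> (incr n m) = \<mu> n * mu_power N \<mu> m"
  unfolding mu_power_def incr_def
  by (subst (1 2) prod.remove[of _ n]) (auto intro!: prod.cong)

lemma mu_power_Suc_upd: "mu_power (Suc N) \<mu> (d(Suc N := c)) = mu_power N \<mu> d * \<mu> (Suc N) ^ c"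
proof -
  have "(\<Prod>n=1..N. \<mu> n ^ (d(Suc N := c)) n) = (\<Prod>n=1..N. \<mu> n ^ d n)" by (intro prod.cong) auto
  then show ?thesis unfolding mu_power_def by simp
qed

lemma wt_Suc_upd: "wt (Suc N) (d(Suc N := c)) = wt N d + c"
proof -
  have "(\<Sum>n=1..N. (d(Suc N := c)) n) = (\<Sum>n=1..N. d n)" by (intro sum.cong) auto
  then show ?thesis unfolding wt_def by simp
qed

lemma pos_tuples_Suc_upd: "d \<in> pos_tuples N \<Longrightarrow> c \<ge> 1 \<Longrightarrow> d(Suc N := c) \<in> pos_tuples (Suc N)"
  by (auto simp: pos_tuples_def PiE_iff extensional_def)

text \<open>The last entry either exceeds 1, and can be lowered, or equals 1, and the tuple comes
  from the boundary face. This is the combinatorial part of summation by parts.\<close>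

lemma pos_tuples_Suc_eq:
  "pos_tuples (Suc N) = incr (Suc N) ` pos_tuples (Suc N) \<union> (\<lambda>d. d(Suc N := 1)) ` pos_tuples N"
proof (intro equalityI subsetI)
  fix m assume m: "m \<in> pos_tuples (Suc N)"
  have m1: "m (Suc N) \<ge> 1" using pos_tuplesD[OF m, of "Suc N"] by simp
  show "m \<in> incr (Suc N) ` pos_tuples (Suc N) \<union> (\<lambda>d. d(Suc N := 1)) ` pos_tuples N"
  proof (cases "m (Suc N) = 1")
    case True
    have "m(Suc N := undefined) \<in> pos_tuples N"
      using m by (auto simp: pos_tuples_def PiE_iff extensional_def)
    moreover have "m = (m(Suc N := undefined))(Suc N := 1)" using True by auto
    ultimately show ?thesis by blast
  next
    case False
    have "m (Suc N) - 1 \<ge> 1" using m1 False by simp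
    then have "m(Suc N := m (Suc N) - 1) \<in> pos_tuples (Suc N)"
      using m by (auto simp: pos_tuples_def PiE_iff extensional_def)
    moreover have "m = incr (Suc N) (m(Suc N := m (Suc N) - 1))" using m1 by (auto simp: incr_def)
    ultimately show ?thesis by blast
  qed
qed (auto simp: incr_pos_tuples pos_tuples_Suc_upd)

lemma inj_on_incr: "inj_on (incr n) A"
proof (rule inj_onI)
  fix x y assume eq: "incr n x = incr n y"
  show "x = y"
  proof
    fix i show "x i = y i" using fun_cong[OF eq, of i] by (cases "i = n") (auto simp: incr_def)
  qed
qed

lemma inj_on_Suc_upd: "inj_on (\<lambda>d. d(Suc N := c)) (pos_tuples N)"
proof (rule inj_onI)
  fix x y assume xy: "x \<in> pos_tuples N" "y \<in> pos_tuples N" and eq: "x(Suc N := c) = y(Suc N := c)"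
  show "x = y"
  proof
    fix i show "x i = y i"
      using fun_cong[OF eq, of i] xy by (cases "i = Suc N") (auto simp: pos_tuples_def PiE_iff extensional_def)
  qed
qed

lemma incr_disjoint: "incr (Suc N) ` pos_tuples (Suc N) \<inter> (\<lambda>d. d(Suc N := 1)) ` pos_tuples N = {}"
proof -
  have False if "m \<in> pos_tuples (Suc N)" "incr (Suc N) m = d(Suc N := 1)" for m d
  proof -
    have "Suc (m (Suc N)) = 1" using fun_cong[OF that(2), of "Suc N"] by (simp add: incr_def)
    then show False using pos_tuplesD[OF that(1), of "Suc N"] by simp
  qed
  then show ?thesis by blast
qed

text \<open>With F, D and B the damped sums of f, of its difference and of the boundary, shifting
  the last variable gives \<open>F = r * \<mu> * (F + D) + r * \<mu> * B\<close>. Solving for F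
  divides by \<open>1 - r * \<mu>\<close>, which is nonzero for r < 1 and has a nonzero limit
  because \<mu> \<noteq> 1.\<close>

lemma abel_summation_by_parts:
  assumes \<mu>: "\<forall>n\<in>{1..Suc N}. norm (\<mu> n) = 1" and \<mu>1: "\<mu> (Suc N) \<noteq> 1"
    and growth: "\<And>m. m \<in> pos_tuples (Suc N) \<Longrightarrow> norm (f m) \<le> C * real (wt (Suc N) m) ^ a"
    and D: "abel (pos_tuples (Suc N)) (wt (Suc N)) (\<lambda>m. mu_power (Suc N) \<mu> m * Delta (Suc N) f m) G"
    and B: "abel (pos_tuples N) (wt N) (\<lambda>d. mu_power N \<mu> d * f (d(Suc N := 1))) B"
  shows "abel (pos_tuples (Suc N)) (wt (Suc N)) (\<lambda>m. mu_power (Suc N) \<mu> m * f m) (\<mu> (Suc N) / (1 - \<mu> (Suc N)) * (G + B))"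
proof -
  let ?n = "Suc N" and ?A = "pos_tuples (Suc N)"
  let ?\<mu> = "\<mu> ?n"
  let ?F = "\<lambda>r m. of_real r ^ wt ?n m * (mu_power ?n \<mu> m * f m)"
  let ?D = "\<lambda>r m. of_real r ^ wt ?n m * (mu_power ?n \<mu> m * Delta ?n f m)"
  let ?B = "\<lambda>r d. of_real r ^ wt N d * (mu_power N \<mu> d * f (d(?n := 1)))"
  have sumF: "(\<lambda>m. norm (?F r m)) summable_on ?A" if "0 < r" "r < 1" for r
    by (rule summable_on_damped[OF _ that, of _ _ C a]) (use growth in \<open>simp add: norm_mult norm_mu_power[OF \<mu>]\<close>)
  have eq: "(\<Sum>\<^sub>\<infinity>m\<in>?A. ?F r m) = of_real r * ?\<mu> / (1 - of_real r * ?\<mu>) * ((\<Sum>\<^sub>\<infinity>m\<in>?A. ?D r m) + (\<Sum>\<^sub>\<infinity>d\<in>pos_tuples N. ?B r d))"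
    if r: "0 < r" "r < 1" for r
  proof -
    have sF: "?F r summable_on ?A" using sumF[OF r] by (rule abs_summable_summable)
    have sD: "?D r summable_on ?A" by (rule abel_summable_on[OF D r])
    have sB: "?B r summable_on pos_tuples N" by (rule abel_summable_on[OF B r])
    have upF: "?F r (incr ?n m) = of_real r * ?\<mu> * (?F r m + ?D r m)" for m
      by (simp add: wt_incr mu_power_incr Delta_def algebra_simps)
    have oneF: "?F r (d(?n := 1)) = of_real r * ?\<mu> * ?B r d" for d
      unfolding mu_power_Suc_upd wt_Suc_upd by (simp add: algebra_simps)
    have "(\<Sum>\<^sub>\<infinity>m\<in>?A. ?F r m) = (\<Sum>\<^sub>\<infinity>m\<in>incr ?n ` ?A. ?F r m) + (\<Sum>\<^sub>\<infinity>m\<in>(\<lambda>d. d(?n := 1)) ` pos_tuples N. ?F r m)"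
      by (subst pos_tuples_Suc_eq, rule infsum_Un_disjoint)
         (use pos_tuples_Suc_eq[of N] incr_disjoint in \<open>auto intro!: summable_on_subset_banach[OF sF]\<close>)
    also have "(\<Sum>\<^sub>\<infinity>m\<in>incr ?n ` ?A. ?F r m) = (\<Sum>\<^sub>\<infinity>m\<in>?A. of_real r * ?\<mu> * (?F r m + ?D r m))"
      by (subst infsum_reindex[OF inj_on_incr]) (simp add: o_def upF)
    also have "\<dots> = of_real r * ?\<mu> * ((\<Sum>\<^sub>\<infinity>m\<in>?A. ?F r m) + (\<Sum>\<^sub>\<infinity>m\<in>?A. ?D r m))"
      unfolding infsum_cmult_right' by (simp add: infsum_add[OF sF sD])
    also have "(\<Sum>\<^sub>\<infinity>m\<in>(\<lambda>d. d(?n := 1)) ` pos_tuples N. ?F r m) = (\<Sum>\<^sub>\<infinity>d\<in>pos_tuples N. of_real r * ?\<mu> * ?B r d)"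
      by (subst infsum_reindex[OF inj_on_Suc_upd]) (simp only: o_def oneF)
    also have "\<dots> = of_real r * ?\<mu> * (\<Sum>\<^sub>\<infinity>d\<in>pos_tuples N. ?B r d)"
      by (rule infsum_cmult_right')
    finally have *: "(\<Sum>\<^sub>\<infinity>m\<in>?A. ?F r m) = of_real r * ?\<mu> * ((\<Sum>\<^sub>\<infinity>m\<in>?A. ?F r m) + (\<Sum>\<^sub>\<infinity>m\<in>?A. ?D r m))
        + of_real r * ?\<mu> * (\<Sum>\<^sub>\<infinity>d\<in>pos_tuples N. ?B r d)" .
    have "norm (of_real r * ?\<mu>) \<noteq> 1" using \<mu> r by (simp add: norm_mult)
    then have "1 - of_real r * ?\<mu> \<noteq> 0" by auto
    moreover have "S = q / (1 - q) * (d + b)" if "S = q * (S + d) + q * b" "1 - q \<noteq> 0" for S q d b :: complex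
      using that by (simp add: field_simps)
    ultimately show ?thesis using * by blast
  qed
  have "((\<lambda>r. of_real r * ?\<mu> / (1 - of_real r * ?\<mu>) * ((\<Sum>\<^sub>\<infinity>m\<in>?A. ?D r m) + (\<Sum>\<^sub>\<infinity>d\<in>pos_tuples N. ?B r d)))
      \<longlongrightarrow> of_real 1 * ?\<mu> / (1 - of_real 1 * ?\<mu>) * (G + B)) (at_left (1::real))"
    using D B \<mu>1 unfolding abel_def by (intro tendsto_intros) auto
  then have "((\<lambda>r. \<Sum>\<^sub>\<infinity>m\<in>?A. ?F r m) \<longlongrightarrow> ?\<mu> / (1 - ?\<mu>) * (G + B)) (at_left (1::real))"
    using Lim_transform_eventually[OF _ eventually_at_left_1[OF eq[symmetric]]] by simp
  then show ?thesis unfolding abel_def using sumF by blast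
qed

section \<open>Induction on the number of variables\<close>

lemma holo_at_summand:
  fixes P :: "'t::finite \<Rightarrow> mpoly"
  assumes "\<And>t. peval (P t) (\<lambda>i. real (m i)) > 0"
  shows "holo_at (\<lambda>s. summand Q P s m) s"
proof -
  have "of_real (peval (P t) (\<lambda>i. real (m i))) powr (- w) = exp (- Ln (of_real (peval (P t) (\<lambda>i. real (m i)))) * w)" for t w
    using assms[of t] by (simp add: powr_def mult.commute)
  then show ?thesis unfolding summand_def
    by (simp only:) (intro holo_at_mult holo_at_prod holo_at_const holo_at_exp_component)
qed

lemma holo_at_Delta_iter:
  assumes n: "n \<in> {1..N}" and hol: "\<And>m. m \<in> pos_tuples N \<Longrightarrow> holo_at (\<lambda>s. f s m) s" and m: "m \<in> pos_tuples N"
  shows "holo_at (\<lambda>s. (Delta n ^^ K) (f s) m) s"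
  using m
proof (induction K arbitrary: m)
  case 0 then show ?case using hol by simp
next
  case (Suc K)
  have "holo_at (\<lambda>s. (Delta n ^^ K) (f s) (incr n m) - (Delta n ^^ K) (f s) m) s"
    by (intro holo_at_diff Suc.IH incr_pos_tuples n Suc.prems)
  then show ?case unfolding funpow.simps o_apply by (simp only: Delta_def)
qed

text \<open>Fixing the last variable at \<open>c\<close> is a restriction with shift 0 to the index
  set \<open>{1..N}\<close>, so the boundary series falls under the induction hypothesis.\<close>

lemma summand_restrict_last:
  assumes Q: "Q \<in> polys (Suc N)" and P: "\<And>t. P t \<in> polys (Suc N)"
  shows "summand (restrict_poly (\<lambda>_. 0) {1..N} (\<lambda>_. c) Q) (\<lambda>t. restrict_poly (\<lambda>_. 0) {1..N} (\<lambda>_. c) (P t)) s d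
     = summand Q P s (d(Suc N := c))"
proof -
  have "peval (restrict_poly (\<lambda>_. 0) {1..N} (\<lambda>_. c) p) (\<lambda>n. real (d n)) = peval p (\<lambda>n. real ((d(Suc N := c)) n))"
    if p: "p \<in> polys (Suc N)" for p
    unfolding peval_restrict_point
  proof (rule peval_cong[OF p])
    fix i assume i: "i \<in> {1..Suc N}"
    have "{j \<in> {1..N}. j \<le> i} = {1..i}" if "i \<in> {1..N}" using that by auto
    then show "restrict_point (\<lambda>_. 0) {1..N} (\<lambda>_. c) (\<lambda>n. real (d n)) i = real ((d(Suc N := c)) i)"
      using i by (auto simp: restrict_point_def)
  qed
  then show ?thesis unfolding summand_def using Q P by simp
qed

text \<open>The number of differences needed grows with the ball in which s varies, so the limit is
  first constructed ball by ball. Abel limits are unique, hence the local functions agree and define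
  one entire function.\<close>

lemma ex_entire_abel_limit:
  fixes P :: "'t::finite \<Rightarrow> mpoly"
  assumes "\<forall>n\<in>{1..N}. norm (\<mu> n) = 1 \<and> \<mu> n \<noteq> 1" and "Q \<in> polys N" and "\<And>t. hypoelliptic N (P t)"
  shows "\<exists>F. entire F \<and> (\<forall>s. abel (pos_tuples N) (wt N) (zeta_term N Q P \<mu> s) (F s))"
  using assms
proof (induction N arbitrary: Q P)
  case 0
  have fin: "finite (pos_tuples 0)" by (simp add: pos_tuples_def)
  show ?case
  proof (intro exI[of _ "\<lambda>s. \<Sum>m\<in>pos_tuples 0. zeta_term 0 Q P \<mu> s m"] conjI allI)
    show "entire (\<lambda>s. \<Sum>m\<in>pos_tuples 0. zeta_term 0 Q P \<mu> s m)"
      unfolding entire_iff_holo_at zeta_term_eq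
      by (intro allI holo_at_sum holo_at_cmult holo_at_summand hypoelliptic_pos[OF "0.prems"(3)]) simp
    show "abel (pos_tuples 0) (wt 0) (zeta_term 0 Q P \<mu> s) (\<Sum>m\<in>pos_tuples 0. zeta_term 0 Q P \<mu> s m)" for s
      using abel_of_summable[of "zeta_term 0 Q P \<mu> s" "pos_tuples 0" "wt 0"] fin by simp
  qed
next
  case (Suc N)
  let ?n = "Suc N" and ?A = "pos_tuples (Suc N)"
  have \<mu>1: "\<forall>n\<in>{1..?n}. norm (\<mu> n) = 1" using Suc.prems(1) by blast
  have \<mu>n: "\<mu> ?n \<noteq> 1" using Suc.prems(1) by auto
  have n: "?n \<in> {1..?n}" by simp
  have Pp: "P t \<in> polys ?n" for t using Suc.prems(3)[of t] by (simp add: hypoelliptic_iff)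
  have Ppos: "peval (P t) (\<lambda>i. real (m i)) > 0" if "m \<in> ?A" for t m
    by (intro hypoelliptic_pos[OF Suc.prems(3)] pos_tuples_ge_1[OF that])
  \<comment> \<open>A difference in the last variable at \<open>c\<close> involves the values at
    \<open>c\<close> and \<open>c + 1\<close>. The boundary series is therefore treated for all
    \<open>c \<ge> 1\<close> at once, by induction on the order of the difference.\<close>
  have bdry: "\<exists>B. entire B \<and> (\<forall>s. abel (pos_tuples N) (wt N) (\<lambda>d. mu_power N \<mu> d * (Delta ?n ^^ j) (summand Q P s) (d(?n := c))) (B s))"
    if "c \<ge> 1" for j c
    using that
  proof (induction j arbitrary: c)
    case 0
    let ?r = "restrict_poly (\<lambda>_. 0) {1..N} (\<lambda>_. c)"
    have sub: "{1..N} \<subseteq> {1..?n}" by auto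
    have "?r Q \<in> polys (card {1..N})" by (rule polys_restrict[OF sub Suc.prems(2)])
    moreover have "hypoelliptic (card {1..N}) (?r (P t))" for t
      by (rule hypoelliptic_restrict[OF sub _ Suc.prems(3)]) (use 0 in simp)
    moreover have "\<forall>n\<in>{1..N}. norm (\<mu> n) = 1 \<and> \<mu> n \<noteq> 1" using Suc.prems(1) by simp
    ultimately have "\<exists>F. entire F \<and> (\<forall>s. abel (pos_tuples N) (wt N) (zeta_term N (?r Q) (\<lambda>t. ?r (P t)) \<mu> s) (F s))"
      using Suc.IH[of "?r Q" "\<lambda>t. ?r (P t)"] by simp
    then show ?case
      unfolding zeta_term_eq[abs_def] summand_restrict_last[OF Suc.prems(2) Pp] by (simp only: funpow_0)
  next
    case (Suc j)
    obtain B1 where B1: "entire B1" "\<And>s. abel (pos_tuples N) (wt N) (\<lambda>d. mu_power N \<mu> d * (Delta ?n ^^ j) (summand Q P s) (d(?n := Suc c))) (B1 s)"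
      using Suc.IH[of "Suc c", OF le_SucI[OF Suc.prems]] by blast
    obtain B2 where B2: "entire B2" "\<And>s. abel (pos_tuples N) (wt N) (\<lambda>d. mu_power N \<mu> d * (Delta ?n ^^ j) (summand Q P s) (d(?n := c))) (B2 s)"
      using Suc.IH[of c, OF Suc.prems] by blast
    have upd: "incr ?n (d(?n := c)) = d(?n := Suc c)" for d by (simp add: incr_def)
    show ?case
    proof (intro exI[of _ "\<lambda>s. B1 s - B2 s"] conjI allI)
      show "entire (\<lambda>s. B1 s - B2 s)" using B1(1) B2(1) unfolding entire_iff_holo_at by (blast intro: holo_at_diff)
      show "abel (pos_tuples N) (wt N) (\<lambda>d. mu_power N \<mu> d * (Delta ?n ^^ Suc j) (summand Q P s) (d(?n := c))) (B1 s - B2 s)" for s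
        using abel_diff[OF B1(2) B2(2), of s s]
        unfolding funpow.simps o_apply Delta_def[of ?n "(Delta ?n ^^ j) (summand Q P s)" for s] upd right_diff_distrib .
    qed
  qed
  have local: "\<exists>G. \<forall>s\<in>ball 0 \<rho>. holo_at G s \<and> abel ?A (wt ?n) (zeta_term ?n Q P \<mu> s) (G s)" if \<rho>: "\<rho> > 0" for \<rho>
  proof -
    obtain K C where KC: "\<And>s m. s \<in> ball 0 \<rho> \<Longrightarrow> m \<in> ?A \<Longrightarrow> norm ((Delta ?n ^^ K) (summand Q P s) m) \<le> C * (1 / real (wt ?n m) ^ (2 * ?n))"
      using summand_difference_decay[where a' = "2 * Suc N" and P = P, OF Suc.prems(2,3) n \<rho>] by blast
    obtain C1 a1 where C1: "C1 \<ge> 0" "\<And>s m. s \<in> ball 0 \<rho> \<Longrightarrow> m \<in> ?A \<Longrightarrow> norm (summand Q P s m) \<le> C1 * real (wt ?n m) ^ a1"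
    proof -
      have "?n \<ge> 1" by simp
      from summand_growth[of Q ?n P \<rho>, OF Suc.prems(2,3) this] show ?thesis using that by blast
    qed
    have sM: "(\<lambda>m. C * (1 / real (wt ?n m) ^ (2 * ?n))) summable_on ?A"
      by (intro summable_on_cmult_right summable_on_wt_power)
    \<comment> \<open>Descent from the differences of order \<open>K\<close>, which are summable
      uniformly in s, to the summand itself; each summation by parts lowers the order by
      one.\<close>
    have "\<exists>G. \<forall>s\<in>ball 0 \<rho>. holo_at G s \<and> abel ?A (wt ?n) (\<lambda>m. mu_power ?n \<mu> m * (Delta ?n ^^ (K - i)) (summand Q P s) m) (G s)" if "i \<le> K" for i
      using that
    proof (induction i)
      case 0
      have nm: "norm (mu_power ?n \<mu> m * (Delta ?n ^^ K) (summand Q P s) m) \<le> C * (1 / real (wt ?n m) ^ (2 * ?n))"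
        if "m \<in> ?A" "s \<in> ball 0 \<rho>" for s m using KC[OF that(2,1)] by (simp add: norm_mult norm_mu_power[OF \<mu>1])
      show ?case
      proof (intro exI[of _ "\<lambda>s. \<Sum>\<^sub>\<infinity>m\<in>?A. mu_power ?n \<mu> m * (Delta ?n ^^ K) (summand Q P s) m"] ballI conjI)
        fix s :: "complex^'t" assume s: "s \<in> ball 0 \<rho>"
        show "holo_at (\<lambda>s. \<Sum>\<^sub>\<infinity>m\<in>?A. mu_power ?n \<mu> m * (Delta ?n ^^ K) (summand Q P s) m) s"
          by (rule holo_at_infsum[OF _ nm sM s]) (intro holo_at_cmult holo_at_Delta_iter[OF n] holo_at_summand Ppos)
        show "abel ?A (wt ?n) (\<lambda>m. mu_power ?n \<mu> m * (Delta ?n ^^ (K - 0)) (summand Q P s) m)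
           (\<Sum>\<^sub>\<infinity>m\<in>?A. mu_power ?n \<mu> m * (Delta ?n ^^ K) (summand Q P s) m)"
          using abel_of_summable[OF Infinite_Sum.abs_summable_on_comparison_test'[OF sM nm[OF _ s]], of "wt ?n"] by simp
      qed
    next
      case (Suc i)
      obtain G where G: "\<And>s. s \<in> ball 0 \<rho> \<Longrightarrow> holo_at G s"
         "\<And>s. s \<in> ball 0 \<rho> \<Longrightarrow> abel ?A (wt ?n) (\<lambda>m. mu_power ?n \<mu> m * (Delta ?n ^^ (K - i)) (summand Q P s) m) (G s)"
        using Suc.IH[OF Suc_leD[OF Suc.prems]] by blast
      define j where "j = K - Suc i"
      have j: "K - i = Suc j" using Suc.prems by (simp add: j_def)
      obtain B where B: "entire B" "\<And>s. abel (pos_tuples N) (wt N) (\<lambda>d. mu_power N \<mu> d * (Delta ?n ^^ j) (summand Q P s) (d(?n := 1))) (B s)"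
        using bdry[of 1 j, OF order_refl] by blast
      show ?case unfolding j_def[symmetric]
      proof (intro exI[of _ "\<lambda>s. \<mu> ?n / (1 - \<mu> ?n) * (G s + B s)"] ballI conjI)
        fix s :: "complex^'t" assume s: "s \<in> ball 0 \<rho>"
        show "holo_at (\<lambda>s. \<mu> ?n / (1 - \<mu> ?n) * (G s + B s)) s"
          using G(1)[OF s] B(1) unfolding entire_iff_holo_at by (intro holo_at_cmult holo_at_add) auto
        show "abel ?A (wt ?n) (\<lambda>m. mu_power ?n \<mu> m * (Delta ?n ^^ j) (summand Q P s) m) (\<mu> ?n / (1 - \<mu> ?n) * (G s + B s))"
        proof (rule abel_summation_by_parts[OF \<mu>1 \<mu>n _ _ B(2)])
          show "norm ((Delta ?n ^^ j) (summand Q P s) m) \<le> (C1 * (1 + 2 ^ a1) ^ j) * real (wt ?n m) ^ a1" if "m \<in> ?A" for m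
            by (rule Delta_iter_growth[OF n C1(2)[OF s] C1(1) that])
          show "abel ?A (wt ?n) (\<lambda>m. mu_power ?n \<mu> m * Delta ?n ((Delta ?n ^^ j) (summand Q P s)) m) (G s)"
            using G(2)[OF s] unfolding j by simp
        qed
      qed
    qed
    from this[of K] show ?thesis by (simp add: zeta_term_eq[abs_def])
  qed
  have ex: "\<exists>L. abel ?A (wt ?n) (zeta_term ?n Q P \<mu> s) L" for s
  proof -
    have "norm s + 1 > 0" by (simp add: add_nonneg_pos)
    then show ?thesis using local[of "norm s + 1"] by force
  qed
  then obtain F where F: "\<And>s. abel ?A (wt ?n) (zeta_term ?n Q P \<mu> s) (F s)" by metis
  have "holo_at F s" for s
  proof -
    have p: "norm s + 1 > 0" by (simp add: add_nonneg_pos)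
    then obtain G where G: "\<And>s'. s' \<in> ball 0 (norm s + 1) \<Longrightarrow> holo_at G s'"
      "\<And>s'. s' \<in> ball 0 (norm s + 1) \<Longrightarrow> abel ?A (wt ?n) (zeta_term ?n Q P \<mu> s') (G s')"
      using local[of "norm s + 1"] by blast
    have s: "s \<in> ball 0 (norm s + 1)" by simp
    show ?thesis
      by (rule holo_at_transform[OF G(1)[OF s] open_ball s]) (rule abel_unique[OF G(2) F])
  qed
  then show ?case using F unfolding entire_iff_holo_at by blast
qed

text \<open>One factor, \<open>P t0\<close>, grows at least like a power of the weight by the
  Lojasiewicz inequality, applied to 1 and \<open>P t0\<close>. The other factors are constant or
  eventually at least 1, so with positive real parts of s they stay bounded.\<close>

lemma ex_abs_convergence:
  fixes P :: "'t::finite \<Rightarrow> mpoly"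
  assumes \<mu>: "\<forall>n\<in>{1..N}. norm (\<mu> n) = 1" and Q: "Q \<in> polys N" and P: "\<And>t. hypoelliptic N (P t)"
    and o: "little_o N 1 (P t0)"
  shows "\<exists>\<sigma>. \<forall>s. (\<forall>t. Re (s $ t) > \<sigma>) \<longrightarrow> (\<lambda>m. norm (zeta_term N Q P \<mu> s m)) summable_on pos_tuples N"
proof (cases "N = 0")
  case True
  then have "finite (pos_tuples N)" by (simp add: pos_tuples_def)
  then show ?thesis by simp
next
  case False
  then have N: "N \<ge> 1" by simp
  obtain C a where C: "C \<ge> 0" "\<And>m. m \<in> pos_tuples N \<Longrightarrow> \<bar>peval Q (\<lambda>i. real (m i))\<bar> \<le> C * real (wt N m) ^ a"
    using peval_tuple_growth[OF Q N] by blast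
  have "P t0 \<in> polys N" using P[of t0] by (simp add: hypoelliptic_iff)
  from Lojasiewicz_at_infinity[OF polys_1 this _ o]
  have "\<exists>\<epsilon>>0. \<exists>R\<ge>1. \<forall>x::nat \<Rightarrow> real. (\<forall>n\<in>{1..N}. 1 \<le> x n) \<and> R \<le> (\<Sum>n=1..N. x n) \<longrightarrow>
      \<bar>peval 1 x\<bar> \<le> peval (P t0) x * (\<Sum>n=1..N. x n) powr (- \<epsilon>)"
    using hypoelliptic_pos[OF P] by blast
  then obtain \<epsilon> R where \<epsilon>: "\<epsilon> > 0" and R: "\<And>x::nat \<Rightarrow> real. (\<forall>n\<in>{1..N}. 1 \<le> x n) \<Longrightarrow> R \<le> (\<Sum>n=1..N. x n) \<Longrightarrow>
      \<bar>peval 1 x\<bar> \<le> peval (P t0) x * (\<Sum>n=1..N. x n) powr (- \<epsilon>)" by blast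
  \<comment> \<open>From this abscissa on, \<open>P t0\<close> beats the growth exponent
    \<open>a\<close> of \<open>Q\<close> and leaves \<open>2 * N\<close> powers of the weight for
    summability.\<close>
  define \<sigma> where "\<sigma> = real (a + 2 * N) / \<epsilon>"
  have \<sigma>: "\<sigma> \<ge> 0" "\<epsilon> * \<sigma> = real (a + 2 * N)" using \<epsilon> by (auto simp: \<sigma>_def)
  have "(\<lambda>m. norm (zeta_term N Q P \<mu> s m)) summable_on pos_tuples N" if s: "\<forall>t. Re (s $ t) > \<sigma>" for s
  proof -
    let ?p = "\<lambda>t m. peval (P t) (\<lambda>i. real (m i))"
    have Ppos: "?p t m > 0" if "m \<in> pos_tuples N" for t m
      by (intro hypoelliptic_pos[OF P] pos_tuples_ge_1[OF that])
    have "\<exists>A R. A \<ge> 0 \<and> (\<forall>m\<in>pos_tuples N. R \<le> real (wt N m) \<longrightarrow> ?p t m powr (- Re (s $ t)) \<le> A)" for t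
    proof (cases "\<exists>c. P t = Const c")
      case True
      then obtain c where "P t = Const c" by blast
      then show ?thesis by (intro exI[of _ "c powr (- Re (s $ t))"]) auto
    next
      case False
      then have "little_o N 1 (P t)" using hypoelliptic_little_o_1[OF P] by blast
      then obtain R where R: "\<And>x::nat \<Rightarrow> real. (\<forall>n\<in>{1..N}. 1 \<le> x n) \<Longrightarrow> R \<le> (\<Sum>n=1..N. x n) \<Longrightarrow> \<bar>peval 1 x\<bar> \<le> 1 * peval (P t) x"
        unfolding little_o_def by (metis zero_less_one)
      have "?p t m powr (- Re (s $ t)) \<le> 1" if m: "m \<in> pos_tuples N" "R \<le> real (wt N m)" for m
      proof -
        have "1 \<le> ?p t m" using R[of "\<lambda>i. real (m i)"] pos_tuples_ge_1[OF m(1)] m(2) by (simp add: real_wt)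
        moreover have "Re (s $ t) \<ge> 0" using s[rule_format, of t] \<sigma>(1) by linarith
        ultimately have "?p t m powr (- Re (s $ t)) \<le> ?p t m powr 0" by (intro powr_mono) auto
        also have "\<dots> \<le> 1" by simp
        finally show ?thesis .
      qed
      then show ?thesis by (intro exI[of _ 1] exI[of _ R]) auto
    qed
    then obtain A R' where A: "\<And>t. A t \<ge> 0" "\<And>t m. m \<in> pos_tuples N \<Longrightarrow> R' t \<le> real (wt N m) \<Longrightarrow> ?p t m powr (- Re (s $ t)) \<le> A t"
      by metis
    define R1 where "R1 = \<bar>R\<bar> + (\<Sum>t\<in>UNIV. \<bar>R' t\<bar>)"
    define B where "B = C * (\<Prod>t\<in>UNIV - {t0}. A t)"
    have B: "B \<ge> 0" unfolding B_def using C(1) A(1) by (intro mult_nonneg_nonneg prod_nonneg) auto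
    have large: "norm (zeta_term N Q P \<mu> s m) \<le> B * (1 / real (wt N m) ^ (2 * N))" if m: "m \<in> pos_tuples N" "R1 \<le> real (wt N m)" for m
    proof -
      define X where "X = real (wt N m)"
      have X1: "X \<ge> 1" using wt_ge_1[OF m(1) N] by (simp add: X_def)
      have sn: "(\<Sum>t\<in>UNIV. \<bar>R' t\<bar>) \<ge> 0" by (simp add: sum_nonneg)
      have RX: "R \<le> X" using m(2) sn unfolding R1_def X_def by linarith
      have R'X: "R' t \<le> X" for t
      proof -
        have "\<bar>R' t\<bar> \<le> (\<Sum>t\<in>UNIV. \<bar>R' t\<bar>)" by (rule member_le_sum) auto
        then show ?thesis using m(2) unfolding R1_def X_def by linarith
      qed
      have "1 \<le> ?p t0 m * X powr (- \<epsilon>)"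
        using R[of "\<lambda>i. real (m i)"] pos_tuples_ge_1[OF m(1)] RX by (simp add: real_wt X_def)
      then have low: "X powr \<epsilon> \<le> ?p t0 m" using X1 by (simp add: powr_minus field_simps)
      have X\<epsilon>: "X powr \<epsilon> \<ge> 1" using X1 \<epsilon> by (intro ge_one_powr_ge_zero) auto
      have "?p t0 m powr (- Re (s $ t0)) \<le> ?p t0 m powr (- \<sigma>)"
        using s[rule_format, of t0] low X\<epsilon> by (intro powr_mono) auto
      also have "\<dots> \<le> (X powr \<epsilon>) powr (- \<sigma>)"
        using low X\<epsilon> \<sigma>(1) by (intro powr_mono2') auto
      also have "\<dots> = 1 / X ^ (a + 2 * N)"
        using X1 by (simp only: powr_powr mult_minus_right \<sigma>(2) powr_minus powr_realpow inverse_eq_divide)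
      finally have t0: "?p t0 m powr (- Re (s $ t0)) \<le> 1 / X ^ (a + 2 * N)" .
      have "(\<Prod>t\<in>UNIV. ?p t m powr (- Re (s $ t))) = ?p t0 m powr (- Re (s $ t0)) * (\<Prod>t\<in>UNIV - {t0}. ?p t m powr (- Re (s $ t)))"
        by (rule prod.remove) auto
      also have "\<dots> \<le> 1 / X ^ (a + 2 * N) * (\<Prod>t\<in>UNIV - {t0}. A t)"
        using X1 by (intro mult_mono t0 prod_mono conjI A(2) m(1) prod_nonneg) (use R'X in \<open>auto simp: X_def\<close>)
      finally have pr: "(\<Prod>t\<in>UNIV. ?p t m powr (- Re (s $ t))) \<le> 1 / X ^ (a + 2 * N) * (\<Prod>t\<in>UNIV - {t0}. A t)" .
      have "norm (zeta_term N Q P \<mu> s m) = \<bar>peval Q (\<lambda>i. real (m i))\<bar> * (\<Prod>t\<in>UNIV. ?p t m powr (- Re (s $ t)))"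
        unfolding zeta_term_eq norm_mult norm_mu_power[OF \<mu>] using norm_summand[OF P m(1)] by simp
      also have "\<dots> \<le> (C * X ^ a) * (1 / X ^ (a + 2 * N) * (\<Prod>t\<in>UNIV - {t0}. A t))"
        using C(1) X1 C(2)[OF m(1)] by (intro mult_mono pr prod_nonneg) (auto simp: X_def)
      also have "\<dots> = B * (1 / X ^ (2 * N))" using X1 by (simp add: B_def power_add)
      finally show ?thesis by (simp add: X_def)
    qed
    define S where "S = {m \<in> pos_tuples N. wt N m \<le> nat \<lceil>R1\<rceil>}"
    have finS: "finite S" unfolding S_def by (rule finite_wt_le)
    \<comment> \<open>The finitely many tuples of small weight are absorbed into the constant, so
      that one bound holds for all tuples.\<close>
    define B' where "B' = B + (\<Sum>m\<in>S. norm (zeta_term N Q P \<mu> s m) * real (wt N m) ^ (2 * N))"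
    have sB: "(\<Sum>m\<in>S. norm (zeta_term N Q P \<mu> s m) * real (wt N m) ^ (2 * N)) \<ge> 0" by (intro sum_nonneg) auto
    have "norm (zeta_term N Q P \<mu> s m) \<le> B' * (1 / real (wt N m) ^ (2 * N))" if m: "m \<in> pos_tuples N" for m
    proof (cases "m \<in> S")
      case True
      have X: "real (wt N m) ^ (2 * N) > 0" using wt_ge_1[OF m N] by simp
      have "norm (zeta_term N Q P \<mu> s m) * real (wt N m) ^ (2 * N) \<le> B'"
        unfolding B'_def using member_le_sum[OF True, of "\<lambda>m. norm (zeta_term N Q P \<mu> s m) * real (wt N m) ^ (2 * N)"] finS B by simp
      then show ?thesis using X by (simp add: pos_le_divide_eq)
    next
      case False
      then have "R1 \<le> real (wt N m)" using m unfolding S_def by simp linarith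
      from large[OF m this] have "norm (zeta_term N Q P \<mu> s m) \<le> B * (1 / real (wt N m) ^ (2 * N))" .
      also have "\<dots> \<le> B' * (1 / real (wt N m) ^ (2 * N))" using sB by (intro mult_right_mono) (auto simp: B'_def)
      finally show ?thesis .
    qed
    then show ?thesis
      by (rule Infinite_Sum.abs_summable_on_comparison_test'[OF summable_on_cmult_right[OF summable_on_wt_power], of _ _ B'])
  qed
  then show ?thesis by blast
qed

text \<open>The entire Abel limit equals the sum wherever the series converges absolutely, and by
  uniqueness it is the continuation. Values of \<open>zeta\<close> can from here on be computed as
  Abel limits, at every s.\<close>

lemma zeta_continues_abel:
  fixes P :: "'t::finite \<Rightarrow> mpoly"
  assumes \<mu>: "\<forall>n\<in>{1..N}. norm (\<mu> n) = 1 \<and> \<mu> n \<noteq> 1" and Q: "Q \<in> polys N" and P: "\<And>t. hypoelliptic N (P t)"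
    and o: "little_o N 1 (P t0)"
  shows zeta_continues: "continues_series (pos_tuples N) (zeta_term N Q P \<mu>) (zeta N Q P \<mu>)"
    and zeta_abel: "abel (pos_tuples N) (wt N) (zeta_term N Q P \<mu> s) (zeta N Q P \<mu> s)"
proof -
  obtain F where F: "entire F" "\<And>s. abel (pos_tuples N) (wt N) (zeta_term N Q P \<mu> s) (F s)"
    using ex_entire_abel_limit[where P = P, OF \<mu> Q P] by blast
  obtain \<sigma> where \<sigma>: "\<And>s. (\<forall>t. Re (s $ t) > \<sigma>) \<Longrightarrow> (\<lambda>m. norm (zeta_term N Q P \<mu> s m)) summable_on pos_tuples N"
    using ex_abs_convergence[of N \<mu> Q P t0, OF _ Q P o] \<mu> by blast
  have c: "continues_series (pos_tuples N) (zeta_term N Q P \<mu>) F"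
    unfolding continues_series_def
  proof (intro conjI F(1) exI[of _ \<sigma>] allI impI)
    fix s :: "complex^'t" assume s: "\<forall>t. Re (s $ t) > \<sigma>"
    show "(\<lambda>m. norm (zeta_term N Q P \<mu> s m)) summable_on pos_tuples N" by (rule \<sigma>[OF s])
    have "F s = (\<Sum>\<^sub>\<infinity>m\<in>pos_tuples N. zeta_term N Q P \<mu> s m)"
      by (rule abel_unique[OF F(2) abel_of_summable[OF \<sigma>[OF s]]])
    then show "(zeta_term N Q P \<mu> s has_sum F s) (pos_tuples N)"
      using abs_summable_summable[OF \<sigma>[OF s]] by simp
  qed
  have "zeta N Q P \<mu> = F" unfolding zeta_def by (rule continuation_eqI[OF c])
  then show "continues_series (pos_tuples N) (zeta_term N Q P \<mu>) (zeta N Q P \<mu>)"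
    "abel (pos_tuples N) (wt N) (zeta_term N Q P \<mu> s) (zeta N Q P \<mu> s)" using c F(2) by auto
qed

section \<open>Images and disjoint unions of index sets\<close>

lemma continues_series_image:
  fixes F :: "complex ^ 't::finite \<Rightarrow> complex"
  assumes F: "continues_series A g F" and inj: "inj_on h A" and eq: "\<And>s d. d \<in> A \<Longrightarrow> f s (h d) = c * g s d"
  shows "continues_series (h ` A) f (\<lambda>s. c * F s)"
proof -
  obtain \<sigma> where \<sigma>: "entire F" "\<And>s :: complex^'t. (\<forall>t. Re (s $ t) > \<sigma>) \<Longrightarrow> (\<lambda>m. norm (g s m)) summable_on A \<and> (g s has_sum F s) A"
    using F unfolding continues_series_def by blast
  show ?thesis unfolding continues_series_def
  proof (intro conjI exI[of _ \<sigma>] allI impI)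
    show "entire (\<lambda>s. c * F s)" using \<sigma>(1) unfolding entire_iff_holo_at by (blast intro: holo_at_cmult)
  next
    fix s :: "complex^'t" assume s: "\<forall>t. Re (s $ t) > \<sigma>"
    have "(\<lambda>d. norm c * norm (g s d)) summable_on A" by (intro summable_on_cmult_right) (use \<sigma>(2)[OF s] in blast)
    then have "(\<lambda>d. norm (f s (h d))) summable_on A" by (rule summable_on_cong[THEN iffD1, rotated]) (simp add: eq norm_mult)
    then show "(\<lambda>m. norm (f s m)) summable_on h ` A" by (subst summable_on_reindex[OF inj]) (simp add: o_def)
    have "((\<lambda>d. c * g s d) has_sum (c * F s)) A" by (intro has_sum_cmult_right) (use \<sigma>(2)[OF s] in blast)
    then have "((\<lambda>d. f s (h d)) has_sum (c * F s)) A" by (rule has_sum_cong[THEN iffD1, rotated]) (simp add: eq)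
    then show "(f s has_sum (c * F s)) (h ` A)" by (subst has_sum_reindex[OF inj]) (simp add: o_def)
  qed
qed

lemma continues_series_UN:
  fixes F :: "'j \<Rightarrow> complex ^ 't::finite \<Rightarrow> complex"
  assumes fin: "finite J" and F: "\<And>j. j \<in> J \<Longrightarrow> continues_series (B j) f (F j)"
    and disj: "\<And>i j. i \<in> J \<Longrightarrow> j \<in> J \<Longrightarrow> i \<noteq> j \<Longrightarrow> B i \<inter> B j = {}"
  shows "continues_series (\<Union>j\<in>J. B j) f (\<lambda>s. \<Sum>j\<in>J. F j s)"
proof -
  have "\<forall>j\<in>J. \<exists>\<sigma>. \<forall>s. (\<forall>t. Re (s $ t) > \<sigma>) \<longrightarrow> (\<lambda>m. norm (f s m)) summable_on B j \<and> (f s has_sum F j s) (B j)"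
    using F unfolding continues_series_def by blast
  from bchoice[OF this] obtain \<sigma> where \<sigma>: "\<And>j s. j \<in> J \<Longrightarrow> (\<forall>t. Re (s $ t) > \<sigma> j) \<Longrightarrow> (\<lambda>m. norm (f s m)) summable_on B j \<and> (f s has_sum F j s) (B j)"
    by blast
  define \<sigma>0 where "\<sigma>0 = (\<Sum>j\<in>J. \<bar>\<sigma> j\<bar>)"
  have le: "\<sigma> j \<le> \<sigma>0" if "j \<in> J" for j
    using member_le_sum[OF that, of "\<lambda>j. \<bar>\<sigma> j\<bar>"] fin by (simp add: \<sigma>0_def)
  show ?thesis unfolding continues_series_def
  proof (intro conjI exI[of _ \<sigma>0] allI impI)
    show "entire (\<lambda>s. \<Sum>j\<in>J. F j s)"
      using F unfolding continues_series_def entire_iff_holo_at by (blast intro: holo_at_sum)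
  next
    fix s :: "complex^'t" assume s: "\<forall>t. Re (s $ t) > \<sigma>0"
    have *: "(\<lambda>m. norm (f s m)) summable_on B j \<and> (f s has_sum F j s) (B j)" if "j \<in> J" for j
      by (rule \<sigma>[OF that]) (use s le[OF that] in \<open>auto intro: le_less_trans\<close>)
    show "(\<lambda>m. norm (f s m)) summable_on (\<Union>j\<in>J. B j)"
      by (rule summable_on_finite_union_disjoint[OF fin _ disj]) (use * in auto)
    show "(f s has_sum (\<Sum>j\<in>J. F j s)) (\<Union>j\<in>J. B j)"
      by (rule sum_has_sum[OF fin _ disj]) (use * in auto)
  qed
qed

text \<open>The embedding may raise the weight by a constant \<open>k\<close>: the extra factor
  \<open>r ^ k\<close> tends to 1 and leaves the limit unchanged.\<close>

lemma abel_image: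
  assumes L: "abel A w' g L" and inj: "inj_on h A" and eq: "\<And>d. d \<in> A \<Longrightarrow> f (h d) = c * g d"
    and w: "\<And>d. d \<in> A \<Longrightarrow> w (h d) = k + w' d"
  shows "abel (h ` A) w f (c * L)"
  unfolding abel_def
proof (intro conjI allI impI)
  have eq': "of_real r ^ w (h d) * f (h d) = of_real r ^ k * c * (of_real r ^ w' d * g d)" if "d \<in> A" for r :: real and d
    using that by (simp add: eq w power_add)
  fix r :: real assume r: "0 < r \<and> r < 1"
  have "(\<lambda>d. norm (of_real r ^ k * c) * norm (of_real r ^ w' d * g d)) summable_on A"
    by (intro summable_on_cmult_right) (use L r in \<open>auto simp: abel_def\<close>)
  then have "(\<lambda>d. norm (of_real r ^ w (h d) * f (h d))) summable_on A"
    by (rule summable_on_cong[THEN iffD1, rotated]) (simp only: eq' norm_mult)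
  then show "(\<lambda>m. norm (of_real r ^ w m * f m)) summable_on h ` A"
    by (subst summable_on_reindex[OF inj]) (simp add: o_def)
next
  have eq': "of_real r ^ w (h d) * f (h d) = of_real r ^ k * c * (of_real r ^ w' d * g d)" if "d \<in> A" for r :: real and d
    using that by (simp add: eq w power_add)
  have "(\<Sum>\<^sub>\<infinity>m\<in>h ` A. of_real r ^ w m * f m) = of_real r ^ k * c * (\<Sum>\<^sub>\<infinity>d\<in>A. of_real r ^ w' d * g d)" for r :: real
  proof -
    have "(\<Sum>\<^sub>\<infinity>m\<in>h ` A. of_real r ^ w m * f m) = (\<Sum>\<^sub>\<infinity>d\<in>A. of_real r ^ w (h d) * f (h d))"
      by (subst infsum_reindex[OF inj]) (simp add: o_def)
    also have "\<dots> = (\<Sum>\<^sub>\<infinity>d\<in>A. of_real r ^ k * c * (of_real r ^ w' d * g d))"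
      by (intro infsum_cong eq')
    also have "\<dots> = of_real r ^ k * c * (\<Sum>\<^sub>\<infinity>d\<in>A. of_real r ^ w' d * g d)" by (rule infsum_cmult_right')
    finally show ?thesis .
  qed
  moreover have "((\<lambda>r. of_real r ^ k * c * (\<Sum>\<^sub>\<infinity>d\<in>A. of_real r ^ w' d * g d)) \<longlongrightarrow> of_real 1 ^ k * c * L) (at_left (1::real))"
    using L unfolding abel_def by (intro tendsto_intros) auto
  ultimately show "((\<lambda>r. \<Sum>\<^sub>\<infinity>m\<in>h ` A. of_real r ^ w m * f m) \<longlongrightarrow> c * L) (at_left (1::real))" by simp
qed

lemma abel_UN:
  assumes fin: "finite J" and F: "\<And>j. j \<in> J \<Longrightarrow> abel (B j) w f (L j)"
    and disj: "\<And>i j. i \<in> J \<Longrightarrow> j \<in> J \<Longrightarrow> i \<noteq> j \<Longrightarrow> B i \<inter> B j = {}"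
  shows "abel (\<Union>j\<in>J. B j) w f (\<Sum>j\<in>J. L j)"
  unfolding abel_def
proof (intro conjI allI impI)
  fix r :: real assume r: "0 < r \<and> r < 1"
  show "(\<lambda>m. norm (of_real r ^ w m * f m)) summable_on (\<Union>j\<in>J. B j)"
    by (rule summable_on_finite_union_disjoint[OF fin _ disj]) (use F r in \<open>auto simp: abel_def\<close>)
next
  have "((\<lambda>r. \<Sum>j\<in>J. \<Sum>\<^sub>\<infinity>m\<in>B j. of_real r ^ w m * f m) \<longlongrightarrow> (\<Sum>j\<in>J. L j)) (at_left (1::real))"
    using F unfolding abel_def by (intro tendsto_sum) auto
  then show "((\<lambda>r. \<Sum>\<^sub>\<infinity>m\<in>(\<Union>j\<in>J. B j). of_real r ^ w m * f m) \<longlongrightarrow> (\<Sum>j\<in>J. L j)) (at_left (1::real))"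
    by (rule Lim_transform_eventually)
       (intro eventually_at_left_1 sum_infsum[OF fin _ disj] abel_summable_on[OF F]; assumption)
qed

lemma abel_Un:
  assumes "abel A w f L" "abel B w f L'" "A \<inter> B = {}"
  shows "abel (A \<union> B) w f (L + L')"
proof -
  have "abel (\<Union>j\<in>{True, False}. if j then A else B) w f (\<Sum>j\<in>{True, False}. if j then L else L')"
    by (rule abel_UN) (use assms in auto)
  then show ?thesis by (simp add: Un_commute)
qed

section \<open>Faces of the orthant\<close>

definition embed :: "nat \<Rightarrow> (nat \<Rightarrow> nat) \<Rightarrow> nat set \<Rightarrow> (nat \<Rightarrow> nat) \<Rightarrow> (nat \<Rightarrow> nat) \<Rightarrow> nat \<Rightarrow> nat" where
  "embed N a I b d = restrict (restrict_point a I b d) {1..N}"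

text \<open>The set \<open>I\<close> collects the coordinates with m_i > a_i and \<open>b\<close>
  the values of the others. That \<open>I\<close> is a proper subset expresses that some coordinate
  is at most its bound, and \<open>I = {}\<close> gives single tuples. Values start at 1 since
  tuples have positive entries.\<close>

definition faces :: "nat \<Rightarrow> (nat \<Rightarrow> nat) \<Rightarrow> (nat set \<times> (nat \<Rightarrow> nat)) set" where
  "faces N a = (SIGMA I:{I. I \<subseteq> {1..N} \<and> card I < N}. \<Pi>\<^sub>E i\<in>{1..N} - I. {1..a i})"

lemma finite_faces: "finite (faces N a)"
  unfolding faces_def
proof (rule finite_SigmaI)
  show "finite {I. I \<subseteq> {1..N} \<and> card I < N}" by (rule finite_subset[of _ "Pow {1..N}"]) auto
qed (auto intro: finite_PiE)

text \<open>On the face m_i = a_i + d_k for the k-th element i of \<open>I\<close>, so besides the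
  fixed coordinates also \<open>\<mu> i ^ a i\<close> for i in \<open>I\<close> splits off as a
  constant.\<close>

lemma embed_zeta_term:
  fixes P :: "'t::finite \<Rightarrow> mpoly"
  assumes I: "I \<subseteq> {1..N}" and Q: "Q \<in> polys N" and P: "\<And>t. P t \<in> polys N"
  shows "zeta_term N Q P \<mu> s (embed N a I b d) =
    ((\<Prod>i\<in>I. \<mu> i ^ a i) * (\<Prod>i\<in>{1..N} - I. \<mu> i ^ b i)) *
      zeta_term (card I) (restrict_poly a I b Q) (\<lambda>t. restrict_poly a I b (P t)) (\<lambda>n. \<mu> (idx I n)) s d"
proof -
  have fin: "finite I" using I finite_subset by blast
  have pe: "peval p (\<lambda>n. real (embed N a I b d n)) = peval (restrict_poly a I b p) (\<lambda>n. real (d n))" if "p \<in> polys N" for p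
    unfolding peval_restrict_point
    by (rule peval_cong[OF that]) (auto simp: embed_def restrict_point_def)
  have "mu_power N \<mu> (embed N a I b d) = (\<Prod>i\<in>I. \<mu> i ^ embed N a I b d i) * (\<Prod>i\<in>{1..N} - I. \<mu> i ^ embed N a I b d i)"
    unfolding mu_power_def using I by (simp add: prod.subset_diff[of I] mult.commute)
  also have "(\<Prod>i\<in>{1..N} - I. \<mu> i ^ embed N a I b d i) = (\<Prod>i\<in>{1..N} - I. \<mu> i ^ b i)"
    by (intro prod.cong) (auto simp: embed_def restrict_point_def)
  also have "(\<Prod>i\<in>I. \<mu> i ^ embed N a I b d i) = (\<Prod>i\<in>I. \<mu> i ^ a i) * (\<Prod>i\<in>I. \<mu> i ^ d (card {j\<in>I. j \<le> i}))"
    unfolding prod.distrib[symmetric] using I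
    by (intro prod.cong) (auto simp: embed_def restrict_point_def power_add)
  also have "(\<Prod>i\<in>I. \<mu> i ^ d (card {j\<in>I. j \<le> i})) = (\<Prod>k\<in>{1..card I}. \<mu> (idx I k) ^ d (card {j\<in>I. j \<le> idx I k}))"
    by (rule prod.reindex_bij_betw[OF bij_betw_idx[OF fin], symmetric])
  also have "\<dots> = mu_power (card I) (\<lambda>n. \<mu> (idx I n)) d"
    unfolding mu_power_def by (intro prod.cong refl) (simp only: card_le_idx[OF fin])
  finally show ?thesis unfolding zeta_term_eq summand_def using pe[OF Q] pe[OF P] by simp
qed

lemma wt_embed:
  assumes I: "I \<subseteq> {1..N}"
  shows "wt N (embed N a I b d) = ((\<Sum>i\<in>I. a i) + (\<Sum>i\<in>{1..N} - I. b i)) + wt (card I) d"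
proof -
  have fin: "finite I" using I finite_subset by blast
  have "wt N (embed N a I b d) = (\<Sum>i\<in>I. embed N a I b d i) + (\<Sum>i\<in>{1..N} - I. embed N a I b d i)"
    unfolding wt_def using I by (simp add: sum.subset_diff[of I] add.commute)
  also have "(\<Sum>i\<in>{1..N} - I. embed N a I b d i) = (\<Sum>i\<in>{1..N} - I. b i)"
    by (intro sum.cong) (auto simp: embed_def restrict_point_def)
  also have "(\<Sum>i\<in>I. embed N a I b d i) = (\<Sum>i\<in>I. a i) + (\<Sum>i\<in>I. d (card {j\<in>I. j \<le> i}))"
    unfolding sum.distrib[symmetric] using I
    by (intro sum.cong) (auto simp: embed_def restrict_point_def)
  also have "(\<Sum>i\<in>I. d (card {j\<in>I. j \<le> i})) = (\<Sum>k\<in>{1..card I}. d (card {j\<in>I. j \<le> idx I k}))"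
    by (rule sum.reindex_bij_betw[OF bij_betw_idx[OF fin], symmetric])
  also have "\<dots> = wt (card I) d"
    unfolding wt_def by (intro sum.cong refl) (simp only: card_le_idx[OF fin])
  finally show ?thesis by simp
qed

lemma inj_on_embed:
  assumes I: "I \<subseteq> {1..N}"
  shows "inj_on (embed N a I b) (pos_tuples (card I))"
proof (rule inj_onI)
  fix x y assume xy: "x \<in> pos_tuples (card I)" "y \<in> pos_tuples (card I)" and eq: "embed N a I b x = embed N a I b y"
  have fin: "finite I" using I finite_subset by blast
  show "x = y"
  proof
    fix k show "x k = y k"
    proof (cases "k \<in> {1..card I}")
      case True
      have "idx I k \<in> {1..N}" using idx_in[OF fin True] I by blast
      then show ?thesis using fun_cong[OF eq, of "idx I k"] idx_props[OF fin True] by (simp add: embed_def restrict_point_def)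
    next
      case False
      then show ?thesis using xy by (auto simp: pos_tuples_def PiE_iff extensional_def)
    qed
  qed
qed

text \<open>A tuple determines its face: \<open>I\<close> is recovered as the set of coordinates
  above \<open>a\<close>, and \<open>b\<close> by restriction. Hence the faces are disjoint.\<close>

lemma embed_gt_iff:
  assumes f: "(I, b) \<in> faces N a" and d: "d \<in> pos_tuples (card I)"
  shows "{i \<in> {1..N}. embed N a I b d i > a i} = I" "restrict (embed N a I b d) ({1..N} - I) = b"
    "embed N a I b d \<in> E_set N a"
proof -
  have I: "I \<subseteq> {1..N}" "card I < N" and b: "b \<in> (\<Pi>\<^sub>E i\<in>{1..N} - I. {1..a i})" using f by (auto simp: faces_def)
  have fin: "finite I" using I finite_subset by blast
  have bi: "1 \<le> b i \<and> b i \<le> a i" if "i \<in> {1..N} - I" for i using b that by (auto simp: PiE_iff)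
  have in_I: "embed N a I b d i > a i" if "i \<in> I" for i
    using pos_tuplesD[OF d idx_card_le(2)[OF fin that]] that I(1) by (auto simp: embed_def restrict_point_def)
  have notin_I: "embed N a I b d i = b i" if "i \<in> {1..N} - I" for i
    using that by (simp add: embed_def restrict_point_def)
  show "{i \<in> {1..N}. embed N a I b d i > a i} = I"
  proof (intro equalityI subsetI)
    fix i assume i: "i \<in> {i \<in> {1..N}. embed N a I b d i > a i}"
    show "i \<in> I"
    proof (rule ccontr)
      assume "i \<notin> I"
      then have "i \<in> {1..N} - I" using i by blast
      then show False using notin_I bi[of i] i by fastforce
    qed
  qed (use in_I I in auto)
  show "restrict (embed N a I b d) ({1..N} - I) = b"
  proof
    fix i show "restrict (embed N a I b d) ({1..N} - I) i = b i"
      using notin_I[of i] b by (cases "i \<in> {1..N} - I") (auto simp: PiE_iff extensional_def)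
  qed
  have "embed N a I b d i \<ge> 1" if "i \<in> {1..N}" for i
    using in_I[of i] notin_I[of i] bi[of i] that by (cases "i \<in> I") auto
  then have pos: "embed N a I b d \<in> pos_tuples N"
    by (auto simp: pos_tuples_def PiE_iff embed_def)
  have "{1..N} - I \<noteq> {}"
  proof
    assume "{1..N} - I = {}"
    then have "I = {1..N}" using I(1) by blast
    then show False using I(2) by simp
  qed
  then obtain i where i: "i \<in> {1..N} - I" by blast
  then have "embed N a I b d i \<le> a i" using notin_I bi by simp
  then show "embed N a I b d \<in> E_set N a" using pos i unfolding E_set_def by blast
qed

lemma E_set_eq: "E_set N a = (\<Union>(I, b)\<in>faces N a. embed N a I b ` pos_tuples (card I))"
proof (intro equalityI subsetI)
  fix m assume m: "m \<in> E_set N a"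
  then have mp: "m \<in> pos_tuples N" and ex: "\<exists>n\<in>{1..N}. m n \<le> a n" by (auto simp: E_set_def)
  define I where "I = {i \<in> {1..N}. m i > a i}"
  have I: "I \<subseteq> {1..N}" by (auto simp: I_def)
  have fin: "finite I" using I finite_subset by blast
  obtain n where "n \<in> {1..N}" "m n \<le> a n" using ex by blast
  then have "n \<in> {1..N} - I" by (simp add: I_def)
  then have "I \<subset> {1..N}" using I by blast
  then have "card I < card {1..N}" by (intro psubset_card_mono) auto
  then have card: "card I < N" by simp
  define b where "b = restrict m ({1..N} - I)"
  have b: "b \<in> (\<Pi>\<^sub>E i\<in>{1..N} - I. {1..a i})"
    using pos_tuplesD[OF mp] by (auto simp: b_def I_def not_less)
  define d where "d = restrict (\<lambda>k. m (idx I k) - a (idx I k)) {1..card I}"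
  have d: "d \<in> pos_tuples (card I)"
  proof -
    have "m (idx I k) > a (idx I k)" if "k \<in> {1..card I}" for k using idx_in[OF fin that] by (simp add: I_def)
    then show ?thesis by (auto simp: pos_tuples_def d_def Suc_le_eq)
  qed
  have "m = embed N a I b d"
  proof
    fix i
    show "m i = embed N a I b d i"
    proof (cases "i \<in> {1..N}")
      case False then show ?thesis using mp by (auto simp: embed_def pos_tuples_def PiE_iff extensional_def)
    next
      case True
      show ?thesis
      proof (cases "i \<in> I")
        case False then show ?thesis using True by (simp add: embed_def restrict_point_def b_def)
      next
        case iI: True
        then have "m i > a i" by (simp add: I_def)
        then show ?thesis using True iI idx_card_le[OF fin iI] by (simp add: embed_def restrict_point_def d_def)
      qed
    qed
  qed
  moreover have "(I, b) \<in> faces N a" using I card b by (simp add: faces_def)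
  ultimately show "m \<in> (\<Union>(I, b)\<in>faces N a. embed N a I b ` pos_tuples (card I))" using d by blast
next
  fix m assume "m \<in> (\<Union>(I, b)\<in>faces N a. embed N a I b ` pos_tuples (card I))"
  then show "m \<in> E_set N a" using embed_gt_iff(3) by blast
qed

lemma faces_disjoint:
  assumes "p \<in> faces N a" "p' \<in> faces N a" "p \<noteq> p'"
  shows "(case p of (I, b) \<Rightarrow> embed N a I b ` pos_tuples (card I)) \<inter> (case p' of (I, b) \<Rightarrow> embed N a I b ` pos_tuples (card I)) = {}"
proof -
  obtain I b I' b' where p: "p = (I, b)" "p' = (I', b')" by (cases p, cases p')
  have False if "d \<in> pos_tuples (card I)" "d' \<in> pos_tuples (card I')" "embed N a I b d = embed N a I' b' d'" for d d'
    using embed_gt_iff(1,2)[of I b N a d] embed_gt_iff(1,2)[of I' b' N a d'] that assms p by metis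
  then show ?thesis unfolding p by auto
qed

section \<open>Values at negative integers\<close>

lemma summand_neg_point:
  fixes P :: "'t::finite \<Rightarrow> mpoly"
  assumes "\<And>t. peval (P t) (\<lambda>i. real (m i)) > 0"
  shows "summand Q P (neg_point k) m = of_real (peval Q (\<lambda>i. real (m i)) * (\<Prod>t\<in>UNIV. peval (P t) (\<lambda>i. real (m i)) ^ k t))"
proof -
  have "of_real (peval (P t) (\<lambda>i. real (m i))) powr (- (neg_point k $ t)) = of_real (peval (P t) (\<lambda>i. real (m i))) ^ k t" for t
    using assms[of t] powr_nat[of "of_real (peval (P t) (\<lambda>i. real (m i)))" "k t"] by (simp add: neg_point_def)
  then show ?thesis unfolding summand_def by simp
qed

lemma finite_le_fun: "finite {u :: 't::finite \<Rightarrow> nat. \<forall>t. u t \<le> k t}"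
proof -
  have "{u. \<forall>t. u t \<le> k t} = (\<Pi>\<^sub>E t\<in>UNIV. {..k t})" by (auto simp: PiE_UNIV_domain)
  then show ?thesis by (simp add: finite_PiE)
qed

lemma prod_binomial:
  fixes x y :: "'t::finite \<Rightarrow> real"
  shows "(\<Prod>t\<in>UNIV. (x t + y t) ^ k t) =
    (\<Sum>u\<in>{u. \<forall>t. u t \<le> k t}. real (\<Prod>t\<in>UNIV. k t choose u t) * ((\<Prod>t\<in>UNIV. x t ^ u t) * (\<Prod>t\<in>UNIV. y t ^ (k t - u t))))"
proof -
  have "(\<Prod>t\<in>UNIV. (x t + y t) ^ k t) = (\<Prod>t\<in>UNIV. \<Sum>j\<in>{..k t}. real (k t choose j) * x t ^ j * y t ^ (k t - j))"
    by (simp add: binomial_ring)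
  also have "\<dots> = (\<Sum>u\<in>(\<Pi>\<^sub>E t\<in>UNIV. {..k t}). \<Prod>t\<in>UNIV. real (k t choose u t) * x t ^ u t * y t ^ (k t - u t))"
    by (rule prod_sum_PiE) auto
  also have "(\<Pi>\<^sub>E t\<in>UNIV. {..k t}) = {u. \<forall>t. u t \<le> k t}" by (auto simp: PiE_UNIV_domain)
  finally show ?thesis by (simp add: prod.distrib mult.assoc)
qed

text \<open>At negative integers the summand is a polynomial value, so P(m + a) = P(m) +
  (\<Delta>P)(m) can be expanded by the binomial theorem in each factor. In the term u = k no power
  of a difference is left, and there Q(m + a) is split into Q and its difference.\<close>

lemma summand_shift:
  fixes P :: "'t::finite \<Rightarrow> mpoly"
  assumes pos: "\<And>t. peval (P t) (\<lambda>i. real (m i)) > 0" and pos': "\<And>t. peval (P t) (\<lambda>i. real (m i + a i)) > 0"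
  shows "summand Q P (neg_point k) (\<lambda>i. m i + a i) =
    (\<Sum>u\<in>{u. (\<forall>t. u t \<le> k t) \<and> u \<noteq> k}. of_nat (\<Prod>t\<in>UNIV. k t choose u t) *
       summand (shift_poly a Q * (\<Prod>t\<in>UNIV. diff_poly a (P t) ^ (k t - u t))) P (neg_point u) m)
    + (summand Q P (neg_point k) m + summand (diff_poly a Q) P (neg_point k) m)"
proof -
  let ?x = "\<lambda>i. real (m i)"
  let ?U = "{u. (\<forall>t. u t \<le> k t)}"
  have ps: "peval p (\<lambda>i. real (m i + a i)) = peval (shift_poly a p) ?x" for p
    by (simp add: peval_shift)
  have pd: "peval (shift_poly a p) ?x = peval p ?x + peval (diff_poly a p) ?x" for p
    by (simp add: diff_poly_def peval_diff)
  define T where "T u = real (\<Prod>t\<in>UNIV. k t choose u t) * (peval (shift_poly a Q) ?x *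
      ((\<Prod>t\<in>UNIV. peval (P t) ?x ^ u t) * (\<Prod>t\<in>UNIV. peval (diff_poly a (P t)) ?x ^ (k t - u t))))" for u
  have "summand Q P (neg_point k) (\<lambda>i. m i + a i) =
      of_real (peval (shift_poly a Q) ?x * (\<Prod>t\<in>UNIV. (peval (P t) ?x + peval (diff_poly a (P t)) ?x) ^ k t))"
    by (subst summand_neg_point[OF pos']) (simp only: ps pd[of "P _"])
  also have "peval (shift_poly a Q) ?x * (\<Prod>t\<in>UNIV. (peval (P t) ?x + peval (diff_poly a (P t)) ?x) ^ k t) = (\<Sum>u\<in>?U. T u)"
    unfolding prod_binomial sum_distrib_left T_def by (intro sum.cong refl) (simp only: mult_ac)
  also have "(\<Sum>u\<in>?U. T u) = T k + (\<Sum>u\<in>?U - {k}. T u)"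
    by (rule sum.remove[OF finite_le_fun]) simp
  also have "?U - {k} = {u. (\<forall>t. u t \<le> k t) \<and> u \<noteq> k}" by blast
  also have "T k = peval Q ?x * (\<Prod>t\<in>UNIV. peval (P t) ?x ^ k t) + peval (diff_poly a Q) ?x * (\<Prod>t\<in>UNIV. peval (P t) ?x ^ k t)"
    by (simp add: T_def pd[of Q] distrib_right)
  finally have "summand Q P (neg_point k) (\<lambda>i. m i + a i) =
      (\<Sum>u\<in>{u. (\<forall>t. u t \<le> k t) \<and> u \<noteq> k}. of_real (T u)) + (summand Q P (neg_point k) m + summand (diff_poly a Q) P (neg_point k) m)"
    by (simp add: summand_neg_point[OF pos])
  moreover have "of_real (T u) = of_nat (\<Prod>t\<in>UNIV. k t choose u t) *
       summand (shift_poly a Q * (\<Prod>t\<in>UNIV. diff_poly a (P t) ^ (k t - u t))) P (neg_point u) m" for u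
    unfolding summand_neg_point[OF pos] by (simp add: T_def peval_mult peval_prod peval_power mult_ac)
  ultimately show ?thesis by simp
qed

section \<open>Translation of the index set by a\<close>

definition translate :: "nat \<Rightarrow> (nat \<Rightarrow> nat) \<Rightarrow> (nat \<Rightarrow> nat) \<Rightarrow> nat \<Rightarrow> nat" where
  "translate N a m = restrict (\<lambda>i. m i + a i) {1..N}"

lemma pos_tuples_eq_translate_Un: "pos_tuples N = translate N a ` pos_tuples N \<union> E_set N a"
proof (intro equalityI subsetI)
  fix m assume m: "m \<in> pos_tuples N"
  show "m \<in> translate N a ` pos_tuples N \<union> E_set N a"
  proof (cases "\<exists>n\<in>{1..N}. m n \<le> a n")
    case True then show ?thesis using m by (auto simp: E_set_def)
  next
    case False
    define d where "d = restrict (\<lambda>i. m i - a i) {1..N}"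
    have "d \<in> pos_tuples N" using False by (auto simp: pos_tuples_def d_def Suc_le_eq not_le)
    moreover have "m = translate N a d"
    proof
      fix i show "m i = translate N a d i"
      proof (cases "i \<in> {1..N}")
        case True
        then have "a i \<le> m i" using False by (meson le_cases)
        then show ?thesis using True by (simp add: translate_def d_def)
      next
        case False
        then show ?thesis using m by (auto simp: translate_def pos_tuples_def PiE_iff extensional_def)
      qed
    qed
    ultimately show ?thesis by blast
  qed
next
  fix m assume "m \<in> translate N a ` pos_tuples N \<union> E_set N a"
  then consider d where "m = translate N a d" "d \<in> pos_tuples N" | "m \<in> E_set N a" by blast
  then show "m \<in> pos_tuples N"
  proof cases
    case (1 d)
    have "1 \<le> d i + a i" if "i \<in> {1..N}" for i using pos_tuplesD[OF 1(2) that] by simp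
    then show ?thesis by (simp add: 1(1) pos_tuples_def translate_def)
  qed (simp add: E_set_def)
qed

lemma translate_disjoint: "translate N a ` pos_tuples N \<inter> E_set N a = {}"
proof -
  have False if "d \<in> pos_tuples N" "n \<in> {1..N}" "translate N a d n \<le> a n" for d n
    using that pos_tuplesD[OF that(1,2)] by (simp add: translate_def)
  then show ?thesis unfolding E_set_def by blast
qed

lemma inj_on_translate: "inj_on (translate N a) (pos_tuples N)"
proof (rule inj_onI)
  fix x y assume xy: "x \<in> pos_tuples N" "y \<in> pos_tuples N" and eq: "translate N a x = translate N a y"
  show "x = y"
  proof
    fix i show "x i = y i"
      using fun_cong[OF eq, of i] xy by (cases "i \<in> {1..N}") (auto simp: translate_def pos_tuples_def PiE_iff extensional_def)
  qed
qed

lemma mu_power_translate: "mu_power N \<mu> (translate N a m) = mu_power N \<mu> a * mu_power N \<mu> m"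
  unfolding mu_power_def prod.distrib[symmetric]
  by (intro prod.cong) (auto simp: translate_def power_add mult.commute)

lemma wt_translate: "wt N (translate N a m) = wt N a + wt N m"
  unfolding wt_def sum.distrib[symmetric] by (intro sum.cong) (auto simp: translate_def)

lemma summand_cong:
  assumes "Q \<in> polys N" "\<And>t. P t \<in> polys N" "\<And>i. i \<in> {1..N} \<Longrightarrow> m i = m' i"
  shows "summand Q P s m = summand Q P s m'"
proof -
  have "peval p (\<lambda>i. real (m i)) = peval p (\<lambda>i. real (m' i))" if "p \<in> polys N" for p
    by (rule peval_cong[OF that]) (use assms(3) in simp)
  then show ?thesis unfolding summand_def using assms(1,2) by simp
qed

text \<open>The decomposition of the sum over E(a) takes its form from the tuples: entries are
  positive, so fixed entries run from 1; tuples with all m_n \<le> a_n make up the faces with q = 0;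
  and m_i = a_i + d_k yields the factor \<mu>_i^{a_i} for i in \<open>I\<close>. The displayed
  English formula differs in these three points, as it starts with b_i = 0 and q = 1 and has no such
  factor. For N = 1 and a = 1, for example, E(a) is one tuple, and it is counted by q = 0.\<close>

theorem theorem1:
  fixes N :: nat
    and \<mu> :: "nat \<Rightarrow> complex"
    and Q :: mpoly
    and P :: "'t::finite \<Rightarrow> mpoly"
  assumes "N \<ge> 1"
    and "\<forall>n\<in>{1..N}. norm (\<mu> n) = 1 \<and> \<mu> n \<noteq> 1"
    and "Q \<in> polys N"
    and "\<forall>t. hypoelliptic N (P t)"
    and "\<exists>t. \<forall>c. P t \<noteq> Const c"
  shows "(\<exists>F. continues_series (pos_tuples N) (zeta_term N Q P \<mu>) F) \<and>
    (\<forall>a :: nat \<Rightarrow> nat.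
      (\<exists>F. continues_series (E_set N a) (zeta_term N Q P \<mu>) F) \<and>
      (\<forall>k :: 't \<Rightarrow> nat.
        (1 - mu_power N \<mu> a) * zeta N Q P \<mu> (neg_point k) =
          mu_power N \<mu> a *
            (\<Sum>u\<in>{u. (\<forall>t. u t \<le> k t) \<and> u \<noteq> k}.
               of_nat (\<Prod>t\<in>UNIV. k t choose u t) *
               zeta N (shift_poly a Q * (\<Prod>t\<in>UNIV. diff_poly a (P t) ^ (k t - u t))) P \<mu>
                 (neg_point u))
          + mu_power N \<mu> a * zeta N (diff_poly a Q) P \<mu> (neg_point k)
          + zeta_E N a Q P \<mu> (neg_point k)) \<and>
      (\<forall>s. zeta_E N a Q P \<mu> s =
        (\<Sum>q=0..N-1. \<Sum>I\<in>{I. I \<subseteq> {1..N} \<and> card I = q}.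
           \<Sum>b\<in>(\<Pi>\<^sub>E i\<in>{1..N} - I. {1..a i}).
             (\<Prod>i\<in>I. \<mu> i ^ a i) * (\<Prod>i\<in>{1..N} - I. \<mu> i ^ b i) *
             zeta q (restrict_poly a I b Q) (\<lambda>t. restrict_poly a I b (P t))
               (\<lambda>n. \<mu> (idx I n)) s)) \<and>
      (\<forall>q\<in>{0..N-1}. \<forall>I. I \<subseteq> {1..N} \<and> card I = q \<longrightarrow>
        (\<forall>b\<in>(\<Pi>\<^sub>E i\<in>{1..N} - I. {1..a i}).
           restrict_poly a I b Q \<in> polys q \<and>
           (\<forall>t. hypoelliptic q (restrict_poly a I b (P t))) \<and>
           (\<exists>F. continues_series (pos_tuples q)
              (zeta_term q (restrict_poly a I b Q) (\<lambda>t. restrict_poly a I b (P t))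
                 (\<lambda>n. \<mu> (idx I n))) F))))"
proof -
  note Q = \<open>Q \<in> polys N\<close>
  have \<mu>: "\<forall>n\<in>{1..N}. norm (\<mu> n) = 1 \<and> \<mu> n \<noteq> 1" by fact
  have P: "hypoelliptic N (P t)" for t using \<open>\<forall>t. hypoelliptic N (P t)\<close> by blast
  have Pp: "P t \<in> polys N" for t using P[of t] by (simp add: hypoelliptic_iff)
  obtain t0 where "\<forall>c. P t0 \<noteq> Const c" using \<open>\<exists>t. \<forall>c. P t \<noteq> Const c\<close> by blast
  then have o: "little_o N 1 (P t0)" by (rule hypoelliptic_little_o_1[OF P])
  have zc: "continues_series (pos_tuples N) (zeta_term N R P \<mu>) (zeta N R P \<mu>)"
    and za: "abel (pos_tuples N) (wt N) (zeta_term N R P \<mu> s) (zeta N R P \<mu> s)" if "R \<in> polys N" for R s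
    using zeta_continues[where P = P, OF \<mu> that P o] zeta_abel[where P = P, OF \<mu> that P o] by auto
  have Ppos: "peval (P t) (\<lambda>i. real (m i)) > 0" if "m \<in> pos_tuples N" for t m
    by (intro hypoelliptic_pos[OF P] pos_tuples_ge_1[OF that])
  have part: "(\<exists>F. continues_series (E_set N a) (zeta_term N Q P \<mu>) F) \<and>
      (\<forall>k :: 't \<Rightarrow> nat.
        (1 - mu_power N \<mu> a) * zeta N Q P \<mu> (neg_point k) =
          mu_power N \<mu> a *
            (\<Sum>u\<in>{u. (\<forall>t. u t \<le> k t) \<and> u \<noteq> k}.
               of_nat (\<Prod>t\<in>UNIV. k t choose u t) *
               zeta N (shift_poly a Q * (\<Prod>t\<in>UNIV. diff_poly a (P t) ^ (k t - u t))) P \<mu>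
                 (neg_point u))
          + mu_power N \<mu> a * zeta N (diff_poly a Q) P \<mu> (neg_point k)
          + zeta_E N a Q P \<mu> (neg_point k)) \<and>
      (\<forall>s. zeta_E N a Q P \<mu> s =
        (\<Sum>q=0..N-1. \<Sum>I\<in>{I. I \<subseteq> {1..N} \<and> card I = q}.
           \<Sum>b\<in>(\<Pi>\<^sub>E i\<in>{1..N} - I. {1..a i}).
             (\<Prod>i\<in>I. \<mu> i ^ a i) * (\<Prod>i\<in>{1..N} - I. \<mu> i ^ b i) *
             zeta q (restrict_poly a I b Q) (\<lambda>t. restrict_poly a I b (P t))
               (\<lambda>n. \<mu> (idx I n)) s)) \<and>
      (\<forall>q\<in>{0..N-1}. \<forall>I. I \<subseteq> {1..N} \<and> card I = q \<longrightarrow>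
        (\<forall>b\<in>(\<Pi>\<^sub>E i\<in>{1..N} - I. {1..a i}).
           restrict_poly a I b Q \<in> polys q \<and>
           (\<forall>t. hypoelliptic q (restrict_poly a I b (P t))) \<and>
           (\<exists>F. continues_series (pos_tuples q)
              (zeta_term q (restrict_poly a I b Q) (\<lambda>t. restrict_poly a I b (P t))
                 (\<lambda>n. \<mu> (idx I n))) F)))" for a :: "nat \<Rightarrow> nat"
  proof -
    let ?rP = "\<lambda>I b t. restrict_poly a I b (P t)"
    let ?\<mu> = "\<lambda>I n. \<mu> (idx I n)"
    have face: "restrict_poly a I b Q \<in> polys (card I) \<and> (\<forall>t. hypoelliptic (card I) (?rP I b t)) \<and>
        continues_series (pos_tuples (card I)) (zeta_term (card I) (restrict_poly a I b Q) (?rP I b) (?\<mu> I))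
          (zeta (card I) (restrict_poly a I b Q) (?rP I b) (?\<mu> I)) \<and>
        (\<forall>s. abel (pos_tuples (card I)) (wt (card I)) (zeta_term (card I) (restrict_poly a I b Q) (?rP I b) (?\<mu> I) s)
          (zeta (card I) (restrict_poly a I b Q) (?rP I b) (?\<mu> I) s))"
      if I: "I \<subseteq> {1..N}" and b: "b \<in> (\<Pi>\<^sub>E i\<in>{1..N} - I. {1..a i})" for I b
    proof -
      have fin: "finite I" using I finite_subset by blast
      have b1: "1 \<le> b i" if "i \<in> {1..N} - I" for i using PiE_mem[OF b that] by simp
      have rQ: "restrict_poly a I b Q \<in> polys (card I)" by (rule polys_restrict[OF I Q])
      have rP: "hypoelliptic (card I) (?rP I b t)" for t by (rule hypoelliptic_restrict[OF I b1 P])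
      have ro: "little_o (card I) 1 (?rP I b t0)" by (rule little_o_1_restrict[OF I b1 o])
      have r\<mu>: "\<forall>n\<in>{1..card I}. norm (?\<mu> I n) = 1 \<and> ?\<mu> I n \<noteq> 1"
        using idx_in[OF fin] I \<mu> by blast
      show ?thesis
        using rQ rP zeta_continues[of "card I" "?\<mu> I" _ "?rP I b", OF r\<mu> rQ rP ro]
          zeta_abel[of "card I" "?\<mu> I" _ "?rP I b", OF r\<mu> rQ rP ro] by blast
    qed
    define c where "c I b = (\<Prod>i\<in>I. \<mu> i ^ a i) * (\<Prod>i\<in>{1..N} - I. \<mu> i ^ b i)" for I b
    define Z where "Z I b = zeta (card I) (restrict_poly a I b Q) (?rP I b) (?\<mu> I)" for I b
    let ?piece = "\<lambda>p. case p of (I, b) \<Rightarrow> embed N a I b ` pos_tuples (card I)"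
    let ?val = "\<lambda>s p. case p of (I, b) \<Rightarrow> c I b * Z I b s"
    define FE where "FE s = (\<Sum>p\<in>faces N a. ?val s p)" for s
    have facesD: "fst p \<subseteq> {1..N}" "snd p \<in> (\<Pi>\<^sub>E i\<in>{1..N} - fst p. {1..a i})" if "p \<in> faces N a" for p
      using that by (auto simp: faces_def)
    have cE: "continues_series (E_set N a) (zeta_term N Q P \<mu>) FE"
      unfolding E_set_eq FE_def
    proof (rule continues_series_UN[OF finite_faces _ faces_disjoint])
      fix p assume p: "p \<in> faces N a"
      obtain I b where pIb: "p = (I, b)" by (cases p)
      have I: "I \<subseteq> {1..N}" and b: "b \<in> (\<Pi>\<^sub>E i\<in>{1..N} - I. {1..a i})" using facesD[OF p] pIb by auto
      show "continues_series (?piece p) (zeta_term N Q P \<mu>) (\<lambda>s. ?val s p)"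
        unfolding pIb prod.case Z_def
        by (rule continues_series_image[OF _ inj_on_embed[OF I]])
           (use face[OF I b] embed_zeta_term[OF I Q Pp] in \<open>auto simp: c_def\<close>)
    qed
    have aE: "abel (E_set N a) (wt N) (zeta_term N Q P \<mu> s) (FE s)" for s
      unfolding E_set_eq FE_def
    proof (rule abel_UN[OF finite_faces _ faces_disjoint])
      fix p assume p: "p \<in> faces N a"
      obtain I b where pIb: "p = (I, b)" by (cases p)
      have I: "I \<subseteq> {1..N}" and b: "b \<in> (\<Pi>\<^sub>E i\<in>{1..N} - I. {1..a i})" using facesD[OF p] pIb by auto
      show "abel (?piece p) (wt N) (zeta_term N Q P \<mu> s) (?val s p)"
        unfolding pIb prod.case Z_def
        by (rule abel_image[where w' = "wt (card I)" and k = "(\<Sum>i\<in>I. a i) + (\<Sum>i\<in>{1..N} - I. b i)"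
              and g = "zeta_term (card I) (restrict_poly a I b Q) (?rP I b) (?\<mu> I) s", OF _ inj_on_embed[OF I]])
           (use face[OF I b] embed_zeta_term[OF I Q Pp] wt_embed[OF I] in \<open>auto simp: c_def\<close>)
    qed
    have zE: "zeta_E N a Q P \<mu> = FE" unfolding zeta_E_def by (rule continuation_eqI[OF cE])
    have rel: "(1 - mu_power N \<mu> a) * zeta N Q P \<mu> (neg_point k) =
          mu_power N \<mu> a *
            (\<Sum>u\<in>{u. (\<forall>t. u t \<le> k t) \<and> u \<noteq> k}.
               of_nat (\<Prod>t\<in>UNIV. k t choose u t) *
               zeta N (shift_poly a Q * (\<Prod>t\<in>UNIV. diff_poly a (P t) ^ (k t - u t))) P \<mu> (neg_point u))
          + mu_power N \<mu> a * zeta N (diff_poly a Q) P \<mu> (neg_point k)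
          + zeta_E N a Q P \<mu> (neg_point k)" for k :: "'t \<Rightarrow> nat"
    proof -
      let ?U = "{u. (\<forall>t. u t \<le> k t) \<and> u \<noteq> k}"
      let ?Q = "\<lambda>u. shift_poly a Q * (\<Prod>t\<in>UNIV. diff_poly a (P t) ^ (k t - u t))"
      let ?S = "\<Sum>u\<in>?U. of_nat (\<Prod>t\<in>UNIV. k t choose u t) * zeta N (?Q u) P \<mu> (neg_point u)"
      have Qu: "?Q u \<in> polys N" for u
        by (intro polys_mult polys_shift polys_prod polys_power polys_diff_poly Q Pp)
      define g where "g m = (\<Sum>u\<in>?U. of_nat (\<Prod>t\<in>UNIV. k t choose u t) * zeta_term N (?Q u) P \<mu> (neg_point u) m)
          + (zeta_term N Q P \<mu> (neg_point k) m + zeta_term N (diff_poly a Q) P \<mu> (neg_point k) m)" for m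
      \<comment> \<open>The damped series for the right-hand side converge separately, and each
        limit is a value of the continuation.\<close>
      have ag: "abel (pos_tuples N) (wt N) g (?S + (zeta N Q P \<mu> (neg_point k) + zeta N (diff_poly a Q) P \<mu> (neg_point k)))"
        unfolding g_def by (intro abel_add abel_sum abel_cmult za Qu Q polys_diff_poly)
      have fg: "zeta_term N Q P \<mu> (neg_point k) (translate N a m) = mu_power N \<mu> a * g m" if m: "m \<in> pos_tuples N" for m
      proof -
        have "peval (P t) (\<lambda>i. real (m i + a i)) > 0" for t
        proof (rule hypoelliptic_pos[OF P])
          fix n assume "n \<in> {1..N}"
          from pos_tuplesD[OF m this] show "1 \<le> real (m n + a n)" by simp
        qed
        note sh = summand_shift[of P m a, OF Ppos[OF m] this]
        have "summand Q P (neg_point k) (translate N a m) = summand Q P (neg_point k) (\<lambda>i. m i + a i)"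
          by (rule summand_cong[OF Q Pp]) (simp add: translate_def)
        then have "zeta_term N Q P \<mu> (neg_point k) (translate N a m) =
            mu_power N \<mu> a * (mu_power N \<mu> m * summand Q P (neg_point k) (\<lambda>i. m i + a i))"
          by (simp add: zeta_term_eq mu_power_translate)
        also have "mu_power N \<mu> m * summand Q P (neg_point k) (\<lambda>i. m i + a i) = g m"
          unfolding sh g_def zeta_term_eq by (simp add: distrib_left sum_distrib_left mult_ac)
        finally show ?thesis .
      qed
      have "abel (translate N a ` pos_tuples N) (wt N) (zeta_term N Q P \<mu> (neg_point k))
          (mu_power N \<mu> a * (?S + (zeta N Q P \<mu> (neg_point k) + zeta N (diff_poly a Q) P \<mu> (neg_point k))))"
        by (rule abel_image[where w' = "wt N" and k = "wt N a" and g = g, OF ag inj_on_translate])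
           (simp_all add: fg wt_translate)
      \<comment> \<open>The same series over all tuples now has two Abel limits: the value of
        \<open>zeta\<close> and the contribution of the translate plus that of E(a). Uniqueness
        equates them.\<close>
      from abel_Un[OF this aE translate_disjoint]
      have "abel (pos_tuples N) (wt N) (zeta_term N Q P \<mu> (neg_point k))
          (mu_power N \<mu> a * (?S + (zeta N Q P \<mu> (neg_point k) + zeta N (diff_poly a Q) P \<mu> (neg_point k))) + FE (neg_point k))"
        unfolding pos_tuples_eq_translate_Un[symmetric] .
      from abel_unique[OF za[OF Q] this] show ?thesis unfolding zE by (simp add: algebra_simps)
    qed
    have sumE: "FE s = (\<Sum>q=0..N-1. \<Sum>I\<in>{I. I \<subseteq> {1..N} \<and> card I = q}.
           \<Sum>b\<in>(\<Pi>\<^sub>E i\<in>{1..N} - I. {1..a i}).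
             (\<Prod>i\<in>I. \<mu> i ^ a i) * (\<Prod>i\<in>{1..N} - I. \<mu> i ^ b i) *
             zeta q (restrict_poly a I b Q) (?rP I b) (?\<mu> I) s)" for s
    proof -
      let ?J = "{I. I \<subseteq> {1..N} \<and> card I < N}"
      let ?h = "\<lambda>I. \<Sum>b\<in>(\<Pi>\<^sub>E i\<in>{1..N} - I. {1..a i}). c I b * Z I b s"
      have finJ: "finite ?J" by (rule finite_subset[of _ "Pow {1..N}"]) auto
      have "FE s = (\<Sum>I\<in>?J. ?h I)"
        unfolding FE_def faces_def by (rule sum.Sigma[symmetric]) (use finJ in \<open>auto intro: finite_PiE\<close>)
      \<comment> \<open>Grouping the proper subsets by cardinality turns the single sum over faces
        into the sum over q.\<close>
      also have "\<dots> = (\<Sum>q\<in>{0..N-1}. \<Sum>I\<in>{I \<in> ?J. card I = q}. ?h I)"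
        by (rule sum.group[OF finJ, symmetric]) auto
      also have "\<dots> = (\<Sum>q=0..N-1. \<Sum>I\<in>{I. I \<subseteq> {1..N} \<and> card I = q}.
           \<Sum>b\<in>(\<Pi>\<^sub>E i\<in>{1..N} - I. {1..a i}).
             (\<Prod>i\<in>I. \<mu> i ^ a i) * (\<Prod>i\<in>{1..N} - I. \<mu> i ^ b i) *
             zeta q (restrict_poly a I b Q) (?rP I b) (?\<mu> I) s)"
        by (intro sum.cong refl) (use \<open>N \<ge> 1\<close> in \<open>auto simp: c_def Z_def\<close>)
      finally show ?thesis .
    qed
    show ?thesis
      using cE rel sumE face unfolding zE by blast
  qed
  show ?thesis using zc[OF Q] part by blast
qed

end
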